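(* Let $s \ge 2$ be an integer. There is a constant $C$ such that for every integer $k \ge s + C$, $$\min (S_k)' \le \frac{1}{\binom{k-11}{s-1}}.$$
   Context: For integers $s \ge 2$, $n \ge 1$ and $p\in[0,1]$, the random $s$-uniform hypergraph $G^s(n,p)$ is the random $s$-uniform hypergraph on vertex set $\{1,\dots,n\}$ in which each of the $\binom{n}{s}$ possible $s$-element edges is present independently with probability $p$. First-order properties of $s$-uniform hypergraphs are those expressible by first-order formulae built from the $s$-ary predicate symbol $N$ (meaning "these $s$ vertices form an edge"), equality, logical connectives, variables and quantifiers $\forall,\exists$ over vertices; the quantifier depth of a formula is the maximum number of nested quantifiers. For a first-order property $L$, its spectrum $S(L)$ is the set of all $\alpha \in (0, s-1)$ for which it is not the case that $\lim_{n\to\infty}\Pr[G^s(n,n^{-\alpha}) \models L]$ exists and equals $0$ or $1$. $S_k$ is the union of $S(L)$ over all first-order properties $L$ expressible by a formula of quantifier depth at most $k$ (equivalently, the set of $\alpha\in(0,s-1)$ for which $G^s(n,n^{-\alpha})$ fails the zero-one $k$-law). $(S_k)'$ denotes the set of limit points of $S_k$. *)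

theory Defs
  imports "HOL-Probability.Probability"
begin

text \<open>
  Hypergraphs are pairs of a vertex set and a set of edges. Formulae use named variables;
  \<open>Edge xs\<close> is the atom \<open>N(x\<^sub>1, \<dots>, x\<^sub>s)\<close>, whose arity \<open>s\<close> is enforced by \<open>has_arity\<close>.
\<close>

type_synonym hypergraph = "nat set \<times> nat set set"

datatype fo_formula =
    Edge "nat list"
  | Equal nat nat
  | Neg fo_formula
  | Conj fo_formula fo_formula
  | Disj fo_formula fo_formula
  | Impl fo_formula fo_formula
  | Equiv fo_formula fo_formula
  | Forall nat fo_formula
  | Exists nat fo_formula

fun has_arity :: "nat \<Rightarrow> fo_formula \<Rightarrow> bool" where
  "has_arity s (Edge xs) \<longleftrightarrow> length xs = s"
| "has_arity s (Equal x y) \<longleftrightarrow> True"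
| "has_arity s (Neg \<phi>) \<longleftrightarrow> has_arity s \<phi>"
| "has_arity s (Conj \<phi> \<psi>) \<longleftrightarrow> has_arity s \<phi> \<and> has_arity s \<psi>"
| "has_arity s (Disj \<phi> \<psi>) \<longleftrightarrow> has_arity s \<phi> \<and> has_arity s \<psi>"
| "has_arity s (Impl \<phi> \<psi>) \<longleftrightarrow> has_arity s \<phi> \<and> has_arity s \<psi>"
| "has_arity s (Equiv \<phi> \<psi>) \<longleftrightarrow> has_arity s \<phi> \<and> has_arity s \<psi>"
| "has_arity s (Forall x \<phi>) \<longleftrightarrow> has_arity s \<phi>"
| "has_arity s (Exists x \<phi>) \<longleftrightarrow> has_arity s \<phi>"

fun free_vars :: "fo_formula \<Rightarrow> nat set" where
  "free_vars (Edge xs) = set xs"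
| "free_vars (Equal x y) = {x, y}"
| "free_vars (Neg \<phi>) = free_vars \<phi>"
| "free_vars (Conj \<phi> \<psi>) = free_vars \<phi> \<union> free_vars \<psi>"
| "free_vars (Disj \<phi> \<psi>) = free_vars \<phi> \<union> free_vars \<psi>"
| "free_vars (Impl \<phi> \<psi>) = free_vars \<phi> \<union> free_vars \<psi>"
| "free_vars (Equiv \<phi> \<psi>) = free_vars \<phi> \<union> free_vars \<psi>"
| "free_vars (Forall x \<phi>) = free_vars \<phi> - {x}"
| "free_vars (Exists x \<phi>) = free_vars \<phi> - {x}"

fun quantifier_depth :: "fo_formula \<Rightarrow> nat" where
  "quantifier_depth (Edge xs) = 0"
| "quantifier_depth (Equal x y) = 0"
| "quantifier_depth (Neg \<phi>) = quantifier_depth \<phi>"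
| "quantifier_depth (Conj \<phi> \<psi>) = max (quantifier_depth \<phi>) (quantifier_depth \<psi>)"
| "quantifier_depth (Disj \<phi> \<psi>) = max (quantifier_depth \<phi>) (quantifier_depth \<psi>)"
| "quantifier_depth (Impl \<phi> \<psi>) = max (quantifier_depth \<phi>) (quantifier_depth \<psi>)"
| "quantifier_depth (Equiv \<phi> \<psi>) = max (quantifier_depth \<phi>) (quantifier_depth \<psi>)"
| "quantifier_depth (Forall x \<phi>) = Suc (quantifier_depth \<phi>)"
| "quantifier_depth (Exists x \<phi>) = Suc (quantifier_depth \<phi>)"

text \<open>
  In an \<open>s\<close>-uniform hypergraph, an atom with \<open>s\<close> arguments can only hold if these are pairwise
  distinct, since otherwise the set of their values has fewer than \<open>s\<close> elements.
\<close>

fun sat :: "hypergraph \<Rightarrow> (nat \<Rightarrow> nat) \<Rightarrow> fo_formula \<Rightarrow> bool" where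
  "sat H v (Edge xs) \<longleftrightarrow> v ` set xs \<in> snd H"
| "sat H v (Equal x y) \<longleftrightarrow> v x = v y"
| "sat H v (Neg \<phi>) \<longleftrightarrow> \<not> sat H v \<phi>"
| "sat H v (Conj \<phi> \<psi>) \<longleftrightarrow> sat H v \<phi> \<and> sat H v \<psi>"
| "sat H v (Disj \<phi> \<psi>) \<longleftrightarrow> sat H v \<phi> \<or> sat H v \<psi>"
| "sat H v (Impl \<phi> \<psi>) \<longleftrightarrow> (sat H v \<phi> \<longrightarrow> sat H v \<psi>)"
| "sat H v (Equiv \<phi> \<psi>) \<longleftrightarrow> (sat H v \<phi> \<longleftrightarrow> sat H v \<psi>)"
| "sat H v (Forall x \<phi>) \<longleftrightarrow> (\<forall>a\<in>fst H. sat H (v(x := a)) \<phi>)"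
| "sat H v (Exists x \<phi>) \<longleftrightarrow> (\<exists>a\<in>fst H. sat H (v(x := a)) \<phi>)"

definition models :: "hypergraph \<Rightarrow> fo_formula \<Rightarrow> bool" where
  "models H \<phi> \<longleftrightarrow> (\<forall>v. range v \<subseteq> fst H \<longrightarrow> sat H v \<phi>)"

definition fo_properties :: "nat \<Rightarrow> nat \<Rightarrow> hypergraph set set" where
  "fo_properties s k =
     {{H. models H \<phi>} | \<phi>. has_arity s \<phi> \<and> free_vars \<phi> = {} \<and> quantifier_depth \<phi> \<le> k}"

definition possible_edges :: "nat \<Rightarrow> nat \<Rightarrow> nat set set" where
  "possible_edges s n = {e. e \<subseteq> {1..n} \<and> card e = s}"

definition random_hypergraph :: "nat \<Rightarrow> nat \<Rightarrow> real \<Rightarrow> hypergraph pmf" where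
  "random_hypergraph s n p =
     map_pmf (\<lambda>present. ({1..n}, {e \<in> possible_edges s n. present e}))
       (Pi_pmf (possible_edges s n) False (\<lambda>_. bernoulli_pmf p))"

definition spectrum :: "nat \<Rightarrow> hypergraph set \<Rightarrow> real set" where
  "spectrum s L =
     {\<alpha> \<in> {0<..<real s - 1}.
        \<not> ((\<lambda>n. measure_pmf.prob (random_hypergraph s n (real n powr - \<alpha>)) L) \<longlonglongrightarrow> 0 \<or>
           (\<lambda>n. measure_pmf.prob (random_hypergraph s n (real n powr - \<alpha>)) L) \<longlonglongrightarrow> 1)}"

definition spectrum_upto :: "nat \<Rightarrow> nat \<Rightarrow> real set" where
  "spectrum_upto s k = (\<Union>L\<in>fo_properties s k. spectrum s L)"

definition limit_points :: "real set \<Rightarrow> real set" where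
  "limit_points A = {x. x islimpt A}"

end

theory Submission
  imports Defs
begin

text \<open>
  Put \<open>m = k - 11\<close> and \<open>M = (m choose (s - 1))\<close>, and say that \<open>u\<close> is joined to a vertex set \<open>B\<close> if all sets
  \<open>{u} \<union> S\<close> with \<open>S \<subseteq> B\<close> and \<open>|S| = s - 1\<close> are edges. If \<open>\<alpha> M = 1 + \<epsilon>\<close>, attaching a new vertex to a
  given \<open>m\<close>-set multiplies the expected number of copies of a configuration by about \<open>n powr (- \<epsilon>)\<close>, while
  every free vertex contributes a factor \<open>n\<close>.

  For distinct vertices \<open>a\<^sub>0\<close>, ..., \<open>a\<^sub>m\<close> let the cluster \<open>N\<^sub>i\<close> consist of the vertices joined to all \<open>a\<^sub>j\<close> with
  \<open>j \<noteq> i\<close>. Say that \<open>p\<close> covers a set \<open>Y\<close> if for every \<open>y \<in> Y\<close> some \<open>u\<close> is joined to \<open>{y, p, a\<^sub>3, ..., a\<^sub>m}\<close>.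
  If \<open>d \<epsilon> < 1 < (d + 1) \<epsilon>\<close>, then asymptotically almost surely every set of at most \<open>d\<close> vertices can be covered,
  whereas covering \<open>d + 1\<close> vertices has negative exponent. Hence the sentence ``there are \<open>a\<^sub>0\<close>, ..., \<open>a\<^sub>m\<close>
  and \<open>b \<in> N\<^sub>0\<close> such that no \<open>N\<^sub>i \<union> {b}\<close> can be covered'' forces \<open>|N\<^sub>0| \<ge> d + 1\<close> and \<open>|N\<^sub>i| \<ge> d\<close>: it
  asserts the existence of a configuration with \<open>m + 1\<close> free vertices and \<open>(m + 1) d + 1\<close> attached ones, and
  conversely such a configuration at its threshold leaves no room for a cover. Its threshold is
  \<open>\<epsilon> = (m + 1) / ((m + 1) d + 1)\<close>. There the first moment (copies come in pairs) bounds the probability by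
  \<open>1 / 2\<close> from above, and the second moment bounds it away from \<open>0\<close>. The sentence does not depend on \<open>d\<close>, so
  letting \<open>d\<close> tend to infinity exhibits \<open>1 / M\<close> as a limit point.
\<close>

section \<open>Independence in product distributions\<close>

text \<open>The product over \<open>I\<close> splits into the products over
  \<open>I \<inter> K\<close> and \<open>I - K\<close>, and each of these is a marginal of a full
  sample. So the two halves may be read off two independent full samples.\<close>

lemma Pi_pmf_resample:
  fixes I :: "'a set" and d :: 'b
  assumes "finite I"
  shows "map_pmf (\<lambda>(g, f) x. if x \<in> K then g x else f x)
           (pair_pmf (Pi_pmf I d q) (Pi_pmf I d q)) = Pi_pmf I d q"
proof -
  let ?Q = "Pi_pmf I d q"
  define r where "r = (\<lambda>J f (x::'a). if x \<in> J then f x else d)"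
  have sub: "Pi_pmf J d q = map_pmf (r J) ?Q" if "J \<subseteq> I" for J
    using Pi_pmf_subset[OF assms that] by (simp add: r_def)
  have un: "(I \<inter> K) \<union> (I - K) = I" by auto
  have "?Q = map_pmf (\<lambda>(f, g) x. if x \<in> I \<inter> K then f x else g x)
             (pair_pmf (Pi_pmf (I \<inter> K) d q) (Pi_pmf (I - K) d q))"
    using Pi_pmf_union[of "I \<inter> K" "I - K" d q] assms unfolding un by auto
  also have "\<dots> = map_pmf (\<lambda>(f, g) x. if x \<in> I \<inter> K then r (I \<inter> K) f x else r (I - K) g x)
             (pair_pmf ?Q ?Q)"
    unfolding sub[OF Int_lower1] sub[OF Diff_subset] map_pair[symmetric] pmf.map_comp
    by (intro map_pmf_cong) (auto simp: fun_eq_iff)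
  \<comment> \<open>Off \<open>I\<close> every sample in the support has the value \<open>d\<close>,
    so the truncation by \<open>r\<close> changes nothing there.\<close>
  also have "\<dots> = map_pmf (\<lambda>(g, f) x. if x \<in> K then g x else f x) (pair_pmf ?Q ?Q)"
    using set_Pi_pmf_subset[OF assms, of d q]
    by (intro map_pmf_cong) (fastforce simp: r_def fun_eq_iff)+
  finally show ?thesis by simp
qed

text \<open>Fubini for the resampled pair: \<open>g\<close> fixes the coordinates in
  \<open>K\<close>, and the event is then judged under a fresh \<open>f\<close>. This replaces
  conditioning on the coordinates in \<open>K\<close>.\<close>

lemma prob_Pi_pmf_resample:
  assumes "finite I"
  shows "measure_pmf.prob (Pi_pmf I d q) {f. P f} =
    measure_pmf.expectation (Pi_pmf I d q)
      (\<lambda>g. measure_pmf.prob (Pi_pmf I d q) {f. P (\<lambda>x. if x \<in> K then g x else f x)})"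
    (is "?l = measure_pmf.expectation ?Q ?h")
proof -
  have "ennreal ?l = emeasure (map_pmf (\<lambda>(g, f) x. if x \<in> K then g x else f x) (pair_pmf ?Q ?Q)) {f. P f}"
    unfolding Pi_pmf_resample[OF assms] by (simp add: measure_pmf.emeasure_eq_measure)
  also have "\<dots> = (\<integral>\<^sup>+g. ennreal (?h g) \<partial>?Q)"
    by (simp add: pair_pmf_def map_bind_pmf map_pmf_def[symmetric] pmf.map_comp vimage_def
        measure_pmf.emeasure_eq_measure[symmetric] o_def emeasure_map_pmf bind_return_pmf'
        del: emeasure_measure_pmf_not_zero)
  also have "\<dots> = ennreal (measure_pmf.expectation ?Q ?h)"
    by (intro nn_integral_eq_integral measure_pmf.integrable_const_bound[where B=1]) auto
  finally show ?thesis by (simp add: integral_nonneg_AE)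
qed

text \<open>A discrete form of measurability with respect to the coordinates in
  \<open>K\<close>.\<close>

definition depends_only_on :: "(('a \<Rightarrow> 'b) \<Rightarrow> bool) \<Rightarrow> 'a set \<Rightarrow> bool" where
  "depends_only_on P K \<longleftrightarrow> (\<forall>f g. (\<forall>x\<in>K. f x = g x) \<longrightarrow> P f = P g)"

lemma depends_only_onD:
  "depends_only_on P K \<Longrightarrow> (\<And>x. x \<in> K \<Longrightarrow> f x = g x) \<Longrightarrow> P f = P g"
  unfolding depends_only_on_def by blast

text \<open>After resampling on \<open>K\<close>, the event \<open>P\<close> sees only
  \<open>g\<close> and \<open>R\<close> sees only \<open>f\<close>, so the average factors.\<close>

lemma prob_Pi_pmf_conj:
  assumes "finite I" "depends_only_on P K" "depends_only_on R L" "K \<inter> L = {}"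
  shows "measure_pmf.prob (Pi_pmf I d q) {f. P f \<and> R f} =
    measure_pmf.prob (Pi_pmf I d q) {f. P f} * measure_pmf.prob (Pi_pmf I d q) {f. R f}"
proof -
  let ?Q = "Pi_pmf I d q"
  have P: "P (\<lambda>x. if x \<in> K then g x else f x) = P g" for f g
    by (rule depends_only_onD[OF assms(2)]) simp
  have R: "R (\<lambda>x. if x \<in> K then g x else f x) = R f" for f g
    by (rule depends_only_onD[OF assms(3)]) (use assms(4) in auto)
  have "measure_pmf.prob ?Q {f. P f \<and> R f} =
      measure_pmf.expectation ?Q (\<lambda>g. measure_pmf.prob ?Q {f. P g \<and> R f})"
    by (subst prob_Pi_pmf_resample[OF assms(1), where K=K]) (simp add: P R)
  also have "\<dots> = measure_pmf.expectation ?Q (\<lambda>g. indicator {g. P g} g * measure_pmf.prob ?Q {f. R f})"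
    by (intro Bochner_Integration.integral_cong) (auto simp: indicator_def)
  finally show ?thesis by simp
qed

lemma prob_Pi_pmf_Ball:
  fixes I :: "'a set" and d :: 'b
  assumes "finite I" "finite J" "\<And>j. j \<in> J \<Longrightarrow> depends_only_on (P j) (K j)"
    and "disjoint_family_on K J"
  shows "measure_pmf.prob (Pi_pmf I d q) {f. \<forall>j\<in>J. P j f} =
    (\<Prod>j\<in>J. measure_pmf.prob (Pi_pmf I d q) {f. P j f})"
  using assms(2,3,4)
proof (induction J rule: finite_induct)
  case (insert j J)
  have "depends_only_on (\<lambda>f. \<forall>j\<in>J. P j f) (\<Union>j\<in>J. K j)"
    unfolding depends_only_on_def
  proof (intro allI impI)
    fix f g :: "'a \<Rightarrow> 'b" assume "\<forall>x\<in>\<Union> (K ` J). f x = g x"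
    then have "P i f = P i g" if "i \<in> J" for i
      using that insert.prems(1)[of i] depends_only_onD[of "P i" "K i" f g] by auto
    then show "(\<forall>j\<in>J. P j f) = (\<forall>j\<in>J. P j g)" by blast
  qed
  moreover have "K j \<inter> (\<Union>j\<in>J. K j) = {}"
    using insert.prems(2) insert.hyps(2) by (fastforce simp: disjoint_family_on_def)
  ultimately have "measure_pmf.prob (Pi_pmf I d q) {f. P j f \<and> (\<forall>j\<in>J. P j f)} =
    measure_pmf.prob (Pi_pmf I d q) {f. P j f} * measure_pmf.prob (Pi_pmf I d q) {f. \<forall>j\<in>J. P j f}"
    by (intro prob_Pi_pmf_conj[OF assms(1)]) (use insert.prems in auto)
  then show ?case
    using insert by (simp add: disjoint_family_on_def)
qed auto

lemma prob_bernoulli_all: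
  assumes "finite I" "F \<subseteq> I" "0 \<le> p" "p \<le> 1"
  shows "measure_pmf.prob (Pi_pmf I False (\<lambda>_. bernoulli_pmf p)) {f. \<forall>e\<in>F. f e} = p ^ card F"
proof -
  have F: "finite F" using assms finite_subset by blast
  have eq: "{f. \<forall>e\<in>F. f e} = Pi I (\<lambda>e. if e \<in> F then {True} else UNIV)"
    using assms by (auto simp: Pi_def)
  have "measure_pmf.prob (Pi_pmf I False (\<lambda>_. bernoulli_pmf p)) {f. \<forall>e\<in>F. f e} =
     (\<Prod>e\<in>I. if e \<in> F then p else 1)"
    unfolding eq using assms
    by (subst measure_Pi_pmf_Pi) (auto intro!: prod.cong simp: measure_pmf_single)
  also have "\<dots> = p ^ card F"
    using assms F by (subst prod.inter_restrict[symmetric]) (auto simp: Int_absorb1)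
  finally show ?thesis .
qed

text \<open>Two-round exposure: in the average over the first round \<open>g\<close>, a bad
  \<open>g\<close> contributes at most 1 and a good one at most \<open>c\<close>.\<close>

lemma prob_Pi_pmf_two_stage:
  assumes "finite I"
    and "\<And>g. Good g \<Longrightarrow>
      measure_pmf.prob (Pi_pmf I d q) {f. P (\<lambda>x. if x \<in> K then g x else f x)} \<le> c"
    and "c \<ge> 0"
  shows "measure_pmf.prob (Pi_pmf I d q) {f. P f} \<le>
     measure_pmf.prob (Pi_pmf I d q) {f. \<not> Good f} + c"
proof -
  let ?Q = "Pi_pmf I d q"
  have "measure_pmf.prob ?Q {f. P f} = measure_pmf.expectation ?Q
      (\<lambda>g. measure_pmf.prob ?Q {f. P (\<lambda>x. if x \<in> K then g x else f x)})"
    by (rule prob_Pi_pmf_resample[OF assms(1)])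
  also have "\<dots> \<le> measure_pmf.expectation ?Q (\<lambda>g. indicator {f. \<not> Good f} g + c)"
  proof (intro integral_mono)
    show "integrable ?Q (\<lambda>g. measure_pmf.prob ?Q {f. P (\<lambda>x. if x \<in> K then g x else f x)})"
      by (rule measure_pmf.integrable_const_bound[where B=1]) auto
    show "integrable ?Q (\<lambda>g. indicator {f. \<not> Good f} g + c)"
      by (rule measure_pmf.integrable_const_bound[where B="1 + c"]) (use assms(3) in \<open>auto simp: indicator_def\<close>)
    fix g
    show "measure_pmf.prob ?Q {f. P (\<lambda>x. if x \<in> K then g x else f x)} \<le>
      indicator {f. \<not> Good f} g + c"
      using assms(2)[of g] assms(3)
      by (cases "Good g") (auto intro: order_trans[OF measure_pmf.prob_le_1])
  qed
  also have "\<dots> = measure_pmf.prob ?Q {f. \<not> Good f} + c"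
    by (subst Bochner_Integration.integral_add) (auto intro!: measure_pmf.integrable_const_bound[where B=1])
  finally show ?thesis .
qed

section \<open>First and second moments of the number of copies\<close>

abbreviation edge_indicator_pmf :: "nat \<Rightarrow> nat \<Rightarrow> real \<Rightarrow> (nat set \<Rightarrow> bool) pmf" where
  "edge_indicator_pmf s n p \<equiv> Pi_pmf (possible_edges s n) False (\<lambda>_. bernoulli_pmf p)"

lemma finite_possible_edges [simp]: "finite (possible_edges s n)"
  by (rule finite_subset[of _ "Pow {1..n}"]) (auto simp: possible_edges_def)

lemma finite_set_edge_indicator_pmf [simp]: "finite (set_pmf (edge_indicator_pmf s n p))"
  by (rule finite_subset[OF set_Pi_pmf_subset']) (auto intro!: finite_PiE_dflt)

lemma integrable_edge_indicator_pmf [simp]: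
  fixes h :: "_ \<Rightarrow> real" shows "integrable (edge_indicator_pmf s n p) h"
  by (rule integrable_measure_pmf_finite) simp

definition placements :: "'v set \<Rightarrow> nat \<Rightarrow> ('v \<Rightarrow> nat) set" where
  "placements V n = {\<phi> \<in> V \<rightarrow>\<^sub>E {1..n}. inj_on \<phi> V}"

text \<open>Copies are labelled and need not be induced, so composing one with an automorphism of
  the pattern gives a copy again.\<close>

definition copies :: "'v set \<Rightarrow> 'v set set \<Rightarrow> nat \<Rightarrow> (nat set \<Rightarrow> bool) \<Rightarrow> ('v \<Rightarrow> nat) set" where
  "copies V E n f = {\<phi> \<in> placements V n. \<forall>e\<in>E. f (\<phi> ` e)}"

definition uniform_pattern :: "nat \<Rightarrow> 'v set \<Rightarrow> 'v set set \<Rightarrow> bool" where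
  "uniform_pattern s V E \<longleftrightarrow> finite V \<and> E \<subseteq> {e. e \<subseteq> V \<and> card e = s}"

lemma uniform_patternD:
  assumes "uniform_pattern s V E"
  shows "finite V" "finite E" "\<And>e. e \<in> E \<Longrightarrow> e \<subseteq> V" "\<And>e. e \<in> E \<Longrightarrow> card e = s"
proof -
  show "finite V" "\<And>e. e \<in> E \<Longrightarrow> e \<subseteq> V" "\<And>e. e \<in> E \<Longrightarrow> card e = s"
    using assms by (auto simp: uniform_pattern_def)
  then show "finite E" by (meson PowI finite_Pow_iff finite_subset subsetI)
qed

lemma finite_placements [simp]: "finite V \<Longrightarrow> finite (placements V n)"
  unfolding placements_def by (rule finite_subset[of _ "V \<rightarrow>\<^sub>E {1..n}"]) (auto intro: finite_PiE)

lemma card_placements_le: "finite V \<Longrightarrow> card (placements V n) \<le> n ^ card V"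
  using card_mono[of "V \<rightarrow>\<^sub>E {1..n}" "placements V n"]
  by (auto simp: placements_def card_funcsetE finite_PiE)

lemma card_placements_ge:
  assumes "finite V" "card V \<le> n"
  shows "(n - card V) ^ card V \<le> card (placements V n)"
proof -
  have "(n - card V) ^ card V = (\<Prod>i\<in>{0..<card V}. n - card V)" by simp
  also have "\<dots> \<le> (\<Prod>i\<in>{0..<card V}. n - i)"
    by (rule prod_mono) auto
  also have "\<dots> = card (placements V n)"
    using card_inj_on_subset_funcset[of V "{1..n}" V] assms
    by (simp add: placements_def)
  finally show ?thesis .
qed

lemma inj_on_image_pattern:
  assumes "uniform_pattern s V E" "inj_on \<phi> V"
  shows "inj_on ((`) \<phi>) E"
  using assms inj_on_image[of \<phi> E] uniform_patternD(3)[OF assms(1)]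
  by (metis Sup_le_iff inj_on_subset)

lemma placement_edges:
  assumes "uniform_pattern s V E" "\<phi> \<in> placements V n"
  shows "(`) \<phi> ` E \<subseteq> possible_edges s n" "card ((`) \<phi> ` E) = card E"
proof -
  have inj: "inj_on \<phi> V" and rng: "\<phi> \<in> V \<rightarrow> {1..n}"
    using assms(2) by (auto simp: placements_def)
  show "(`) \<phi> ` E \<subseteq> possible_edges s n"
    using uniform_patternD(3,4)[OF assms(1)] rng inj
    by (fastforce simp: possible_edges_def card_image inj_on_subset)
  show "card ((`) \<phi> ` E) = card E"
    by (rule card_image) (rule inj_on_image_pattern[OF assms(1) inj])
qed

section \<open>First-moment upper bounds\<close>

lemma expectation_card_copies:
  assumes "uniform_pattern s V E" "0 \<le> p" "p \<le> 1"
  shows "measure_pmf.expectation (edge_indicator_pmf s n p) (\<lambda>f. real (card (copies V E n f))) =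
    real (card (placements V n)) * p ^ card E"
proof -
  note fin = uniform_patternD(1)[OF assms(1)]
  have X: "real (card (copies V E n f)) =
      (\<Sum>\<phi>\<in>placements V n. indicator {f. \<forall>e\<in>(`) \<phi> ` E. f e} f)" for f
    using fin by (simp add: copies_def indicator_def sum.If_cases Int_def)
  have "measure_pmf.expectation (edge_indicator_pmf s n p) (\<lambda>f. real (card (copies V E n f))) =
    (\<Sum>\<phi>\<in>placements V n. measure_pmf.prob (edge_indicator_pmf s n p) {f. \<forall>e\<in>(`) \<phi> ` E. f e})"
    unfolding X by (subst Bochner_Integration.integral_sum) auto
  also have "\<dots> = (\<Sum>\<phi>\<in>placements V n. p ^ card E)"
    using placement_edges[OF assms(1)] assms(2,3)
    by (intro sum.cong refl) (subst prob_bernoulli_all, auto)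
  finally show ?thesis by simp
qed

text \<open>Markov's inequality, better by a factor \<open>r\<close> when copies never occur fewer
  than \<open>r\<close> at a time.\<close>

lemma prob_copies_le:
  assumes "uniform_pattern s V E" "0 \<le> p" "p \<le> 1"
    and "\<And>f. copies V E n f \<noteq> {} \<Longrightarrow> r \<le> card (copies V E n f)"
  shows "real r * measure_pmf.prob (edge_indicator_pmf s n p) {f. copies V E n f \<noteq> {}} \<le>
    real n ^ card V * p ^ card E"
proof -
  let ?Q = "edge_indicator_pmf s n p"
  have "real r * measure_pmf.prob ?Q {f. copies V E n f \<noteq> {}} =
    measure_pmf.expectation ?Q (\<lambda>f. real r * indicator {f. copies V E n f \<noteq> {}} f)"
    by simp
  also have "\<dots> \<le> measure_pmf.expectation ?Q (\<lambda>f. real (card (copies V E n f)))"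
    using assms(4) by (intro integral_mono) (auto simp: indicator_def)
  also have "\<dots> = real (card (placements V n)) * p ^ card E"
    by (rule expectation_card_copies[OF assms(1-3)])
  also have "\<dots> \<le> real n ^ card V * p ^ card E"
    using card_placements_le[OF uniform_patternD(1)[OF assms(1)], of n] assms(2)
    by (intro mult_right_mono) (auto simp flip: of_nat_power)
  finally show ?thesis .
qed

lemma finite_copies: "finite V \<Longrightarrow> finite (copies V E n f)"
  unfolding copies_def by (auto intro: finite_subset[OF _ finite_placements])

lemma prob_copies_le1:
  assumes "uniform_pattern s V E" "0 \<le> p" "p \<le> 1"
  shows "measure_pmf.prob (edge_indicator_pmf s n p) {f. copies V E n f \<noteq> {}} \<le>
    real n ^ card V * p ^ card E"
  using prob_copies_le[OF assms, of n 1] finite_copies[OF uniform_patternD(1)[OF assms(1)]]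
  by (simp add: Suc_le_eq card_gt_0_iff)

text \<open>A nontrivial automorphism makes copies come in pairs.\<close>

lemma prob_copies_le_half:
  assumes "uniform_pattern s V E" "0 \<le> p" "p \<le> 1"
    and "bij_betw \<sigma> V V" "(`) ((`) \<sigma>) E \<subseteq> E" "v \<in> V" "\<sigma> v \<noteq> v"
  shows "measure_pmf.prob (edge_indicator_pmf s n p) {f. copies V E n f \<noteq> {}} \<le>
    real n ^ card V * p ^ card E / 2"
proof -
  note D = uniform_patternD[OF assms(1)]
  have "2 \<le> card (copies V E n f)" if ne: "copies V E n f \<noteq> {}" for f
  proof -
    from ne obtain \<phi> where \<phi>: "\<phi> \<in> copies V E n f" by auto
    define \<psi> where "\<psi> = restrict (\<phi> \<circ> \<sigma>) V"
    have \<sigma>: "\<sigma> ` V = V" "inj_on \<sigma> V" using assms(4) by (auto simp: bij_betw_def)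
    have \<phi>': "\<phi> \<in> V \<rightarrow>\<^sub>E {1..n}" "inj_on \<phi> V" "\<And>e. e \<in> E \<Longrightarrow> f (\<phi> ` e)"
      using \<phi> by (auto simp: copies_def placements_def)
    have "\<psi> ` e = \<phi> ` (\<sigma> ` e)" if "e \<in> E" for e
      using D(3)[OF that] by (force simp: \<psi>_def image_image)
    then have "\<forall>e\<in>E. f (\<psi> ` e)" using \<phi>'(3) assms(5) by auto
    moreover have "\<psi> \<in> V \<rightarrow>\<^sub>E {1..n}"
      unfolding \<psi>_def using \<phi>'(1) \<sigma>(1) by (simp add: PiE_iff) blast
    moreover have "inj_on \<psi> V"
      using \<phi>'(2) \<sigma> by (auto simp: \<psi>_def inj_on_restrict_eq intro!: comp_inj_on)
    ultimately have "\<psi> \<in> copies V E n f"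
      by (auto simp: copies_def placements_def)
    moreover have "\<psi> v \<noteq> \<phi> v"
      using assms(6,7) \<sigma>(1) inj_onD[OF \<phi>'(2), of "\<sigma> v" v] by (auto simp: \<psi>_def)
    ultimately have "card {\<phi>, \<psi>} \<le> card (copies V E n f)" "\<phi> \<noteq> \<psi>"
      using \<phi> finite_copies[OF D(1)] by (auto intro!: card_mono)
    then show ?thesis by simp
  qed
  from prob_copies_le[OF assms(1-3) this] show ?thesis by simp
qed

section \<open>Second moment and the lower bound at the threshold\<close>

lemma expectation_card_copies_squared:
  assumes "uniform_pattern s V E" "0 \<le> p" "p \<le> 1"
  shows "measure_pmf.expectation (edge_indicator_pmf s n p) (\<lambda>f. (real (card (copies V E n f)))\<^sup>2) =
    (\<Sum>\<phi>\<in>placements V n. \<Sum>\<psi>\<in>placements V n. p ^ card ((`) \<phi> ` E \<union> (`) \<psi> ` E))"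
proof -
  note fin = uniform_patternD(1)[OF assms(1)]
  have X: "real (card (copies V E n f)) =
      (\<Sum>\<phi>\<in>placements V n. indicator {f. \<forall>e\<in>(`) \<phi> ` E. f e} f)" for f
    using fin by (simp add: copies_def indicator_def sum.If_cases Int_def)
  have X2: "(real (card (copies V E n f)))\<^sup>2 =
      (\<Sum>\<phi>\<in>placements V n. \<Sum>\<psi>\<in>placements V n. indicator {f. \<forall>e\<in>(`) \<phi> ` E \<union> (`) \<psi> ` E. f e} f)" for f
    unfolding X power2_eq_square sum_product
    by (intro sum.cong refl) (auto simp: indicator_def)
  have "measure_pmf.expectation (edge_indicator_pmf s n p) (\<lambda>f. (real (card (copies V E n f)))\<^sup>2) =
    (\<Sum>\<phi>\<in>placements V n. \<Sum>\<psi>\<in>placements V n.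
      measure_pmf.prob (edge_indicator_pmf s n p) {f. \<forall>e\<in>(`) \<phi> ` E \<union> (`) \<psi> ` E. f e})"
    unfolding X2 by (subst Bochner_Integration.integral_sum, simp)+ simp
  also have "\<dots> = (\<Sum>\<phi>\<in>placements V n. \<Sum>\<psi>\<in>placements V n. p ^ card ((`) \<phi> ` E \<union> (`) \<psi> ` E))"
    using placement_edges(1)[OF assms(1)] assms(2,3)
    by (intro sum.cong refl prob_bernoulli_all) auto
  finally show ?thesis .
qed

text \<open>The pointwise inequality \<open>[X > 0] \<ge> 2 t X - t\<^sup>2 X\<^sup>2\<close> replaces the Cauchy--Schwarz inequality.\<close>

lemma prob_copies_second_moment:
  assumes "uniform_pattern s V E"
    and "measure_pmf.expectation (edge_indicator_pmf s n p) (\<lambda>f. (real (card (copies V E n f)))\<^sup>2) \<le> C"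
    and "measure_pmf.expectation (edge_indicator_pmf s n p) (\<lambda>f. real (card (copies V E n f))) \<ge> 1 / 2"
    and "C > 0"
  shows "1 / (4 * C) \<le> measure_pmf.prob (edge_indicator_pmf s n p) {f. copies V E n f \<noteq> {}}"
proof -
  let ?Q = "edge_indicator_pmf s n p" and ?X = "\<lambda>f. real (card (copies V E n f))"
  define t where "t = 1 / (2 * C)"
  have t: "t > 0" using assms(4) by (simp add: t_def)
  have "1 / (4 * C) = 2 * t * (1 / 2) - t\<^sup>2 * C"
    using assms(4) by (simp add: t_def field_simps power2_eq_square)
  also have "\<dots> \<le> 2 * t * measure_pmf.expectation ?Q ?X - t\<^sup>2 * measure_pmf.expectation ?Q (\<lambda>f. (?X f)\<^sup>2)"
    using assms(2,3) t by (intro diff_mono mult_left_mono) auto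
  also have "\<dots> = measure_pmf.expectation ?Q (\<lambda>f. 2 * t * ?X f - t\<^sup>2 * (?X f)\<^sup>2)"
    by simp
  also have "\<dots> \<le> measure_pmf.expectation ?Q (indicator {f. copies V E n f \<noteq> {}})"
  proof (rule integral_mono)
    fix f
    have "2 * t * ?X f - t\<^sup>2 * (?X f)\<^sup>2 = 1 - (t * ?X f - 1)\<^sup>2"
      by (simp add: power2_eq_square algebra_simps)
    then show "2 * t * ?X f - t\<^sup>2 * (?X f)\<^sup>2 \<le> indicator {f. copies V E n f \<noteq> {}} f"
      by (cases "copies V E n f = {}") auto
  qed auto
  finally show ?thesis by simp
qed

text \<open>At edge probability \<open>n powr - \<alpha>\<close> the expected number of copies of
  the subpattern induced on \<open>J\<close> has exponent
  \<open>card J - \<alpha> * card {e \<in> E. e \<subseteq> J}\<close>. Balance says that this is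
  negative for no \<open>J\<close>.\<close>

definition balanced :: "real \<Rightarrow> 'v set \<Rightarrow> 'v set set \<Rightarrow> bool" where
  "balanced \<alpha> V E \<longleftrightarrow> (\<forall>J\<subseteq>V. \<alpha> * card {e \<in> E. e \<subseteq> J} \<le> card J)"

text \<open>Common edges come from pattern edges inside the set \<open>J\<close> of vertices that
  \<open>\<psi>\<close> sends into the image of \<open>\<phi>\<close>, so balance bounds
  \<open>\<alpha>\<close> times their number by \<open>card J\<close>. The factor
  \<open>n ^ card J\<close> is written as a product over vertices to let a sum over
  \<open>\<psi>\<close> factor.\<close>

lemma overlap_bound:
  assumes "uniform_pattern s V E" "balanced \<alpha> V E" "0 < \<alpha>" "n \<ge> 1"
    and "\<phi> \<in> placements V n" "\<psi> \<in> placements V n"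
  shows "(real n powr - \<alpha>) ^ card ((`) \<phi> ` E \<union> (`) \<psi> ` E) \<le>
    real n powr (- 2 * \<alpha> * card E) * (\<Prod>v\<in>V. if \<psi> v \<in> \<phi> ` V then real n else 1)"
proof -
  note D = uniform_patternD[OF assms(1)]
  define J where "J = {v \<in> V. \<psi> v \<in> \<phi> ` V}"
  have inj: "inj_on \<psi> V" using assms(6) by (simp add: placements_def)
  have "(`) \<phi> ` E \<inter> (`) \<psi> ` E \<subseteq> (`) \<psi> ` {e \<in> E. e \<subseteq> J}"
  proof
    fix x assume "x \<in> (`) \<phi> ` E \<inter> (`) \<psi> ` E"
    then obtain e e' where e: "e \<in> E" "e' \<in> E" "x = \<psi> ` e" "x = \<phi> ` e'" by auto
    then have "e \<subseteq> J" unfolding J_def using D(3) by blast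
    with e show "x \<in> (`) \<psi> ` {e \<in> E. e \<subseteq> J}" by auto
  qed
  then have "card ((`) \<phi> ` E \<inter> (`) \<psi> ` E) \<le> card {e \<in> E. e \<subseteq> J}"
    using D(2) by (intro order_trans[OF card_mono card_image_le]) auto
  then have "\<alpha> * card ((`) \<phi> ` E \<inter> (`) \<psi> ` E) \<le> \<alpha> * card {e \<in> E. e \<subseteq> J}"
    using assms(3) by simp
  also have "\<dots> \<le> card J" using assms(2) by (auto simp: balanced_def J_def)
  finally have le: "\<alpha> * card ((`) \<phi> ` E \<inter> (`) \<psi> ` E) \<le> card J" .
  have "card ((`) \<phi> ` E) + card ((`) \<psi> ` E) =
      card ((`) \<phi> ` E \<union> (`) \<psi> ` E) + card ((`) \<phi> ` E \<inter> (`) \<psi> ` E)"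
    using D(2) by (intro card_Un_Int) auto
  then have eq: "real (card ((`) \<phi> ` E \<union> (`) \<psi> ` E)) =
      2 * card E - real (card ((`) \<phi> ` E \<inter> (`) \<psi> ` E))"
    using placement_edges(2)[OF assms(1,5)] placement_edges(2)[OF assms(1,6)] by simp
  have "(real n powr - \<alpha>) ^ card ((`) \<phi> ` E \<union> (`) \<psi> ` E) =
      real n powr (- \<alpha> * card ((`) \<phi> ` E \<union> (`) \<psi> ` E))"
    using assms(4) by (simp add: powr_realpow[symmetric] powr_powr)
  also have "\<dots> \<le> real n powr (- 2 * \<alpha> * card E + card J)"
    using le assms(4) by (intro powr_mono) (auto simp: eq algebra_simps)
  also have "\<dots> = real n powr (- 2 * \<alpha> * card E) * real n ^ card J"
    using assms(4) by (simp add: powr_add powr_realpow del: add_uminus_conv_diff uminus_add_conv_diff)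
  also have "real n ^ card J = (\<Prod>v\<in>V. if \<psi> v \<in> \<phi> ` V then real n else 1)"
    using D(1) by (simp add: J_def prod.If_cases Int_def)
  finally show ?thesis .
qed

text \<open>For fixed \<open>\<phi>\<close>, at most \<open>card V\<close> of the possible values of
  a vertex carry weight \<open>n\<close> and the others carry weight 1, so each vertex contributes
  at most \<open>n * (card V + 1)\<close>. At the critical exponent the powers of \<open>n\<close>
  cancel.\<close>

lemma expectation_card_copies_squared_le:
  assumes "uniform_pattern s V E" "balanced \<alpha> V E" "0 < \<alpha>" "n \<ge> 1" "\<alpha> * card E = card V"
  shows "measure_pmf.expectation (edge_indicator_pmf s n (real n powr - \<alpha>))
      (\<lambda>f. (real (card (copies V E n f)))\<^sup>2) \<le> (real (card V) + 1) ^ card V"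
proof -
  note D = uniform_patternD[OF assms(1)]
  let ?c = "real n powr (- 2 * \<alpha> * card E)" and ?v = "card V"
  have p: "0 \<le> real n powr - \<alpha>" "real n powr - \<alpha> \<le> 1"
    using assms(3,4) powr_mono[of "- \<alpha>" 0 "real n"] by auto
  have inner: "(\<Sum>\<psi>\<in>placements V n. (real n powr - \<alpha>) ^ card ((`) \<phi> ` E \<union> (`) \<psi> ` E)) \<le>
      ?c * (real n * (real ?v + 1)) ^ ?v" if \<phi>: "\<phi> \<in> placements V n" for \<phi>
  proof -
    let ?g = "\<lambda>x. if x \<in> \<phi> ` V then real n else 1"
    have "(\<Sum>\<psi>\<in>placements V n. (real n powr - \<alpha>) ^ card ((`) \<phi> ` E \<union> (`) \<psi> ` E)) \<le>
      (\<Sum>\<psi>\<in>placements V n. ?c * (\<Prod>v\<in>V. ?g (\<psi> v)))"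
      using overlap_bound[OF assms(1-4) \<phi>] by (intro sum_mono) auto
    \<comment> \<open>Injectivity of \<open>\<psi>\<close> is dropped, so that the sum of products
      becomes a product of sums, one for each vertex of the pattern.\<close>
    also have "\<dots> \<le> (\<Sum>\<psi>\<in>V \<rightarrow>\<^sub>E {1..n}. ?c * (\<Prod>v\<in>V. ?g (\<psi> v)))"
      using D(1) by (intro sum_mono2) (auto intro!: finite_PiE mult_nonneg_nonneg prod_nonneg simp: placements_def)
    also have "\<dots> = ?c * (\<Prod>v\<in>V. \<Sum>x\<in>{1..n}. ?g x)"
      using D(1) by (subst prod_sum_PiE) (auto simp: sum_distrib_left)
    finally have step: "(\<Sum>\<psi>\<in>placements V n. (real n powr - \<alpha>) ^ card ((`) \<phi> ` E \<union> (`) \<psi> ` E)) \<le>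
      ?c * (\<Prod>v\<in>V. \<Sum>x\<in>{1..n}. ?g x)" .
    have "(\<Sum>x\<in>{1..n}. ?g x) \<le> real n * (real ?v + 1)"
    proof -
      have "(\<Sum>x\<in>{1..n}. ?g x) \<le> (\<Sum>x\<in>{1..n}. (if x \<in> \<phi> ` V then real n else 0) + 1)"
        by (intro sum_mono) auto
      also have "\<dots> = real (card ({1..n} \<inter> \<phi> ` V)) * real n + n"
        by (simp add: sum.distrib sum.If_cases)
      finally have "(\<Sum>x\<in>{1..n}. ?g x) \<le> real (card ({1..n} \<inter> \<phi> ` V)) * real n + n" .
      moreover have "card ({1..n} \<inter> \<phi> ` V) \<le> card V"
        using D(1) by (intro order_trans[OF card_mono card_image_le]) auto
      moreover from this have "real (card ({1..n} \<inter> \<phi> ` V)) * real n + n \<le> real ?v * real n + n"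
        by (intro add_mono mult_right_mono) auto
      ultimately show ?thesis by (simp add: algebra_simps)
    qed
    then have "?c * (\<Prod>v\<in>V. \<Sum>x\<in>{1..n}. ?g x) \<le> ?c * (\<Prod>v\<in>V. real n * (real ?v + 1))"
      by (intro mult_left_mono prod_mono) (auto intro!: sum_nonneg)
    with step show ?thesis by simp
  qed
  have "measure_pmf.expectation (edge_indicator_pmf s n (real n powr - \<alpha>))
      (\<lambda>f. (real (card (copies V E n f)))\<^sup>2) \<le> (\<Sum>\<phi>\<in>placements V n. ?c * (real n * (real ?v + 1)) ^ ?v)"
    unfolding expectation_card_copies_squared[OF assms(1) p] using inner by (intro sum_mono) auto
  also have "\<dots> \<le> real n ^ ?v * (?c * (real n * (real ?v + 1)) ^ ?v)"
    using card_placements_le[OF D(1), of n]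
    by (auto intro!: mult_right_mono simp flip: of_nat_power)
  also have "\<dots> = (real n ^ ?v * real n ^ ?v * ?c) * (real ?v + 1) ^ ?v"
    by (simp add: power_mult_distrib)
  also have "?c = real n powr (- real ?v + - real ?v)"
    by (rule arg_cong[where f = "\<lambda>x. real n powr x"]) (use assms(5) in linarith)
  also have "real n ^ ?v * real n ^ ?v * real n powr (- real ?v + - real ?v) = 1"
    unfolding powr_add using assms(4) by (simp add: powr_minus powr_realpow field_simps)
  finally show ?thesis by simp
qed

text \<open>At the threshold the first moment is eventually at least 1/2 while the second stays
  bounded.\<close>

lemma prob_copies_critical_ge:
  assumes "uniform_pattern s V E" "balanced \<alpha> V E" "0 < \<alpha>" "\<alpha> * card E = card V"
  shows "\<exists>c>0. \<forall>\<^sub>F n in sequentially.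
    c \<le> measure_pmf.prob (edge_indicator_pmf s n (real n powr - \<alpha>)) {f. copies V E n f \<noteq> {}}"
proof -
  note D = uniform_patternD[OF assms(1)]
  let ?v = "card V"
  \<comment> \<open>This quotient bounds from below the proportion of injective maps among all maps
    from \<open>V\<close>.\<close>
  have "(\<lambda>n. ((real n - ?v) / real n) ^ ?v) \<longlonglongrightarrow> 1 ^ ?v"
  proof (intro tendsto_power)
    have "(\<lambda>n. 1 - real ?v * inverse (real n)) \<longlonglongrightarrow> 1 - real ?v * 0"
      by (intro tendsto_intros lim_inverse_n)
    moreover have "\<forall>\<^sub>F n in sequentially. 1 - real ?v * inverse (real n) = (real n - ?v) / real n"
      using eventually_gt_at_top[of 0] by eventually_elim (auto simp: field_simps)
    ultimately show "(\<lambda>n. (real n - ?v) / real n) \<longlonglongrightarrow> 1"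
      by (auto intro: Lim_transform_eventually)
  qed
  then have "\<forall>\<^sub>F n in sequentially. 1 / 2 < ((real n - ?v) / real n) ^ ?v"
    by (rule order_tendstoD) auto
  then have "\<forall>\<^sub>F n in sequentially. 1 / (4 * (real ?v + 1) ^ ?v) \<le>
    measure_pmf.prob (edge_indicator_pmf s n (real n powr - \<alpha>)) {f. copies V E n f \<noteq> {}}"
    using eventually_ge_at_top[of "max 1 ?v"]
  proof eventually_elim
    case (elim n)
    have p: "0 \<le> real n powr - \<alpha>" "real n powr - \<alpha> \<le> 1"
      using assms(3) elim powr_mono[of "- \<alpha>" 0 "real n"] by auto
    have "1 / 2 \<le> (real (n - ?v)) ^ ?v * (real n powr - \<alpha>) ^ card E"
    proof -
      have "(real n powr - \<alpha>) ^ card E = real n powr (- (\<alpha> * card E))"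
        using elim by (simp add: powr_realpow[symmetric] powr_powr)
      also have "\<dots> = 1 / real n ^ ?v"
        using elim by (simp add: assms(4) powr_minus powr_realpow field_simps)
      finally show ?thesis using elim by (simp add: power_divide of_nat_diff)
    qed
    also have "\<dots> \<le> real (card (placements V n)) * (real n powr - \<alpha>) ^ card E"
      using of_nat_mono[OF card_placements_ge[OF D(1), of n], where 'a=real] elim
      by (intro mult_right_mono) (simp_all del: of_nat_diff)
    finally show ?case
      using elim by (intro prob_copies_second_moment[OF assms(1)]
          expectation_card_copies_squared_le[OF assms(1-3) _ assms(4)])
        (auto simp: expectation_card_copies[OF assms(1) p])
  qed
  then show ?thesis by (intro exI[of _ "1 / (4 * (real ?v + 1) ^ ?v)"]) auto
qed

section \<open>Local sparseness\<close>

definition present_edges :: "nat \<Rightarrow> nat \<Rightarrow> (nat set \<Rightarrow> bool) \<Rightarrow> nat set set" where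
  "present_edges s n f = {e \<in> possible_edges s n. f e}"

definition sparse :: "real \<Rightarrow> nat \<Rightarrow> nat \<Rightarrow> nat set set \<Rightarrow> bool" where
  "sparse \<alpha> K n E \<longleftrightarrow> (\<forall>W\<subseteq>{1..n}. card W \<le> K \<longrightarrow> \<alpha> * card {e \<in> E. e \<subseteq> W} \<le> card W)"

lemma powr_minus_le_1: "\<alpha> > 0 \<Longrightarrow> real n powr - \<alpha> \<le> 1"
proof (cases "n = 0")
  case False
  then show "\<alpha> > 0 \<Longrightarrow> ?thesis" using powr_mono[of "- \<alpha>" 0 "real n"] by auto
qed auto

text \<open>First moment and union bound: a set \<open>W\<close> violating sparseness carries a
  pattern with \<open>w\<close> vertices and more than \<open>w / \<alpha>\<close> edges. The
  expected number of its copies is at most \<open>n powr (w - \<alpha> * card E)\<close>, which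
  tends to 0, and only finitely many patterns arise from at most \<open>K\<close> vertices.\<close>

lemma prob_not_sparse_tendsto_0:
  assumes "\<alpha> > 0"
  shows "(\<lambda>n. measure_pmf.prob (edge_indicator_pmf s n (real n powr - \<alpha>))
    {f. \<not> sparse \<alpha> K n (present_edges s n f)}) \<longlonglongrightarrow> 0"
proof -
  define P where "P = (SIGMA w:{..K}. {E :: nat set set. E \<subseteq> {e. e \<subseteq> {..<w} \<and> card e = s} \<and> real w < \<alpha> * card E})"
  have finP: "finite P"
  proof (rule finite_subset)
    show "P \<subseteq> {..K} \<times> Pow (Pow {..<K})"
    proof
      fix z assume "z \<in> P"
      then obtain w E where z: "z = (w, E)" "w \<le> K" "E \<subseteq> {e. e \<subseteq> {..<w} \<and> card e = s}"
        by (auto simp: P_def)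
      have "e \<subseteq> {..<K}" if "e \<in> E" for e
        using subsetD[OF z(3) that] z(2) by auto
      with z(1,2) show "z \<in> {..K} \<times> Pow (Pow {..<K})" by auto
    qed
  qed auto
  have pat: "uniform_pattern s {..<w} E" if "(w, E) \<in> P" for w E
    using that by (auto simp: P_def uniform_pattern_def)
  have sub: "{f. \<not> sparse \<alpha> K n (present_edges s n f)} \<subseteq> (\<Union>(w, E)\<in>P. {f. copies {..<w} E n f \<noteq> {}})" for n
  proof
    fix f assume "f \<in> {f. \<not> sparse \<alpha> K n (present_edges s n f)}"
    then obtain W where W: "W \<subseteq> {1..n}" "card W \<le> K"
      "\<alpha> * card {e \<in> present_edges s n f. e \<subseteq> W} > card W"
      by (auto simp: sparse_def not_le)
    have "finite W" using W(1) finite_subset by blast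
    \<comment> \<open>Numbering the vertices of \<open>W\<close> by \<open>h\<close> turns the edges
      inside \<open>W\<close> into one of the patterns in \<open>P\<close>.\<close>
    then obtain h where h: "bij_betw h {..<card W} W"
      using ex_bij_betw_nat_finite[of W] by (auto simp: atLeast0LessThan)
    define F where "F = {e \<in> present_edges s n f. e \<subseteq> W}"
    define E where "E = {e. e \<subseteq> {..<card W} \<and> h ` e \<in> F}"
    have hinj: "inj_on h {..<card W}" and him: "h ` {..<card W} = W"
      using h by (auto simp: bij_betw_def)
    have FE: "F = (`) h ` E"
    proof (intro equalityI subsetI)
      fix e assume e: "e \<in> F"
      then have "e \<subseteq> h ` {..<card W}" unfolding him F_def by simp
      then obtain d where "d \<subseteq> {..<card W}" "e = h ` d" by (auto simp: subset_image_iff)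
      then show "e \<in> (`) h ` E" using e by (auto simp: E_def)
    qed (auto simp: E_def)
    have "finite E" by (simp add: E_def)
    then have "card F \<le> card E"
      unfolding FE by (rule card_image_le)
    then have "\<alpha> * card E > card W"
      using W(3) assms unfolding F_def[symmetric] by (smt (verit) mult_left_mono of_nat_mono)
    moreover have "card e = s" if "e \<in> E" for e
    proof -
      have "card (h ` e) = s" using that by (auto simp: E_def F_def present_edges_def possible_edges_def)
      then show ?thesis using that hinj by (metis (mono_tags, lifting) E_def card_image inj_on_subset mem_Collect_eq)
    qed
    moreover have "e \<subseteq> {..<card W}" if "e \<in> E" for e using that by (simp add: E_def)
    ultimately have "(card W, E) \<in> P" using W(2) unfolding P_def by (simp add: subset_iff)
    moreover have "restrict h {..<card W} \<in> copies {..<card W} E n f"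
    proof -
      have "restrict h {..<card W} ` e = h ` e" if "e \<in> E" for e
        using that by (intro image_cong) (auto simp: E_def)
      moreover have "h x \<in> {1..n}" if "x < card W" for x using that him W(1) by blast
      moreover have "f (h ` e)" if "e \<in> E" for e
        using that by (simp add: E_def F_def present_edges_def)
      ultimately show ?thesis
        using hinj unfolding copies_def placements_def by (simp add: inj_on_restrict_eq)
    qed
    ultimately show "f \<in> (\<Union>(w, E)\<in>P. {f. copies {..<w} E n f \<noteq> {}})" by blast
  qed
  have le: "measure_pmf.prob (edge_indicator_pmf s n (real n powr - \<alpha>))
      {f. \<not> sparse \<alpha> K n (present_edges s n f)} \<le>
      (\<Sum>(w, E)\<in>P. real n ^ w * (real n powr - \<alpha>) ^ card E)" for n
  proof -
    let ?Q = "edge_indicator_pmf s n (real n powr - \<alpha>)"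
    have "measure_pmf.prob ?Q {f. \<not> sparse \<alpha> K n (present_edges s n f)} \<le>
        measure_pmf.prob ?Q (\<Union>(w, E)\<in>P. {f. copies {..<w} E n f \<noteq> {}})"
      using sub by (intro measure_pmf.finite_measure_mono) auto
    also have "\<dots> \<le> (\<Sum>x\<in>P. measure_pmf.prob ?Q (case x of (w, E) \<Rightarrow> {f. copies {..<w} E n f \<noteq> {}}))"
      using finP by (intro measure_pmf.finite_measure_subadditive_finite) auto
    also have "\<dots> \<le> (\<Sum>(w, E)\<in>P. real n ^ w * (real n powr - \<alpha>) ^ card E)"
    proof (intro sum_mono)
      fix x assume "x \<in> P"
      then obtain w E where x: "x = (w, E)" "(w, E) \<in> P" by (cases x) auto
      show "measure_pmf.prob ?Q (case x of (w, E) \<Rightarrow> {f. copies {..<w} E n f \<noteq> {}}) \<le>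
        (case x of (w, E) \<Rightarrow> real n ^ w * (real n powr - \<alpha>) ^ card E)"
        using prob_copies_le1[OF pat[OF x(2)] powr_ge_zero powr_minus_le_1[OF assms]] x(1) by auto
    qed
    finally show ?thesis .
  qed
  have "(\<lambda>n. real n ^ w * (real n powr - \<alpha>) ^ card E) \<longlonglongrightarrow> 0" if "(w, E) \<in> P" for w E
  proof -
    have "(\<lambda>n. real n powr (w - \<alpha> * card E)) \<longlonglongrightarrow> 0"
      using that by (intro tendsto_neg_powr filterlim_real_sequentially) (auto simp: P_def dest!: subsetD)
    moreover have "\<forall>\<^sub>F n in sequentially. real n powr (w - \<alpha> * card E) = real n ^ w * (real n powr - \<alpha>) ^ card E"
      using eventually_gt_at_top[of 0]
    proof eventually_elim
      case (elim n)
      have "real n powr (w - \<alpha> * card E) = real n powr w * real n powr (- \<alpha> * card E)"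
        by (simp add: powr_add[symmetric])
      also have "real n powr (- \<alpha> * card E) = (real n powr - \<alpha>) ^ card E"
        using elim by (simp add: powr_realpow[symmetric] powr_powr)
      finally show ?case using elim by (simp add: powr_realpow)
    qed
    ultimately show ?thesis by (rule Lim_transform_eventually)
  qed
  then have "(\<lambda>n. \<Sum>(w, E)\<in>P. real n ^ w * (real n powr - \<alpha>) ^ card E) \<longlonglongrightarrow> 0"
    by (intro tendsto_null_sum) auto
  then show ?thesis
    by (rule Lim_null_comparison[rotated]) (use le in auto)
qed

section \<open>The sentence\<close>

definition joined :: "nat \<Rightarrow> nat set set \<Rightarrow> nat \<Rightarrow> nat set \<Rightarrow> bool" where
  "joined s E u B \<longleftrightarrow> (\<forall>S. S \<subseteq> B \<and> card S = s - 1 \<longrightarrow> insert u S \<in> E)"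

lemma joinedD: "joined s E u B \<Longrightarrow> S \<subseteq> B \<Longrightarrow> card S = s - 1 \<Longrightarrow> insert u S \<in> E"
  by (simp add: joined_def)

text \<open>\<open>Equal 0 0\<close> serves as a quantifier-free constant for truth.\<close>

definition conjs :: "fo_formula list \<Rightarrow> fo_formula" where
  "conjs \<phi>s = foldr Conj \<phi>s (Equal 0 0)"

lemma sat_conjs [simp]: "sat H v (conjs \<phi>s) \<longleftrightarrow> (\<forall>\<phi>\<in>set \<phi>s. sat H v \<phi>)"
  unfolding conjs_def by (induction \<phi>s) auto

lemma has_arity_conjs [simp]: "has_arity s (conjs \<phi>s) \<longleftrightarrow> (\<forall>\<phi>\<in>set \<phi>s. has_arity s \<phi>)"
  unfolding conjs_def by (induction \<phi>s) auto

lemma free_vars_conjs [simp]: "free_vars (conjs \<phi>s) = insert 0 (\<Union>\<phi>\<in>set \<phi>s. free_vars \<phi>)"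
  unfolding conjs_def by (induction \<phi>s) auto

lemma quantifier_depth_conjs: "quantifier_depth (conjs \<phi>s) \<le> k \<longleftrightarrow> (\<forall>\<phi>\<in>set \<phi>s. quantifier_depth \<phi> \<le> k)"
  unfolding conjs_def by (induction \<phi>s) auto

lemma sat_foldr_Exists:
  "sat H v (foldr Exists xs \<phi>) \<longleftrightarrow>
    (\<exists>w. (\<forall>x\<in>set xs. w x \<in> fst H) \<and> (\<forall>x. x \<notin> set xs \<longrightarrow> w x = v x) \<and> sat H w \<phi>)"
proof (induction xs arbitrary: v)
  case Nil
  have "w = v" if "\<forall>x. w x = v x" for w using that by auto
  then show ?case by auto
next
  case (Cons x xs)
  show ?case
  proof
    assume "sat H v (foldr Exists (x # xs) \<phi>)"
    then obtain a where a: "a \<in> fst H" "sat H (v(x := a)) (foldr Exists xs \<phi>)" by auto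
    then obtain w where "\<forall>x\<in>set xs. w x \<in> fst H" "\<forall>y. y \<notin> set xs \<longrightarrow> w y = (v(x := a)) y" "sat H w \<phi>"
      using Cons.IH by blast
    then show "\<exists>w. (\<forall>x\<in>set (x # xs). w x \<in> fst H) \<and> (\<forall>y. y \<notin> set (x # xs) \<longrightarrow> w y = v y) \<and> sat H w \<phi>"
      using a(1) by (intro exI[of _ w]) (metis fun_upd_apply set_ConsD list.set_intros(2) list.set_intros(1))
  next
    assume "\<exists>w. (\<forall>x\<in>set (x # xs). w x \<in> fst H) \<and> (\<forall>y. y \<notin> set (x # xs) \<longrightarrow> w y = v y) \<and> sat H w \<phi>"
    then obtain w where w: "\<forall>x\<in>set (x # xs). w x \<in> fst H" "\<forall>y. y \<notin> set (x # xs) \<longrightarrow> w y = v y" "sat H w \<phi>"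
      by blast
    then have "sat H (v(x := w x)) (foldr Exists xs \<phi>)"
      unfolding Cons.IH by (intro exI[of _ w]) auto
    then show "sat H v (foldr Exists (x # xs) \<phi>)" using w(1) by auto
  qed
qed

lemma has_arity_foldr_Exists [simp]: "has_arity s (foldr Exists xs \<phi>) = has_arity s \<phi>"
  by (induction xs) auto

lemma free_vars_foldr_Exists [simp]: "free_vars (foldr Exists xs \<phi>) = free_vars \<phi> - set xs"
  by (induction xs) auto

lemma quantifier_depth_foldr_Exists [simp]:
  "quantifier_depth (foldr Exists xs \<phi>) = length xs + quantifier_depth \<phi>"
  by (induction xs) auto

text \<open>The sublists of length \<open>s - 1\<close> of a distinct list run through its subsets
  of that size, so a finite conjunction expresses joinedness and no quantifier is spent.\<close>

definition joined_fm :: "nat \<Rightarrow> nat \<Rightarrow> nat list \<Rightarrow> fo_formula" where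
  "joined_fm s u xs = conjs (map (\<lambda>ys. Edge (u # ys)) (filter (\<lambda>ys. length ys = s - 1) (List.subseqs xs)))"

text \<open>Injectivity of \<open>v\<close> lets the length of a sublist count distinct
  values.\<close>

lemma sat_joined_fm:
  assumes "distinct xs" "inj_on v (set xs)"
  shows "sat H v (joined_fm s u xs) \<longleftrightarrow> joined s (snd H) (v u) (v ` set xs)"
proof -
  have "sat H v (joined_fm s u xs) \<longleftrightarrow>
      (\<forall>ys\<in>set (List.subseqs xs). length ys = s - 1 \<longrightarrow> insert (v u) (v ` set ys) \<in> snd H)"
    by (auto simp: joined_fm_def)
  also have "\<dots> \<longleftrightarrow> (\<forall>ys\<in>set (List.subseqs xs). card (set ys) = s - 1 \<longrightarrow> insert (v u) (v ` set ys) \<in> snd H)"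
    using subseqs_distinctD[OF _ assms(1)] by (simp add: distinct_card)
  also have "\<dots> \<longleftrightarrow> (\<forall>S\<in>set ` set (List.subseqs xs). card S = s - 1 \<longrightarrow> insert (v u) (v ` S) \<in> snd H)"
    by blast
  also have "\<dots> \<longleftrightarrow> (\<forall>S\<in>Pow (set xs). card (v ` S) = s - 1 \<longrightarrow> insert (v u) (v ` S) \<in> snd H)"
    using assms(2) by (auto simp: subseqs_powset card_image inj_on_subset)
  also have "\<dots> \<longleftrightarrow> joined s (snd H) (v u) (v ` set xs)"
    unfolding joined_def by (auto simp: subset_image_iff)
  finally show ?thesis .
qed

lemma has_arity_joined_fm [simp]: "s \<ge> 1 \<Longrightarrow> has_arity s (joined_fm s u xs)"
  by (auto simp: joined_fm_def)

lemma free_vars_joined_fm: "free_vars (joined_fm s u xs) \<subseteq> insert 0 (insert u (set xs))"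
  using subseqs_powset[of xs] by (auto simp: joined_fm_def)

lemma quantifier_depth_joined_fm [simp]: "quantifier_depth (joined_fm s u xs) = 0"
  using quantifier_depth_conjs[of _ 0] by (auto simp: joined_fm_def)

text \<open>The last conjunct makes the clusters of different indices disjoint.\<close>

definition cluster :: "nat \<Rightarrow> nat \<Rightarrow> nat set set \<Rightarrow> (nat \<Rightarrow> nat) \<Rightarrow> nat \<Rightarrow> nat set" where
  "cluster s m E a i = {y. y \<noteq> a i \<and> joined s E y (a ` ({..m} - {i})) \<and>
     (\<forall>j\<in>{..m} - {i}. \<not> joined s E y (a ` ({..m} - {j})))}"

text \<open>For distinct vertices, \<open>y\<close>, \<open>p\<close> and \<open>a 3\<close>, ...,
  \<open>a m\<close> form an \<open>m\<close>-set, so attaching \<open>u\<close> costs as many edges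
  as attaching a cluster member. The set \<open>Y\<close> is cut down to \<open>{1..n}\<close>
  because the quantifier over \<open>y\<close> ranges over vertices.\<close>

definition covered :: "nat \<Rightarrow> nat \<Rightarrow> nat \<Rightarrow> nat set set \<Rightarrow> (nat \<Rightarrow> nat) \<Rightarrow> nat set \<Rightarrow> bool" where
  "covered s m n E a Y \<longleftrightarrow> (\<exists>p\<in>{1..n} - a ` {..m}. \<forall>y\<in>{1..n} \<inter> Y. y \<noteq> p \<and>
     (\<exists>u\<in>{1..n}. joined s E u (insert y (insert p (a ` {3..m})))))"

text \<open>Since \<open>b\<close> lies in cluster 0, it enlarges only the other sets:
  \<open>d + 1\<close> members are forced in cluster 0 and \<open>d\<close> in each other cluster.
  With \<open>d + 1\<close> members in all \<open>m + 1\<close> clusters the threshold would be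
  \<open>\<epsilon> = 1 / (d + 1)\<close>, exactly where covering \<open>d + 1\<close> vertices has
  exponent 0; \<open>b\<close> moves the threshold strictly above this value.\<close>

definition uncoverable :: "nat \<Rightarrow> nat \<Rightarrow> nat \<Rightarrow> nat set set \<Rightarrow> bool" where
  "uncoverable s m n E \<longleftrightarrow> (\<exists>a b. inj_on a {..m} \<and> a ` {..m} \<subseteq> {1..n} \<and> b \<in> {1..n} \<inter> cluster s m E a 0 \<and>
     (\<forall>i\<le>m. \<not> covered s m n E a (insert b (cluster s m E a i))))"

text \<open>Variable \<open>i \<le> m\<close> stands for \<open>a\<^sub>i\<close>; the variables \<open>m + 1\<close> to \<open>m + 4\<close> stand for
  \<open>b\<close>, \<open>p\<close>, \<open>y\<close>, \<open>u\<close>.\<close>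

definition others :: "nat \<Rightarrow> nat \<Rightarrow> nat list" where
  "others m i = filter (\<lambda>j. j \<noteq> i) [0..<Suc m]"

definition cluster_fm :: "nat \<Rightarrow> nat \<Rightarrow> nat \<Rightarrow> nat \<Rightarrow> fo_formula" where
  "cluster_fm s m i y = conjs (Neg (Equal y i) # joined_fm s y (others m i) #
     map (\<lambda>j. Neg (joined_fm s y (others m j))) (others m i))"

definition covered_fm :: "nat \<Rightarrow> nat \<Rightarrow> nat \<Rightarrow> fo_formula" where
  "covered_fm s m i = Exists (m + 2) (Conj (conjs (map (\<lambda>j. Neg (Equal (m + 2) j)) [0..<Suc m]))
     (Forall (m + 3) (Impl (Disj (cluster_fm s m i (m + 3)) (Equal (m + 3) (m + 1)))
       (Conj (Neg (Equal (m + 3) (m + 2)))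
         (Exists (m + 4) (joined_fm s (m + 4) ((m + 3) # (m + 2) # [3..<Suc m])))))))"

definition uncoverable_fm :: "nat \<Rightarrow> nat \<Rightarrow> fo_formula" where
  "uncoverable_fm s m = foldr Exists [0..<m + 2]
     (conjs (map (\<lambda>(i, j). Neg (Equal i j)) (filter (\<lambda>(i, j). i \<noteq> j) (List.product [0..<Suc m] [0..<Suc m])) @
       cluster_fm s m 0 (m + 1) # map (\<lambda>i. Neg (covered_fm s m i)) [0..<Suc m]))"

lemma set_others [simp]: "set (others m i) = {..m} - {i}"
  by (auto simp: others_def)

lemma distinct_others [simp]: "distinct (others m i)"
  by (simp add: others_def)

section \<open>Semantics and quantifier depth of the sentence\<close>

lemma sat_cluster_fm:
  assumes "inj_on v {..m}"
  shows "sat H v (cluster_fm s m i y) \<longleftrightarrow> v y \<in> cluster s m (snd H) v i"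
proof -
  have "sat H v (joined_fm s y (others m j)) \<longleftrightarrow> joined s (snd H) (v y) (v ` ({..m} - {j}))" for j
    using assms by (subst sat_joined_fm) (auto intro: inj_on_subset)
  then show ?thesis by (auto simp: cluster_fm_def cluster_def)
qed

text \<open>If \<open>u\<close> were in \<open>B\<close>, an (s - 1)-subset \<open>S\<close> of
  \<open>B\<close> containing \<open>u\<close> would give the edge \<open>insert u S = S\<close>,
  which is too small.\<close>

lemma joined_notin:
  assumes "joined s E u B" "finite B" "s - 1 \<le> card B" "s \<ge> 2" "\<forall>e\<in>E. card e = s"
  shows "u \<notin> B"
proof
  assume u: "u \<in> B"
  have "s - 2 \<le> card (B - {u})" using assms(2,3) u by simp
  then obtain S where S: "S \<subseteq> B - {u}" "card S = s - 2"
    by (meson obtain_subset_with_card_n)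
  have fin: "finite S" using S assms(2) finite_subset by blast
  have c: "card (insert u S) = s - 1" using S fin assms(4) by (subst card_insert_disjoint) auto
  then have "insert u (insert u S) \<in> E"
    using assms(1) S u unfolding joined_def by blast
  then show False using assms(5) c assms(4) by fastforce
qed

lemma cluster_notin:
  assumes "y \<in> cluster s m E a i" "inj_on a {..m}" "i \<le> m" "s - 1 \<le> m" "s \<ge> 2"
    "\<forall>e\<in>E. card e = s"
  shows "y \<notin> a ` {..m}"
proof -
  have "card (a ` ({..m} - {i})) = m"
    using assms(2,3) by (subst card_image) (auto intro: inj_on_subset)
  then have "y \<notin> a ` ({..m} - {i})"
    using assms by (intro joined_notin[of s E]) (auto simp: cluster_def)
  moreover have "y \<noteq> a i" using assms(1) by (simp add: cluster_def)
  ultimately show ?thesis by auto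
qed

lemma cluster_cong:
  assumes "\<And>j. j \<le> m \<Longrightarrow> a j = a' j" "i \<le> m"
  shows "cluster s m E a i = cluster s m E a' i"
proof -
  have "a ` ({..m} - {j}) = a' ` ({..m} - {j})" for j using assms(1) by (intro image_cong) auto
  then show ?thesis using assms by (simp add: cluster_def)
qed

text \<open>\<open>joined_fm\<close> is read correctly at distinct values. The formula itself keeps
  \<open>p\<close> away from the \<open>v j\<close> and from \<open>y\<close>, and
  \<open>cluster_notin\<close> keeps \<open>y\<close> away from the \<open>v j\<close>.\<close>

lemma sat_covered_fm:
  assumes "inj_on v {..m}" "v (m + 1) \<in> cluster s m E v 0" "i \<le> m" "s - 1 \<le> m" "s \<ge> 2"
    "\<forall>e\<in>E. card e = s"
  shows "sat ({1..n}, E) v (covered_fm s m i) \<longleftrightarrow>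
    covered s m n E v (insert (v (m + 1)) (cluster s m E v i))"
proof -
  define w where "w p y u = v(m + 2 := p, m + 3 := y, m + 4 := u)" for p y u
  have w: "w p y u j = v j" if "j \<le> m + 1" for p y u j
    using that by (simp add: w_def)
  have clu: "sat ({1..n}, E) (v(m + 2 := p, m + 3 := y)) (cluster_fm s m i (m + 3)) \<longleftrightarrow> y \<in> cluster s m E v i" for p y
  proof -
    have "inj_on (v(m + 2 := p, m + 3 := y)) {..m}"
      using assms(1) by (auto simp: inj_on_def)
    moreover have "cluster s m E (v(m + 2 := p, m + 3 := y)) i = cluster s m E v i"
      using assms(3) by (intro cluster_cong) auto
    ultimately show ?thesis by (subst sat_cluster_fm) auto
  qed
  have join: "sat ({1..n}, E) (v(m + 2 := p, m + 3 := y, m + 4 := u))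
      (joined_fm s (m + 4) ((m + 3) # (m + 2) # [3..<Suc m])) \<longleftrightarrow>
      joined s E u (insert y (insert p (v ` {3..m})))"
    if "p \<notin> v ` {..m}" "y \<notin> v ` {..m}" "y \<noteq> p" for p y u
  proof -
    have img: "w p y u ` {3..<Suc m} = v ` {3..m}"
      by (intro image_cong) (auto simp: w)
    have "inj_on (w p y u) {3..<Suc m}"
      using assms(1) w[of _ p y u] by (auto simp: inj_on_def)
    moreover have "v ` {3..m} \<subseteq> v ` {..m}" by auto
    ultimately have "inj_on (w p y u) (insert (m + 3) (insert (m + 2) {3..<Suc m}))"
      using that img by (auto simp: w_def)
    then show ?thesis
      unfolding w_def[symmetric] by (subst sat_joined_fm) (auto simp: img simp del: upt_Suc, auto simp: w_def)
  qed
  have notin: "y \<notin> v ` {..m}" if "y \<in> insert (v (m + 1)) (cluster s m E v i)" for y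
    using that
  proof
    assume "y = v (m + 1)"
    then show ?thesis using cluster_notin[OF assms(2,1) le0 assms(4-6)] by simp
  next
    assume "y \<in> cluster s m E v i"
    then show ?thesis by (rule cluster_notin[OF _ assms(1,3-6)])
  qed
  have "sat ({1..n}, E) v (covered_fm s m i) \<longleftrightarrow>
    (\<exists>p\<in>{1..n}. (\<forall>j\<in>{..m}. p \<noteq> v j) \<and> (\<forall>y\<in>{1..n}. y \<in> cluster s m E v i \<or> y = v (m + 1) \<longrightarrow>
       y \<noteq> p \<and> (\<exists>u\<in>{1..n}. sat ({1..n}, E) (v(m + 2 := p, m + 3 := y, m + 4 := u))
      (joined_fm s (m + 4) ((m + 3) # (m + 2) # [3..<Suc m])))))"
    unfolding covered_fm_def sat.simps fst_conv clu
    by (simp add: atLeast0LessThan lessThan_Suc_atMost del: upt_Suc)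
  also have "\<dots> \<longleftrightarrow> covered s m n E v (insert (v (m + 1)) (cluster s m E v i))"
  proof -
    define Q R where "Q p \<longleftrightarrow> (\<forall>y\<in>{1..n}. y \<in> cluster s m E v i \<or> y = v (m + 1) \<longrightarrow>
       y \<noteq> p \<and> (\<exists>u\<in>{1..n}. sat ({1..n}, E) (v(m + 2 := p, m + 3 := y, m + 4 := u))
      (joined_fm s (m + 4) ((m + 3) # (m + 2) # [3..<Suc m]))))"
      and "R p \<longleftrightarrow> (\<forall>y\<in>{1..n} \<inter> insert (v (m + 1)) (cluster s m E v i). y \<noteq> p \<and>
     (\<exists>u\<in>{1..n}. joined s E u (insert y (insert p (v ` {3..m})))))" for p
    have "Q p \<longleftrightarrow> R p" if "p \<notin> v ` {..m}" for p
      unfolding Q_def R_def using join[OF that notin] by blast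
    then have "(\<exists>p\<in>{1..n}. (\<forall>j\<in>{..m}. p \<noteq> v j) \<and> Q p) \<longleftrightarrow> (\<exists>p\<in>{1..n} - v ` {..m}. R p)"
      by blast
    then show ?thesis unfolding covered_def Q_def R_def .
  qed
  finally show ?thesis .
qed


lemma models_uncoverable_fm:
  assumes "s - 1 \<le> m" "s \<ge> 2" "\<forall>e\<in>E. card e = s" "n \<ge> 1"
  shows "models ({1..n}, E) (uncoverable_fm s m) \<longleftrightarrow> uncoverable s m n E"
proof -
  have core: "sat ({1..n}, E) w (conjs (map (\<lambda>(i, j). Neg (Equal i j)) (filter (\<lambda>(i, j). i \<noteq> j) (List.product [0..<Suc m] [0..<Suc m])) @
       cluster_fm s m 0 (m + 1) # map (\<lambda>i. Neg (covered_fm s m i)) [0..<Suc m])) \<longleftrightarrow>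
     inj_on w {..m} \<and> w (m + 1) \<in> cluster s m E w 0 \<and>
     (\<forall>i\<le>m. \<not> covered s m n E w (insert (w (m + 1)) (cluster s m E w i)))" (is "?l w \<longleftrightarrow> ?r w") for w
  proof -
    have "?l w \<longleftrightarrow> inj_on w {..m} \<and> sat ({1..n}, E) w (cluster_fm s m 0 (m + 1)) \<and>
        (\<forall>i\<le>m. \<not> sat ({1..n}, E) w (covered_fm s m i))"
      by (auto simp: ball_Un inj_on_def less_Suc_eq_le simp del: upt_Suc)
    also have "\<dots> \<longleftrightarrow> ?r w"
      using sat_cluster_fm[of w m "({1..n}, E)" s 0 "m + 1"] sat_covered_fm[OF _ _ _ assms(1-3), of w]
      by auto
    finally show ?thesis .
  qed
  have sat: "sat ({1..n}, E) v (uncoverable_fm s m) \<longleftrightarrow> uncoverable s m n E" for v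
  proof
    assume "sat ({1..n}, E) v (uncoverable_fm s m)"
    then obtain w where "\<forall>x\<in>{0..<m + 2}. w x \<in> {1..n}" "?r w"
      unfolding uncoverable_fm_def sat_foldr_Exists core fst_conv set_upt by blast
    then show "uncoverable s m n E"
      unfolding uncoverable_def by (intro exI[of _ w] exI[of _ "w (m + 1)"]) auto
  next
    assume "uncoverable s m n E"
    then obtain a b where ab: "inj_on a {..m}" "a ` {..m} \<subseteq> {1..n}" "b \<in> {1..n} \<inter> cluster s m E a 0"
      "\<forall>i\<le>m. \<not> covered s m n E a (insert b (cluster s m E a i))"
      unfolding uncoverable_def by blast
    define w where "w x = (if x \<le> m then a x else if x = m + 1 then b else v x)" for x
    have clu: "cluster s m E w i = cluster s m E a i" if "i \<le> m" for i
      using that by (intro cluster_cong) (auto simp: w_def)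
    have img: "w ` J = a ` J" if "J \<subseteq> {..m}" for J
      using that by (intro image_cong) (auto simp: w_def)
    have cov: "covered s m n E w Y = covered s m n E a Y" for Y
      by (simp add: covered_def img)
    have "inj_on w {..m}" using ab(1) by (auto simp: inj_on_def w_def)
    moreover have "w (m + 1) = b" by (simp add: w_def)
    ultimately have "?r w" using ab(3,4) by (simp add: clu cov)
    moreover have "\<forall>x\<in>set [0..<m + 2]. w x \<in> {1..n}" "\<forall>x. x \<notin> set [0..<m + 2] \<longrightarrow> w x = v x"
      using ab(2,3) by (auto simp: w_def image_subset_iff)
    ultimately show "sat ({1..n}, E) v (uncoverable_fm s m)"
      unfolding uncoverable_fm_def sat_foldr_Exists core fst_conv by blast
  qed
  \<comment> \<open>As \<open>n \<ge> 1\<close>, a constant valuation shows that the quantification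
    over valuations in \<open>models\<close> is not vacuous.\<close>
  have "range (\<lambda>_. 1) \<subseteq> fst ({1..n}, E)" using assms(4) by auto
  then show ?thesis unfolding models_def sat by blast
qed

text \<open>Depth count: \<open>m + 2\<close> quantifiers for the \<open>a i\<close> and
  \<open>b\<close>, then three nested ones for \<open>p\<close>, \<open>y\<close> and
  \<open>u\<close>.\<close>

lemma uncoverable_fm_property:
  assumes "s \<ge> 2" "k \<ge> m + 5"
  shows "{H. models H (uncoverable_fm s m)} \<in> fo_properties s k"
proof -
  have fv_clu: "free_vars (cluster_fm s m i y) \<subseteq> insert y {..m}" if "i \<le> m" for i y
  proof -
    have "free_vars (joined_fm s y (others m j)) \<subseteq> insert y {..m}" for j
      using free_vars_joined_fm[of s y "others m j"] by auto
    then show ?thesis using that by (auto simp: cluster_fm_def dest!: subsetD)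
  qed
  have fv_cov: "free_vars (covered_fm s m i) \<subseteq> {..m + 1}" if "i \<le> m" for i
  proof -
    have "free_vars (joined_fm s (m + 4) ((m + 3) # (m + 2) # [3..<Suc m])) \<subseteq> {..m + 4}"
      by (rule order_trans[OF free_vars_joined_fm]) auto
    then show ?thesis
      using fv_clu[OF that, of "m + 3"] by (auto simp: covered_fm_def simp del: upt_Suc dest!: subsetD)
  qed
  have fv: "free_vars (uncoverable_fm s m) = {}"
  proof -
    have "free_vars (cluster_fm s m 0 (m + 1)) \<subseteq> {0..<m + 2}"
      using fv_clu[of 0 "m + 1"] by auto
    moreover have "free_vars (covered_fm s m i) \<subseteq> {0..<m + 2}" if "i \<in> {0..<Suc m}" for i
      using fv_cov[of i] that by auto
    ultimately show ?thesis
      unfolding uncoverable_fm_def free_vars_foldr_Exists free_vars_conjs Diff_eq_empty_iff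
      by (simp add: UN_subset_iff del: upt_Suc)
  qed
  have ar_clu: "has_arity s (cluster_fm s m i y)" for i y
    using assms(1) by (auto simp: cluster_fm_def)
  have ar: "has_arity s (uncoverable_fm s m)"
    using assms(1) by (auto simp: uncoverable_fm_def covered_fm_def ar_clu)
  have qd_clu: "quantifier_depth (cluster_fm s m i y) = 0" for i y
    using quantifier_depth_conjs[of _ 0] by (auto simp: cluster_fm_def)
  have neq: "quantifier_depth (conjs (map (\<lambda>j. Neg (Equal x j)) js)) = 0" for x js
    using quantifier_depth_conjs[of _ 0] by auto
  have qd_cov: "quantifier_depth (covered_fm s m i) = 3" for i
    by (simp add: covered_fm_def qd_clu neq del: upt_Suc)
  have "quantifier_depth (uncoverable_fm s m) \<le> (m + 2) + 3"
    unfolding uncoverable_fm_def quantifier_depth_foldr_Exists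
    by (intro add_mono) (auto simp: quantifier_depth_conjs qd_clu qd_cov simp del: upt_Suc)
  then show ?thesis
    using fv ar assms(2) unfolding fo_properties_def by fastforce
qed

section \<open>The extension property\<close>

text \<open>\<open>Z\<close> is the set that \<open>p\<close> must avoid. In the application
  \<open>r = m - 1\<close>, and a member of \<A> consists of one vertex \<open>y\<close> together
  with \<open>a 3\<close>, ..., \<open>a m\<close>, so that \<open>insert p A\<close> is an
  \<open>m\<close>-set.\<close>

definition extendable :: "nat \<Rightarrow> nat \<Rightarrow> nat \<Rightarrow> nat \<Rightarrow> nat \<Rightarrow> nat set set \<Rightarrow> bool" where
  "extendable s r D K n E \<longleftrightarrow> (\<forall>Z \<A>. Z \<subseteq> {1..n} \<and> card Z \<le> K \<and> \<A> \<subseteq> {A. A \<subseteq> Z \<and> card A = r} \<and> card \<A> \<le> D \<longrightarrow>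
     (\<exists>p\<in>{1..n} - Z. \<forall>A\<in>\<A>. \<exists>u\<in>{1..n}. joined s E u (insert p A)))"

lemma prob_bernoulli_not_all:
  assumes "finite I" "F \<subseteq> I" "0 \<le> p" "p \<le> 1"
  shows "measure_pmf.prob (Pi_pmf I False (\<lambda>_. bernoulli_pmf p)) {f. \<not> (\<forall>e\<in>F. f e)} = 1 - p ^ card F"
proof -
  have "measure_pmf.prob (Pi_pmf I False (\<lambda>_. bernoulli_pmf p)) (UNIV - {f. \<forall>e\<in>F. f e}) = 1 - p ^ card F"
    using measure_pmf.prob_compl[of "{f. \<forall>e\<in>F. f e}" "Pi_pmf I False (\<lambda>_. bernoulli_pmf p)"]
      prob_bernoulli_all[OF assms] by simp
  moreover have "UNIV - {f. \<forall>e\<in>F. f e} = {f. \<not> (\<forall>e\<in>F. f e)}" by auto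
  ultimately show ?thesis by simp
qed

lemma prob_Pi_pmf_not:
  "measure_pmf.prob Q {f. \<not> P f} = 1 - measure_pmf.prob Q {f. P f}"
  using measure_pmf.prob_compl[of "{f. P f}" Q] by (simp add: set_diff_eq)

lemma depends_only_on_not_all: "depends_only_on (\<lambda>f. \<not> (\<forall>e\<in>F. f e)) F"
  by (auto simp: depends_only_on_def)

text \<open>
  The edges avoiding a reservoir \<open>Q\<close> of candidates for \<open>p\<close> are exposed first; they provide, for each
  \<open>A\<close>, many vertices joined to \<open>A\<close>. Given these, the events that the various \<open>p \<in> Q\<close> work are independent.
\<close>

lemma prob_no_extension:
  assumes s: "s \<ge> 2" and q: "0 \<le> q" "q \<le> 1" and Z: "Z \<subseteq> {1..n}"
    and \<A>: "\<A> \<subseteq> {A. A \<subseteq> Z \<and> card A = r}" "card \<A> \<le> D"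
    and size: "D * (x * h) + y \<le> n - card Z"
  shows "measure_pmf.prob (edge_indicator_pmf s n q)
    {f. \<not> (\<exists>p\<in>{1..n} - Z. \<forall>A\<in>\<A>. \<exists>u\<in>{1..n}. joined s (present_edges s n f) u (insert p A))} \<le>
    real D * real x * (1 - q ^ (r choose (s - 1))) ^ h +
    (1 - (1 - (1 - q ^ (r choose (s - 2))) ^ x) ^ D) ^ y"
    (is "?prob {f. \<not> ?ext (present_edges s n f)} \<le> _ + ?c")
proof -
  have finZ: "finite Z" using Z finite_subset by blast
  have fin\<A>: "finite \<A>" using \<A>(1) finZ by (auto intro: finite_subset[of _ "Pow Z"])
  have finA: "finite A" "A \<subseteq> Z" "card A = r" if "A \<in> \<A>" for A
    using that \<A>(1) by (auto intro: finite_subset[OF _ finZ])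
  let ?I = "\<A> \<times> ({..<x} \<times> {..<h})"
  have cardZ: "card ({1..n} - Z) = n - card Z" using Z finZ by (simp add: card_Diff_subset)
  have "y \<le> card ({1..n} - Z)" using size cardZ by linarith
  \<comment> \<open>The reservoir of \<open>y\<close> candidates for \<open>p\<close>;
    \<open>size\<close> leaves room for it and for the blocks chosen next.\<close>
  then obtain Q where Q: "Q \<subseteq> {1..n} - Z" "card Q = y" by (meson obtain_subset_with_card_n)
  have finQ: "finite Q" using Q(1) finite_subset by blast
  have "card ?I = card \<A> * (x * h)" by (simp add: card_cartesian_product)
  also have "\<dots> \<le> D * (x * h)" using \<A>(2) by simp
  also have "\<dots> \<le> card ({1..n} - Z - Q)"
    using size Q cardZ finQ by (simp add: card_Diff_subset)
  \<comment> \<open>Every pair \<open>(A, j)\<close> receives its own block of \<open>h\<close>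
    vertices \<open>g (A, j, l)\<close> outside \<open>Z\<close> and \<open>Q\<close>.\<close>
  finally obtain g where g: "g ` ?I \<subseteq> {1..n} - Z - Q" "inj_on g ?I"
    using card_le_inj[of ?I "{1..n} - Z - Q"] fin\<A> by auto
  have gU: "g (A, j, l) \<in> {1..n}" "g (A, j, l) \<notin> Z" "g (A, j, l) \<notin> Q"
    if "A \<in> \<A>" "j < x" "l < h" for A j l
    using g(1) that by blast+
  \<comment> \<open>\<open>K1 u A\<close> consists of the edges joining \<open>u\<close> to
    \<open>A\<close>, and \<open>K2 t u A\<close> of the edges through \<open>t\<close> that are
    needed in addition to join \<open>u\<close> to \<open>insert t A\<close>.\<close>
  define K1 where "K1 u A = insert u ` {S. S \<subseteq> A \<and> card S = s - 1}" for u :: nat and A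
  define K2 where "K2 t u A = (\<lambda>S. insert u (insert t S)) ` {S. S \<subseteq> A \<and> card S = s - 2}" for t u :: nat and A
  have K1: "K1 u A \<subseteq> possible_edges s n" "card (K1 u A) = r choose (s - 1)"
    if "A \<in> \<A>" "u \<in> {1..n}" "u \<notin> Z" for u A
  proof -
    have "u \<notin> A" using that finA by auto
    have "card (insert u S) = s" if "S \<subseteq> A" "card S = s - 1" for S
      using that \<open>u \<notin> A\<close> finA(1)[OF \<open>A \<in> \<A>\<close>] s finite_subset[of S A] by (subst card_insert_disjoint) auto
    moreover have "insert u S \<subseteq> {1..n}" if "S \<subseteq> A" for S
      using that \<open>u \<in> {1..n}\<close> finA(2)[OF \<open>A \<in> \<A>\<close>] Z by auto
    ultimately show "K1 u A \<subseteq> possible_edges s n"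
      unfolding K1_def possible_edges_def by auto
    have "inj_on (insert u) {S. S \<subseteq> A \<and> card S = s - 1}"
      using \<open>u \<notin> A\<close> by (auto simp: inj_on_def)
    then show "card (K1 u A) = r choose (s - 1)"
      unfolding K1_def using finA[OF that(1)] by (simp add: card_image n_subsets)
  qed
  have K2: "K2 t u A \<subseteq> possible_edges s n" "card (K2 t u A) = r choose (s - 2)"
    if "A \<in> \<A>" "u \<in> {1..n}" "u \<notin> Z" "t \<in> Q" "u \<notin> Q" for t u A
  proof -
    have "u \<notin> A" "t \<notin> A" "t \<noteq> u" "t \<in> {1..n}" using that finA(2)[OF that(1)] Q(1) by auto
    have "card (insert u (insert t S)) = s" if "S \<subseteq> A" "card S = s - 2" for S
    proof -
      have "finite S" "t \<notin> S" "u \<notin> S"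
        using that \<open>u \<notin> A\<close> \<open>t \<notin> A\<close> finA(1)[OF \<open>A \<in> \<A>\<close>] finite_subset by auto
      then show ?thesis using that \<open>t \<noteq> u\<close> s by simp
    qed
    moreover have "insert u (insert t S) \<subseteq> {1..n}" if "S \<subseteq> A" for S
      using that \<open>u \<in> {1..n}\<close> \<open>t \<in> {1..n}\<close> finA(2)[OF \<open>A \<in> \<A>\<close>] Z by auto
    ultimately show "K2 t u A \<subseteq> possible_edges s n"
      unfolding K2_def possible_edges_def by auto
    have "inj_on (\<lambda>S. insert u (insert t S)) {S. S \<subseteq> A \<and> card S = s - 2}"
    proof (rule inj_onI)
      fix S S' assume a: "S \<in> {S. S \<subseteq> A \<and> card S = s - 2}" "S' \<in> {S. S \<subseteq> A \<and> card S = s - 2}"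
        "insert u (insert t S) = insert u (insert t S')"
      have "insert u (insert t T) - {u, t} = T" if "T \<subseteq> A" for T
        using that \<open>u \<notin> A\<close> \<open>t \<notin> A\<close> by auto
      then show "S = S'" using a by (metis (no_types, lifting) mem_Collect_eq)
    qed
    then show "card (K2 t u A) = r choose (s - 2)"
      unfolding K2_def using finA[OF that(1)] by (simp add: card_image n_subsets)
  qed
  \<comment> \<open>First round: every block contains a vertex already joined to its
    \<open>A\<close>. The edges inspected for this avoid \<open>Q\<close>.\<close>
  define Good where "Good f \<longleftrightarrow> (\<forall>A\<in>\<A>. \<forall>j<x. \<exists>l<h. \<forall>e\<in>K1 (g (A, j, l)) A. f e)" for f
  have bad: "?prob {f. \<not> Good f} \<le> real D * real x * (1 - q ^ (r choose (s - 1))) ^ h"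
  proof -
    let ?B = "\<lambda>(A, j). {f. \<forall>l\<in>{..<h}. \<not> (\<forall>e\<in>K1 (g (A, j, l)) A. f e)}"
    have "{f. \<not> Good f} = (\<Union>i\<in>\<A> \<times> {..<x}. ?B i)"
      unfolding Good_def by fastforce
    then have "?prob {f. \<not> Good f} \<le> (\<Sum>i\<in>\<A> \<times> {..<x}. ?prob (?B i))"
      using fin\<A> by (simp add: measure_pmf.finite_measure_subadditive_finite)
    also have "\<dots> = (\<Sum>i\<in>\<A> \<times> {..<x}. (1 - q ^ (r choose (s - 1))) ^ h)"
    proof (rule sum.cong[OF refl])
      fix i assume i: "i \<in> \<A> \<times> {..<x}"
      then obtain A j where Aj: "i = (A, j)" "A \<in> \<A>" "j < x" by auto
      have disj: "disjoint_family_on (\<lambda>l. K1 (g (A, j, l)) A) {..<h}"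
        unfolding disjoint_family_on_def
      proof (intro ballI impI)
        fix l l' assume l: "l \<in> {..<h}" "l' \<in> {..<h}" "l \<noteq> l'"
        then have ne: "g (A, j, l) \<noteq> g (A, j, l')"
          using inj_onD[OF g(2), of "(A, j, l)" "(A, j, l')"] Aj by auto
        have "g (A, j, l) \<notin> A" using gU(2)[OF Aj(2,3)] finA(2)[OF Aj(2)] l by auto
        with ne show "K1 (g (A, j, l)) A \<inter> K1 (g (A, j, l')) A = {}"
          unfolding K1_def by blast
      qed
      have "?prob (?B i) = (\<Prod>l\<in>{..<h}. ?prob {f. \<not> (\<forall>e\<in>K1 (g (A, j, l)) A. f e)})"
        unfolding Aj(1) prod.case
        by (rule prob_Pi_pmf_Ball[OF _ _ depends_only_on_not_all disj]) auto
      also have "\<dots> = (\<Prod>l\<in>{..<h}. 1 - q ^ (r choose (s - 1)))"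
      proof (rule prod.cong[OF refl])
        fix l assume "l \<in> {..<h}"
        then have l: "l < h" by simp
        note u = gU[OF Aj(2,3) l]
        show "?prob {f. \<not> (\<forall>e\<in>K1 (g (A, j, l)) A. f e)} = 1 - q ^ (r choose (s - 1))"
          using prob_bernoulli_not_all[OF finite_possible_edges K1(1)[OF Aj(2) u(1,2)] q]
            K1(2)[OF Aj(2) u(1,2)] by simp
      qed
      finally show "?prob (?B i) = (1 - q ^ (r choose (s - 1))) ^ h" by simp
    qed
    also have "\<dots> = real (card \<A> * x) * (1 - q ^ (r choose (s - 1))) ^ h"
      by (simp add: card_cartesian_product)
    also have "\<dots> \<le> real (D * x) * (1 - q ^ (r choose (s - 1))) ^ h"
      using \<A>(2) q by (intro mult_right_mono of_nat_mono mult_right_mono zero_le_power)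
        (auto simp: power_le_one)
    finally show ?thesis by simp
  qed
  have cond: "?prob {f. \<not> ?ext (present_edges s n (\<lambda>e. if e \<in> {e. e \<inter> Q = {}} then g0 e else f e))} \<le> ?c"
    if "Good g0" for g0
  proof -
    \<comment> \<open>Second round: one successful vertex \<open>u A j\<close> is kept from every
      block, which makes \<open>x\<close> of them for each \<open>A\<close>.\<close>
    from that obtain l where l: "\<And>A j. A \<in> \<A> \<Longrightarrow> j < x \<Longrightarrow> l A j < h \<and> (\<forall>e\<in>K1 (g (A, j, l A j)) A. g0 e)"
      unfolding Good_def by metis
    define u where "u A j = g (A, j, l A j)" for A j
    have u: "u A j \<in> {1..n}" "u A j \<notin> Z" "u A j \<notin> Q" "\<forall>e\<in>K1 (u A j) A. g0 e" if "A \<in> \<A>" "j < x" for A j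
      unfolding u_def using gU[OF that] l[OF that] by auto
    have uinj: "u A j = u A' j' \<Longrightarrow> A = A' \<and> j = j'"
      if "A \<in> \<A>" "j < x" "A' \<in> \<A>" "j' < x" for A j A' j'
      unfolding u_def using inj_onD[OF g(2), of "(A, j, l A j)" "(A', j', l A' j')"] l that by auto
    define P1 where "P1 t A f \<longleftrightarrow> \<not> (\<forall>j\<in>{..<x}. \<not> (\<forall>e\<in>K2 t (u A j) A. f e))" for t A and f :: "nat set \<Rightarrow> bool"
    have sub: "{f. \<not> ?ext (present_edges s n (\<lambda>e. if e \<in> {e. e \<inter> Q = {}} then g0 e else f e))} \<subseteq>
      {f. \<forall>t\<in>Q. \<not> (\<forall>A\<in>\<A>. P1 t A f)}"
    proof (rule subsetI, rule CollectI, rule ballI, rule notI)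
      fix f t assume f: "f \<in> {f. \<not> ?ext (present_edges s n (\<lambda>e. if e \<in> {e. e \<inter> Q = {}} then g0 e else f e))}"
        and t: "t \<in> Q" and P: "\<forall>A\<in>\<A>. P1 t A f"
      let ?f = "\<lambda>e. if e \<in> {e. e \<inter> Q = {}} then g0 e else f e"
      have "\<exists>v\<in>{1..n}. joined s (present_edges s n ?f) v (insert t A)" if A: "A \<in> \<A>" for A
      proof -
        obtain j where j: "j < x" "\<forall>e\<in>K2 t (u A j) A. f e" using P A unfolding P1_def by auto
        note uj = u[OF A j(1)]
        have AQ: "A \<inter> Q = {}" using finA(2)[OF A] Q(1) by auto
        have "insert (u A j) S \<in> present_edges s n ?f" if S: "S \<subseteq> insert t A" "card S = s - 1" for S
        proof (cases "t \<in> S")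
          case False
          then have "insert (u A j) S \<in> K1 (u A j) A" using S by (auto simp: K1_def)
          moreover have "insert (u A j) S \<inter> Q = {}" using False S AQ uj(3) by auto
          ultimately show ?thesis using K1(1)[OF A uj(1,2)] uj(4) by (auto simp: present_edges_def)
        next
          case True
          have fS: "finite S" using S(1) finA(1)[OF A] finite_subset by auto
          have "S - {t} \<subseteq> A" "card (S - {t}) = s - 2" using S True fS by auto
          moreover have "insert (u A j) S = insert (u A j) (insert t (S - {t}))" using True by auto
          ultimately have "insert (u A j) S \<in> K2 t (u A j) A" unfolding K2_def by blast
          moreover have "insert (u A j) S \<inter> Q \<noteq> {}" using True t by auto
          ultimately show ?thesis using K2(1)[OF A uj(1,2) t uj(3)] j(2) by (auto simp: present_edges_def)
        qed
        then show ?thesis using uj(1) unfolding joined_def by blast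
      qed
      moreover have "t \<in> {1..n} - Z" using t Q(1) by auto
      ultimately show False using f by blast
    qed
    define KA where "KA t A = (\<Union>j\<in>{..<x}. K2 t (u A j) A)" for t A
    \<comment> \<open>An edge of \<open>K2 t (u A j) A\<close> reveals \<open>t\<close> as its trace
      on \<open>Q\<close>, and \<open>u A j\<close> as what remains outside \<open>Z\<close> and
      \<open>Q\<close>. Hence the edge sets for different \<open>t\<close>, \<open>A\<close> or
      \<open>j\<close> are disjoint and the corresponding events independent.\<close>
    have K2_t: "e \<inter> Q = {t}" if "e \<in> K2 t (u A j) A" "t \<in> Q" "A \<in> \<A>" "j < x" for e t A j
      using that u(3)[OF that(3,4)] finA(2)[OF that(3)] Q(1) unfolding K2_def by auto
    have K2_u: "e - Z - Q = {u A j}" if "e \<in> K2 t (u A j) A" "t \<in> Q" "A \<in> \<A>" "j < x" for e t A j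
      using that u(2,3)[OF that(3,4)] finA(2)[OF that(3)] Q(1) unfolding K2_def by auto
    have dep1: "depends_only_on (P1 t A) (KA t A)" for t A
      unfolding depends_only_on_def P1_def KA_def by (auto; blast)
    have pr1: "?prob {f. P1 t A f} = 1 - (1 - q ^ (r choose (s - 2))) ^ x" if "t \<in> Q" "A \<in> \<A>" for t A
    proof -
      have disj: "disjoint_family_on (\<lambda>j. K2 t (u A j) A) {..<x}"
        unfolding disjoint_family_on_def
      proof (intro ballI impI equals0I)
        fix j j' e assume a: "j \<in> {..<x}" "j' \<in> {..<x}" "j \<noteq> j'" "e \<in> K2 t (u A j) A \<inter> K2 t (u A j') A"
        then have "u A j = u A j'" using K2_u[OF _ that, of e j] K2_u[OF _ that, of e j'] by auto
        then show False using uinj[OF that(2) _ that(2), of j j'] a by auto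
      qed
      have "?prob {f. \<forall>j\<in>{..<x}. \<not> (\<forall>e\<in>K2 t (u A j) A. f e)} =
          (\<Prod>j\<in>{..<x}. ?prob {f. \<not> (\<forall>e\<in>K2 t (u A j) A. f e)})"
        by (rule prob_Pi_pmf_Ball[OF _ _ depends_only_on_not_all disj]) auto
      also have "\<dots> = (\<Prod>j\<in>{..<x}. 1 - q ^ (r choose (s - 2)))"
      proof (rule prod.cong[OF refl])
        fix j assume "j \<in> {..<x}"
        then have j: "j < x" by simp
        note uj = u[OF that(2) j]
        show "?prob {f. \<not> (\<forall>e\<in>K2 t (u A j) A. f e)} = 1 - q ^ (r choose (s - 2))"
          using prob_bernoulli_not_all[OF finite_possible_edges K2(1)[OF that(2) uj(1,2) that(1) uj(3)] q]
            K2(2)[OF that(2) uj(1,2) that(1) uj(3)] by simp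
      qed
      finally show ?thesis unfolding P1_def by (subst prob_Pi_pmf_not) simp
    qed
    have pr2: "?prob {f. \<forall>A\<in>\<A>. P1 t A f} = (1 - (1 - q ^ (r choose (s - 2))) ^ x) ^ card \<A>" if "t \<in> Q" for t
    proof -
      have disj: "disjoint_family_on (KA t) \<A>"
        unfolding disjoint_family_on_def KA_def
      proof (intro ballI impI equals0I)
        fix A A' e assume a: "A \<in> \<A>" "A' \<in> \<A>" "A \<noteq> A'"
          "e \<in> (\<Union>j\<in>{..<x}. K2 t (u A j) A) \<inter> (\<Union>j\<in>{..<x}. K2 t (u A' j) A')"
        then obtain j j' where jj: "j < x" "j' < x" "e \<in> K2 t (u A j) A" "e \<in> K2 t (u A' j') A'" by auto
        have "{u A j} = {u A' j'}"
          using K2_u[OF jj(3) that a(1) jj(1)] K2_u[OF jj(4) that a(2) jj(2)] by (rule trans[OF sym])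
        then show False using uinj[OF a(1) jj(1) a(2) jj(2)] a(3) by simp
      qed
      have "?prob {f. \<forall>A\<in>\<A>. P1 t A f} = (\<Prod>A\<in>\<A>. ?prob {f. P1 t A f})"
        by (rule prob_Pi_pmf_Ball[OF _ fin\<A> dep1 disj]) auto
      then show ?thesis using pr1[OF that] by simp
    qed
    have "?prob {f. \<forall>t\<in>Q. \<not> (\<forall>A\<in>\<A>. P1 t A f)} = (\<Prod>t\<in>Q. ?prob {f. \<not> (\<forall>A\<in>\<A>. P1 t A f)})"
    proof (rule prob_Pi_pmf_Ball[OF _ finQ, where K="\<lambda>t. \<Union>A\<in>\<A>. KA t A"])
      fix t assume "t \<in> Q"
      show "depends_only_on (\<lambda>f. \<not> (\<forall>A\<in>\<A>. P1 t A f)) (\<Union>A\<in>\<A>. KA t A)"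
        unfolding depends_only_on_def
      proof (intro allI impI)
        fix f f' :: "nat set \<Rightarrow> bool" assume "\<forall>e\<in>\<Union> (KA t ` \<A>). f e = f' e"
        then have "P1 t A f = P1 t A f'" if "A \<in> \<A>" for A
          using depends_only_onD[OF dep1, of t A f f'] that by blast
        then show "(\<not> (\<forall>A\<in>\<A>. P1 t A f)) = (\<not> (\<forall>A\<in>\<A>. P1 t A f'))" by blast
      qed
    next
      show "disjoint_family_on (\<lambda>t. \<Union>A\<in>\<A>. KA t A) Q"
        unfolding disjoint_family_on_def KA_def
      proof (intro ballI impI equals0I)
        fix t t' e assume a: "t \<in> Q" "t' \<in> Q" "t \<noteq> t'"
          "e \<in> (\<Union>A\<in>\<A>. \<Union>j\<in>{..<x}. K2 t (u A j) A) \<inter> (\<Union>A\<in>\<A>. \<Union>j\<in>{..<x}. K2 t' (u A j) A)"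
        from a(4) obtain A j A' j' where jj: "A \<in> \<A>" "j < x" "A' \<in> \<A>" "j' < x"
          "e \<in> K2 t (u A j) A" "e \<in> K2 t' (u A' j') A'" by auto
        have "{t} = {t'}"
          using K2_t[OF jj(5) a(1) jj(1,2)] K2_t[OF jj(6) a(2) jj(3,4)] by (rule trans[OF sym])
        with a(3) show False by simp
      qed
    qed auto
    also have "\<dots> = (1 - (1 - (1 - q ^ (r choose (s - 2))) ^ x) ^ card \<A>) ^ y"
      unfolding prob_Pi_pmf_not using pr2 Q(2) by simp
    also have "\<dots> \<le> ?c"
      using q \<A>(2) by (intro power_mono diff_mono power_decreasing)
        (auto simp: power_le_one)
    finally show ?thesis
      using measure_pmf.finite_measure_mono[OF sub, of "edge_indicator_pmf s n q"] by auto
  qed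
  have c0: "0 \<le> ?c"
    using q by (auto simp: power_le_one)
  have "?prob {f. \<not> ?ext (present_edges s n f)} \<le> ?prob {f. \<not> Good f} + ?c"
    by (rule prob_Pi_pmf_two_stage[OF finite_possible_edges cond c0])
  with bad show ?thesis by linarith
qed

section \<open>Asymptotics of the failure probability\<close>

lemma power_times_exp_minus_powr_tendsto_0:
  assumes "c > 0" "a > 0"
  shows "(\<lambda>n. real n ^ k * exp (- (c * real n powr a))) \<longlonglongrightarrow> 0"
proof -
  \<comment> \<open>With \<open>k \<le> a * j\<close>, the factor \<open>n ^ k\<close> is at most
    the \<open>j\<close>-th power of \<open>n powr a\<close>, which the exponential beats.\<close>
  define j where "j = nat \<lceil>real k / a\<rceil>"
  have j: "real k \<le> a * real j"
    using assms(2) by (simp add: j_def field_simps) (metis assms(2) ceiling_divide_upper mult.commute)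
  have "filterlim (\<lambda>n. c * real n powr a) at_top sequentially"
    using assms
    by (intro filterlim_tendsto_pos_mult_at_top[OF tendsto_const] filterlim_compose[OF real_powr_at_top filterlim_real_sequentially]) auto
  from filterlim_compose[OF tendsto_power_div_exp_0 this, of j]
  have "(\<lambda>n. (1 / c ^ j) * ((c * real n powr a) ^ j / exp (c * real n powr a))) \<longlonglongrightarrow> (1 / c ^ j) * 0"
    by (intro tendsto_mult tendsto_const)
  moreover have "(1 / c ^ j) * ((c * t) ^ j / exp (c * t)) = t ^ j * exp (- (c * t))" for t
    using assms(1) by (simp add: power_mult_distrib exp_minus field_simps)
  ultimately have lim: "(\<lambda>n. (real n powr a) ^ j * exp (- (c * real n powr a))) \<longlonglongrightarrow> 0"
    by (simp only: mult_zero_right)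
  show ?thesis
  proof (rule Lim_null_comparison[OF _ lim])
    show "\<forall>\<^sub>F n in sequentially. norm (real n ^ k * exp (- (c * real n powr a))) \<le>
      (real n powr a) ^ j * exp (- (c * real n powr a))"
      using eventually_ge_at_top[of 1]
    proof eventually_elim
      case (elim n)
      have "real n ^ k = real n powr real k" using elim by (simp add: powr_realpow)
      also have "\<dots> \<le> real n powr (a * real j)" using elim j by (intro powr_mono) auto
      also have "\<dots> = (real n powr a) ^ j" using elim by (simp add: powr_powr[symmetric] powr_realpow)
      finally show ?case by (simp add: mult_right_mono)
    qed
  qed
qed

text \<open>Since \<open>exp t \<ge> 1 + t\<close>, it is enough that
  \<open>(1 - t / 2) * (1 + t) = 1 + t * (1 - t) / 2\<close> is at least 1. It serves to turn an
  exponential upper bound on missing into a linear lower bound on hitting.\<close>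

lemma exp_minus_le_linear: "exp (- t) \<le> 1 - t / 2" if "0 \<le> t" "t \<le> 1" for t :: real
proof -
  have "(1 - t / 2) * exp t \<ge> (1 - t / 2) * (1 + t)"
    using that exp_ge_add_one_self[of t] by (intro mult_left_mono) auto
  moreover have "(1 - t / 2) * (1 + t) \<ge> 1"
    using that mult_left_mono[of t 1 t] by (simp add: algebra_simps)
  ultimately have "1 \<le> (1 - t / 2) * exp t" by linarith
  then show ?thesis by (simp add: exp_minus field_simps)
qed

lemma power_one_minus_le_exp: "0 \<le> t \<Longrightarrow> t \<le> 1 \<Longrightarrow> (1 - t) ^ h \<le> exp (- (t * real h))" for t :: real
  using power_mono[of "1 - t" "exp (- t)" h] exp_ge_add_one_self[of "- t"]
  by (simp add: exp_of_nat_mult[symmetric] mult.commute)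

lemma card_small_subsets_le:
  assumes "n \<ge> 1"
  shows "card {Z. Z \<subseteq> {1..n} \<and> card Z \<le> K} \<le> (K + 1) * n ^ K"
proof -
  have "{Z. Z \<subseteq> {1..n} \<and> card Z \<le> K} = (\<Union>k\<le>K. {Z. Z \<subseteq> {1..n} \<and> card Z = k})" by auto
  then have "card {Z. Z \<subseteq> {1..n} \<and> card Z \<le> K} \<le> (\<Sum>k\<le>K. card {Z. Z \<subseteq> {1..n} \<and> card Z = k})"
    by (simp add: card_UN_le)
  also have "\<dots> \<le> (\<Sum>k\<le>K. n ^ K)"
  proof (rule sum_mono)
    fix k assume k: "k \<in> {..K}"
    have "card {Z. Z \<subseteq> {1..n} \<and> card Z = k} = n choose k" by (simp add: n_subsets)
    also have "\<dots> \<le> n ^ k"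
      by (cases "k \<le> n") (auto simp: binomial_le_pow binomial_eq_0)
    also have "\<dots> \<le> n ^ K" using k assms by (intro power_increasing) auto
    finally show "card {Z. Z \<subseteq> {1..n} \<and> card Z = k} \<le> n ^ K" .
  qed
  finally show ?thesis by simp
qed

text \<open>Union bound: there are polynomially many sets \<open>Z\<close>, each with at most
  \<open>2 ^ 2 ^ K\<close> families, so it suffices that a single failure is less likely than any
  fixed power of \<open>1 / n\<close>.\<close>

lemma prob_not_extendable_le:
  assumes "s \<ge> 2" "0 \<le> q" "q \<le> 1" "n \<ge> 1" "D * (x * h) + y \<le> n - K"
  shows "measure_pmf.prob (edge_indicator_pmf s n q) {f. \<not> extendable s r D K n (present_edges s n f)} \<le>
    real ((K + 1) * n ^ K * 2 ^ 2 ^ K) * (real D * real x * (1 - q ^ (r choose (s - 1))) ^ h +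
    (1 - (1 - (1 - q ^ (r choose (s - 2))) ^ x) ^ D) ^ y)" (is "_ \<le> _ * ?b")
proof -
  let ?Q = "edge_indicator_pmf s n q"
  define bad where "bad Z \<A> = {f. \<not> (\<exists>p\<in>{1..n} - Z. \<forall>A\<in>\<A>. \<exists>u\<in>{1..n}. joined s (present_edges s n f) u (insert p A))}"
    for Z \<A>
  define I where "I = (SIGMA Z:{Z. Z \<subseteq> {1..n} \<and> card Z \<le> K}. {\<A>. \<A> \<subseteq> {A. A \<subseteq> Z \<and> card A = r} \<and> card \<A> \<le> D})"
  have finZ: "finite Z" if "Z \<subseteq> {1..n}" for Z using that finite_subset by blast
  have fin: "finite {Z. Z \<subseteq> {1..n} \<and> card Z \<le> K}" by simp
  have fin2: "finite {\<A>. \<A> \<subseteq> {A. A \<subseteq> Z \<and> card A = r} \<and> card \<A> \<le> D}"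
    "card {\<A>. \<A> \<subseteq> {A. A \<subseteq> Z \<and> card A = r} \<and> card \<A> \<le> D} \<le> 2 ^ 2 ^ K"
    if Z: "Z \<subseteq> {1..n}" "card Z \<le> K" for Z
  proof -
    have sub: "{\<A>. \<A> \<subseteq> {A. A \<subseteq> Z \<and> card A = r} \<and> card \<A> \<le> D} \<subseteq> Pow (Pow Z)" by auto
    show "finite {\<A>. \<A> \<subseteq> {A. A \<subseteq> Z \<and> card A = r} \<and> card \<A> \<le> D}"
      using finite_subset[OF sub] finZ[OF Z(1)] by simp
    have "card {\<A>. \<A> \<subseteq> {A. A \<subseteq> Z \<and> card A = r} \<and> card \<A> \<le> D} \<le> card (Pow (Pow Z))"
      using finZ[OF Z(1)] by (intro card_mono sub) simp
    also have "\<dots> = 2 ^ 2 ^ card Z" using finZ[OF Z(1)] by (simp add: card_Pow)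
    also have "\<dots> \<le> 2 ^ 2 ^ K" using Z(2) by (intro power_increasing) auto
    finally show "card {\<A>. \<A> \<subseteq> {A. A \<subseteq> Z \<and> card A = r} \<and> card \<A> \<le> D} \<le> 2 ^ 2 ^ K" .
  qed
  have finI: "finite I" unfolding I_def using fin fin2(1) by (intro finite_SigmaI) auto
  have "card I = (\<Sum>Z\<in>{Z. Z \<subseteq> {1..n} \<and> card Z \<le> K}. card {\<A>. \<A> \<subseteq> {A. A \<subseteq> Z \<and> card A = r} \<and> card \<A> \<le> D})"
    unfolding I_def using fin fin2(1) by (intro card_SigmaI) auto
  also have "\<dots> \<le> (\<Sum>Z\<in>{Z. Z \<subseteq> {1..n} \<and> card Z \<le> K}. 2 ^ 2 ^ K)"
    using fin2(2) by (intro sum_mono) auto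
  also have "\<dots> \<le> (K + 1) * n ^ K * 2 ^ 2 ^ K"
    using card_small_subsets_le[OF assms(4), of K] by simp
  finally have cardI: "card I \<le> (K + 1) * n ^ K * 2 ^ 2 ^ K" .
  have b0: "0 \<le> ?b" using assms(2,3) by (auto simp: power_le_one)
  have "{f. \<not> extendable s r D K n (present_edges s n f)} \<subseteq> (\<Union>i\<in>I. bad (fst i) (snd i))"
  proof
    fix f assume "f \<in> {f. \<not> extendable s r D K n (present_edges s n f)}"
    then obtain Z \<A> where Z: "Z \<subseteq> {1..n} \<and> card Z \<le> K \<and> \<A> \<subseteq> {A. A \<subseteq> Z \<and> card A = r} \<and> card \<A> \<le> D"
      "\<not> (\<exists>p\<in>{1..n} - Z. \<forall>A\<in>\<A>. \<exists>u\<in>{1..n}. joined s (present_edges s n f) u (insert p A))"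
      unfolding extendable_def mem_Collect_eq by blast
    then have "(Z, \<A>) \<in> I" "f \<in> bad Z \<A>" unfolding I_def bad_def by auto
    then show "f \<in> (\<Union>i\<in>I. bad (fst i) (snd i))" by force
  qed
  then have "measure_pmf.prob ?Q {f. \<not> extendable s r D K n (present_edges s n f)} \<le>
      measure_pmf.prob ?Q (\<Union>i\<in>I. bad (fst i) (snd i))"
    by (intro measure_pmf.finite_measure_mono) auto
  also have "\<dots> \<le> (\<Sum>i\<in>I. measure_pmf.prob ?Q (bad (fst i) (snd i)))"
    using finI by (intro measure_pmf.finite_measure_subadditive_finite) auto
  also have "\<dots> \<le> (\<Sum>i\<in>I. ?b)"
  proof (rule sum_mono)
    fix i assume "i \<in> I"
    then obtain Z \<A> where i: "i = (Z, \<A>)" "Z \<subseteq> {1..n}" "card Z \<le> K" "\<A> \<subseteq> {A. A \<subseteq> Z \<and> card A = r}" "card \<A> \<le> D"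
      unfolding I_def by auto
    have "D * (x * h) + y \<le> n - card Z" using assms(5) i(3) by linarith
    from prob_no_extension[OF assms(1-3) i(2,4,5) this]
    show "measure_pmf.prob ?Q (bad (fst i) (snd i)) \<le> ?b" unfolding i(1) fst_conv snd_conv bad_def .
  qed
  also have "\<dots> \<le> real ((K + 1) * n ^ K * 2 ^ 2 ^ K) * ?b"
    using of_nat_mono[OF cardI, where 'a=real] b0 by (simp only: sum_constant mult_right_mono)
  finally show ?thesis .
qed

text \<open>About \<open>n powr (1 - \<alpha> * \<beta>)\<close> vertices are joined to a given
  \<open>A\<close>, and a candidate \<open>p\<close> completes one of them with probability about
  \<open>n powr (1 - \<alpha> * (\<beta> + \<gamma>))\<close>. Among \<open>n\<close> candidates the
  number serving \<open>D\<close> sets at once has exponent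
  \<open>1 - D * (\<alpha> * (\<beta> + \<gamma>) - 1)\<close>, which is positive.\<close>

lemma prob_not_extendable_tendsto_0:
  fixes r s D K :: nat and \<alpha> :: real
  defines "\<beta> \<equiv> real (r choose (s - 1))" and "\<gamma> \<equiv> real (r choose (s - 2))"
  assumes s: "s \<ge> 2" and \<alpha>: "\<alpha> > 0" "\<alpha> * \<beta> < 1" "1 \<le> \<alpha> * (\<beta> + \<gamma>)" "D * (\<alpha> * (\<beta> + \<gamma>) - 1) < 1"
  shows "(\<lambda>n. measure_pmf.prob (edge_indicator_pmf s n (real n powr - \<alpha>))
    {f. \<not> extendable s r D K n (present_edges s n f)}) \<longlonglongrightarrow> 0"
proof -
  \<comment> \<open>The slack in the exponents: the first bound keeps \<open>\<xi>\<close>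
    nonnegative, the second keeps \<open>\<kappa>\<close> positive.\<close>
  define \<delta> where "\<delta> = min ((1 - \<alpha> * \<beta>) / 3) ((1 - D * (\<alpha> * (\<beta> + \<gamma>) - 1)) / (2 * D + 1) / 2)"
  have \<delta>0: "\<delta> > 0" using \<alpha> by (simp add: \<delta>_def)
  \<comment> \<open>Blocks of length about \<open>n powr \<eta>\<close> are searched for about
    \<open>n powr \<xi>\<close> vertices joined to \<open>A\<close>; all blocks fit since
    \<open>\<xi> + \<eta> = 1 - \<delta>\<close>. A candidate serves one \<open>A\<close> with
    probability of order at least \<open>n powr - \<sigma>\<close>, so the expected number serving
    all of them is of order at least \<open>n powr \<kappa>\<close>.\<close>
  define \<xi> \<eta> \<sigma> \<kappa> :: real where "\<xi> = 1 - \<alpha> * \<beta> - 2 * \<delta>" and "\<eta> = \<alpha> * \<beta> + \<delta>"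
    and "\<sigma> = \<alpha> * (\<beta> + \<gamma>) - 1 + 2 * \<delta>" and "\<kappa> = 1 - real D * \<sigma>"
  have "\<delta> \<le> (1 - \<alpha> * \<beta>) / 3" unfolding \<delta>_def by (rule min.cobounded1)
  then have "3 * \<delta> \<le> 1 - \<alpha> * \<beta>" by simp
  then have \<xi>: "\<xi> \<ge> 0" using \<delta>0 unfolding \<xi>_def by simp
  have "\<delta> \<le> (1 - D * (\<alpha> * (\<beta> + \<gamma>) - 1)) / (2 * D + 1) / 2" unfolding \<delta>_def by (rule min.cobounded2)
  then have "2 * (\<delta> * (2 * D + 1)) \<le> 1 - D * (\<alpha> * (\<beta> + \<gamma>) - 1)" by (simp add: field_simps)
  moreover have "\<kappa> = 1 - D * (\<alpha> * (\<beta> + \<gamma>) - 1) - 2 * (real D * \<delta>)"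
    by (simp add: \<kappa>_def \<sigma>_def algebra_simps)
  moreover have "2 * (\<delta> * (2 * D + 1)) = 4 * (real D * \<delta>) + 2 * \<delta>" by (simp add: algebra_simps)
  moreover have "real D * \<delta> \<ge> 0" using \<delta>0 by simp
  ultimately have \<kappa>: "\<kappa> > 0" using \<delta>0 by linarith
  have \<eta>: "\<eta> \<ge> 0" using \<alpha>(1) \<delta>0 unfolding \<eta>_def \<beta>_def by simp
  define x h y where "x n = nat \<lfloor>real n powr \<xi>\<rfloor>" and "h n = nat \<lceil>real n powr \<eta>\<rceil>" and "y n = n div 3" for n :: nat
  \<comment> \<open>One factor 1/4 for each of \<open>D\<close> sets and one from
    \<open>y n \<ge> n / 4\<close>.\<close>
  define c :: real where "c = (1 / 4) ^ (D + 1)"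
  have c: "c > 0" by (simp add: c_def)
  define B where "B n = real ((K + 1) * n ^ K * 2 ^ 2 ^ K) *
     (real D * real n * exp (- (1 * real n powr \<delta>)) + exp (- (c * real n powr \<kappa>)))" for n :: nat
  have "(\<lambda>n. real n powr - \<delta>) \<longlonglongrightarrow> 0"
    using \<delta>0 by (intro tendsto_neg_powr filterlim_real_sequentially) auto
  \<comment> \<open>The constant is such that the blocks occupy at most \<open>n / 3\<close>
    vertices.\<close>
  then have ev: "\<forall>\<^sub>F n in sequentially. real n powr - \<delta> < 1 / (6 * (real D + 1))"
    by (rule order_tendstoD) simp
  have le: "\<forall>\<^sub>F n in sequentially. measure_pmf.prob (edge_indicator_pmf s n (real n powr - \<alpha>))
      {f. \<not> extendable s r D K n (present_edges s n f)} \<le> B n"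
    using ev eventually_ge_at_top[of "12 + 3 * K"]
  proof eventually_elim
    case (elim n)
    have n: "n \<ge> 1" "real n \<ge> 1" using elim by auto
    define q where "q = real n powr - \<alpha>"
    have q: "0 \<le> q" "q \<le> 1" using powr_minus_le_1[OF \<alpha>(1)] by (auto simp: q_def)
    have q\<beta>: "q ^ (r choose (s - 1)) = real n powr - (\<alpha> * \<beta>)"
      using n by (simp add: q_def powr_realpow[symmetric] powr_powr \<beta>_def)
    have q\<gamma>: "q ^ (r choose (s - 2)) = real n powr - (\<alpha> * \<gamma>)"
      using n by (simp add: q_def powr_realpow[symmetric] powr_powr \<gamma>_def)
    have x1: "real (x n) \<le> real n powr \<xi>" by (simp add: x_def)
    have "1 \<le> real n powr \<xi>" using n \<xi> by (simp add: ge_one_powr_ge_zero)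
    then have "1 \<le> \<lfloor>real n powr \<xi>\<rfloor>" by simp
    then have "real (x n) = of_int \<lfloor>real n powr \<xi>\<rfloor>" "(1 :: real) \<le> of_int \<lfloor>real n powr \<xi>\<rfloor>"
      unfolding x_def by auto
    then have x2: "real n powr \<xi> / 2 \<le> real (x n)"
      using real_of_int_floor_add_one_gt[of "real n powr \<xi>"] by linarith
    have h1: "real n powr \<eta> \<le> real (h n)" by (simp add: h_def)
    have "1 \<le> real n powr \<eta>" using n \<eta> by (simp add: ge_one_powr_ge_zero)
    moreover have "real (h n) = of_int \<lceil>real n powr \<eta>\<rceil>" unfolding h_def by simp
    ultimately have h2: "real (h n) \<le> 2 * real n powr \<eta>"
      using of_int_ceiling_le_add_one[of "real n powr \<eta>"] by linarith
    have y: "real n / 4 \<le> real (y n)" "real (y n) \<le> real n / 3" using elim(2) unfolding y_def by linarith+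
    have "real (D * (x n * h n)) \<le> real D * (real n powr \<xi> * (2 * real n powr \<eta>))"
      unfolding of_nat_mult by (intro mult_left_mono mult_mono x1 h2) auto
    also have "\<dots> = 2 * real D * real n powr (1 - \<delta>)"
    proof -
      have "\<xi> + \<eta> = 1 - \<delta>" by (simp add: \<xi>_def \<eta>_def)
      then show ?thesis by (simp add: powr_add[symmetric])
    qed
    also have "\<dots> = 2 * real D * (real n * real n powr - \<delta>)"
      using n by (simp add: powr_diff powr_minus divide_inverse)
    also have "\<dots> \<le> 2 * (real D + 1) * (real n * (1 / (6 * (real D + 1))))"
      using elim(1) by (intro mult_mono) auto
    also have "\<dots> = real n / 3" by (simp add: field_simps)
    finally have "real (D * (x n * h n) + y n) \<le> real n / 3 + real n / 3" using y by simp
    also have "\<dots> \<le> real (n - K)" using elim(2) by simp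
    finally have size: "D * (x n * h n) + y n \<le> n - K" by linarith
    have t1: "(1 - q ^ (r choose (s - 1))) ^ h n \<le> exp (- (1 * real n powr \<delta>))"
    proof -
      have "(1 - q ^ (r choose (s - 1))) ^ h n \<le> exp (- (q ^ (r choose (s - 1)) * real (h n)))"
        using q by (intro power_one_minus_le_exp) (auto simp: power_le_one)
      also have "real n powr \<delta> = real n powr - (\<alpha> * \<beta>) * real n powr \<eta>"
        by (simp add: powr_add[symmetric] \<eta>_def)
      then have "exp (- (q ^ (r choose (s - 1)) * real (h n))) \<le> exp (- (1 * real n powr \<delta>))"
        unfolding q\<beta> using h1 by (simp add: mult_left_mono)
      finally show ?thesis .
    qed
    have xn: "real (x n) \<le> real n"
      using x1 powr_mono[of \<xi> 1 "real n"] n \<alpha> \<delta>0 unfolding \<xi>_def \<beta>_def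
      by (smt (verit) mult_nonneg_nonneg of_nat_0_le_iff powr_one)
    have t2: "(1 - (1 - (1 - q ^ (r choose (s - 2))) ^ x n) ^ D) ^ y n \<le> exp (- (c * real n powr \<kappa>))"
    proof -
      \<comment> \<open>Up to the rounding of \<open>x n\<close>, this is the expected number of
        vertices \<open>u A j\<close> that a candidate completes for one \<open>A\<close>. Rounding
        costs a factor 2, and so does the passage from expectation to probability.\<close>
      define \<tau> where "\<tau> = real n powr - \<sigma>"
      let ?\<rho> = "q ^ (r choose (s - 2))"
      have \<tau>: "?\<rho> * real n powr \<xi> = \<tau>"
        by (simp add: q\<gamma> \<tau>_def powr_add[symmetric] \<xi>_def \<sigma>_def algebra_simps)
      have \<sigma>0: "\<sigma> > 0" using \<alpha>(3) \<delta>0 by (simp add: \<sigma>_def)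
      have \<tau>01: "0 \<le> \<tau>" "\<tau> \<le> 1" using powr_minus_le_1[OF \<sigma>0] by (auto simp: \<tau>_def)
      have a1: "?\<rho> * real (x n) \<le> \<tau>" unfolding \<tau>[symmetric] using x1 q by (intro mult_left_mono) auto
      have a2: "\<tau> / 2 \<le> ?\<rho> * real (x n)"
        using mult_left_mono[OF x2, of ?\<rho>] q unfolding \<tau>[symmetric] by simp
      have "(1 - ?\<rho>) ^ x n \<le> exp (- (?\<rho> * real (x n)))"
        using q by (intro power_one_minus_le_exp) (auto simp: power_le_one)
      also have "\<dots> \<le> 1 - ?\<rho> * real (x n) / 2"
        using a1 \<tau>01 q by (intro exp_minus_le_linear) auto
      finally have "\<tau> / 4 \<le> 1 - (1 - ?\<rho>) ^ x n" using a2 by linarith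
      then have "(\<tau> / 4) ^ D \<le> (1 - (1 - ?\<rho>) ^ x n) ^ D" using \<tau>01 by (intro power_mono) auto
      then have "(1 - (1 - (1 - ?\<rho>) ^ x n) ^ D) ^ y n \<le> (1 - (\<tau> / 4) ^ D) ^ y n"
        using q by (intro power_mono) (auto simp: power_le_one)
      also have "\<dots> \<le> exp (- ((\<tau> / 4) ^ D * real (y n)))"
        using \<tau>01 by (intro power_one_minus_le_exp) (auto simp: power_le_one)
      also have "\<dots> \<le> exp (- (c * real n powr \<kappa>))"
      proof -
        have "c * real n powr \<kappa> = (\<tau> / 4) ^ D * (real n / 4)"
        proof -
          have "\<tau> ^ D = real n powr - (D * \<sigma>)"
            using n by (simp add: \<tau>_def powr_realpow[symmetric] powr_powr mult.commute)
          then have "real n powr \<kappa> = \<tau> ^ D * real n"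
            using n by (simp add: \<kappa>_def powr_diff powr_minus divide_inverse)
          then show ?thesis by (simp add: c_def power_divide)
        qed
        also have "\<dots> \<le> (\<tau> / 4) ^ D * real (y n)" using y \<tau>01 by (intro mult_left_mono) auto
        finally show ?thesis by simp
      qed
      finally show ?thesis .
    qed
    have "measure_pmf.prob (edge_indicator_pmf s n q) {f. \<not> extendable s r D K n (present_edges s n f)} \<le>
      real ((K + 1) * n ^ K * 2 ^ 2 ^ K) * (real D * real (x n) * (1 - q ^ (r choose (s - 1))) ^ h n +
      (1 - (1 - (1 - q ^ (r choose (s - 2))) ^ x n) ^ D) ^ y n)"
      by (rule prob_not_extendable_le[OF s q n(1) size])
    also have "\<dots> \<le> B n"
      unfolding B_def using t1 t2 xn q
      by (intro mult_left_mono add_mono mult_mono) (auto simp: power_le_one)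
    finally show ?case unfolding q_def .
  qed
  have "(\<lambda>n. real (K + 1) * 2 ^ 2 ^ K * (real D * (real n ^ (K + 1) * exp (- (1 * real n powr \<delta>)))
      + real n ^ K * exp (- (c * real n powr \<kappa>)))) \<longlonglongrightarrow> real (K + 1) * 2 ^ 2 ^ K * (real D * 0 + 0)"
    by (intro tendsto_mult tendsto_add tendsto_const power_times_exp_minus_powr_tendsto_0 \<delta>0 \<kappa> c) auto
  then have "B \<longlonglongrightarrow> 0"
    unfolding B_def by (simp add: algebra_simps)
  then show ?thesis
    by (rule Lim_null_comparison[rotated]) (use le in auto)
qed

section \<open>The critical pattern\<close>

text \<open>Cluster 0 is larger by one because \<open>b\<close> is counted there.\<close>

definition cluster_size :: "nat \<Rightarrow> nat \<Rightarrow> nat" where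
  "cluster_size d i = (if i = 0 then d + 1 else d)"

definition cluster_index :: "nat \<Rightarrow> nat \<Rightarrow> (nat \<times> nat) set" where
  "cluster_index m d = (SIGMA i:{..m}. {..<cluster_size d i})"

text \<open>\<open>Inl i\<close> stands for the free vertex \<open>a i\<close> and
  \<open>Inr (i, j)\<close> for the \<open>j\<close>-th prescribed member of cluster
  \<open>i\<close>. Sharing \<open>m + 1\<close> free vertices among \<open>m + 1\<close> clusters
  brings the ratio of free to attached vertices just below \<open>1 / d\<close>. A single cluster of
  size \<open>d + 1\<close> over \<open>m \<ge> 2\<close> free vertices would be critical at
  \<open>\<epsilon> = m / (d + 1)\<close>, too large for \<open>d\<close> vertices to be
  coverable.\<close>

definition pattern_vertices :: "nat \<Rightarrow> nat \<Rightarrow> (nat + nat \<times> nat) set" where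
  "pattern_vertices m d = Inl ` {..m} \<union> Inr ` cluster_index m d"

definition pattern_edges :: "nat \<Rightarrow> nat \<Rightarrow> nat \<Rightarrow> (nat + nat \<times> nat) set set" where
  "pattern_edges s m d = {insert (Inr (i, j)) (Inl ` S) | i j S. (i, j) \<in> cluster_index m d \<and> S \<subseteq> {..m} - {i} \<and> card S = s - 1}"

lemma finite_cluster_index [simp]: "finite (cluster_index m d)"
  by (simp add: cluster_index_def)

lemma card_cluster_index: "card (cluster_index m d) = (m + 1) * d + 1"
proof -
  have "card (cluster_index m d) = (\<Sum>i\<in>{..m}. cluster_size d i)"
    by (simp add: cluster_index_def)
  also have "\<dots> = (\<Sum>i\<in>{..m}. d + (if i = 0 then 1 else 0))"
    by (intro sum.cong) (auto simp: cluster_size_def)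
  also have "\<dots> = (m + 1) * d + 1"
    by (subst sum.distrib) simp
  finally show ?thesis .
qed

lemma finite_pattern_vertices [simp]: "finite (pattern_vertices m d)"
  by (simp add: pattern_vertices_def)

lemma card_pattern_vertices: "card (pattern_vertices m d) = (m + 1) + ((m + 1) * d + 1)"
proof -
  have "card (pattern_vertices m d) = card (Inl ` {..m} :: (nat + nat \<times> nat) set) + card (Inr ` cluster_index m d :: (nat + nat \<times> nat) set)"
    unfolding pattern_vertices_def by (intro card_Un_disjoint) auto
  also have "\<dots> = card {..m} + card (cluster_index m d)"
    by (simp add: card_image)
  finally show ?thesis by (simp add: card_cluster_index)
qed

text \<open>Every edge has exactly one vertex of the form \<open>Inr x\<close>, so edges are counted
  by that vertex and the set of free vertices it is combined with.\<close>

lemma pattern_edges_within: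
  assumes "J \<subseteq> pattern_vertices m d"
  shows "card {e \<in> pattern_edges s m d. e \<subseteq> J} =
    (\<Sum>(i, j)\<in>{x \<in> cluster_index m d. Inr x \<in> J}. card ({k. Inl k \<in> J} - {i}) choose (s - 1))"
proof -
  let ?X = "{x \<in> cluster_index m d. Inr x \<in> J}" and ?A = "{k. Inl k \<in> J}"
  let ?f = "\<lambda>(x, S). insert (Inr x) (Inl ` S) :: (nat + nat \<times> nat) set"
  have A: "?A \<subseteq> {..m}" using assms by (auto simp: pattern_vertices_def)
  have finA: "finite ?A" using A finite_subset by blast
  let ?I = "SIGMA x:?X. {S. S \<subseteq> ?A - {fst x} \<and> card S = s - 1}"
  have "{e \<in> pattern_edges s m d. e \<subseteq> J} = ?f ` ?I"
  proof (intro equalityI subsetI)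
    fix e assume "e \<in> {e \<in> pattern_edges s m d. e \<subseteq> J}"
    then obtain i j S where "e = insert (Inr (i, j)) (Inl ` S)" "(i, j) \<in> cluster_index m d"
      "S \<subseteq> {..m} - {i}" "card S = s - 1" "e \<subseteq> J"
      by (auto simp: pattern_edges_def)
    then have "((i, j), S) \<in> ?I" "e = ?f ((i, j), S)" by auto
    then show "e \<in> ?f ` ?I" by blast
  next
    fix e assume "e \<in> ?f ` ?I"
    then obtain i j S where e: "e = insert (Inr (i, j)) (Inl ` S)" "(i, j) \<in> cluster_index m d" "Inr (i, j) \<in> J"
      "S \<subseteq> ?A - {i}" "card S = s - 1" by auto
    then have "S \<subseteq> {..m} - {i}" using A by auto
    with e show "e \<in> {e \<in> pattern_edges s m d. e \<subseteq> J}" unfolding pattern_edges_def by auto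
  qed
  moreover have "inj_on ?f ?I"
  proof (rule inj_onI)
    fix a b :: "(nat \<times> nat) \<times> nat set"
    assume "?f a = ?f b"
    moreover obtain x S y T where "a = (x, S)" "b = (y, T)" by (cases a, cases b)
    moreover have "Inr -` insert (Inr x) (Inl ` S) = {x}" "Inl -` insert (Inr x) (Inl ` S) = S"
      for x :: "nat \<times> nat" and S :: "nat set" by auto
    ultimately show "a = b" by (metis case_prod_conv singleton_inject)
  qed
  ultimately have "card {e \<in> pattern_edges s m d. e \<subseteq> J} = card ?I"
    by (simp add: card_image)
  also have "\<dots> = (\<Sum>x\<in>?X. card {S. S \<subseteq> ?A - {fst x} \<and> card S = s - 1})"
    using finA by (intro card_SigmaI) auto
  also have "\<dots> = (\<Sum>(i, j)\<in>?X. card (?A - {i}) choose (s - 1))"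
    using finA by (intro sum.cong) (auto simp: n_subsets)
  finally show ?thesis .
qed

lemma pattern_edges_subset: "e \<in> pattern_edges s m d \<Longrightarrow> e \<subseteq> pattern_vertices m d"
  by (auto simp: pattern_edges_def pattern_vertices_def)

lemma uniform_pattern_edges:
  assumes "s \<ge> 2"
  shows "uniform_pattern s (pattern_vertices m d) (pattern_edges s m d)"
proof -
  have "card e = s" if "e \<in> pattern_edges s m d" for e
  proof -
    from that obtain i j S where e: "e = insert (Inr (i, j)) (Inl ` S)" "S \<subseteq> {..m} - {i}" "card S = s - 1"
      by (auto simp: pattern_edges_def)
    have "finite S" using e(2) finite_subset by blast
    then have "card e = Suc (card (Inl ` S :: (nat + nat \<times> nat) set))"
      unfolding e(1) by (intro card_insert_disjoint) auto
    then show ?thesis using e(3) assms by (simp add: card_image)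
  qed
  then show ?thesis using pattern_edges_subset[of _ s m d] unfolding uniform_pattern_def by simp blast
qed

lemma card_pattern_edges: "card (pattern_edges s m d) = ((m + 1) * d + 1) * (m choose (s - 1))"
proof -
  have "{e \<in> pattern_edges s m d. e \<subseteq> pattern_vertices m d} = pattern_edges s m d"
    using pattern_edges_subset by blast
  moreover have "{k. Inl k \<in> pattern_vertices m d} = {..m}"
    "{x \<in> cluster_index m d. Inr x \<in> pattern_vertices m d} = cluster_index m d"
    by (auto simp: pattern_vertices_def)
  ultimately have "card (pattern_edges s m d) =
      (\<Sum>(i, j)\<in>cluster_index m d. card ({..m} - {i}) choose (s - 1))"
    using pattern_edges_within[of "pattern_vertices m d" m d s] by simp
  also have "\<dots> = (\<Sum>(i, j)\<in>cluster_index m d. m choose (s - 1))"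
    by (intro sum.cong) (auto simp: cluster_index_def)
  finally show ?thesis by (simp add: card_cluster_index)
qed

text \<open>The number of vertices of the pattern divided by its number of edges.\<close>

definition critical_exponent :: "nat \<Rightarrow> nat \<Rightarrow> nat \<Rightarrow> real" where
  "critical_exponent s m d = (1 + (real m + 1) / ((real m + 1) * real d + 1)) / real (m choose (s - 1))"

text \<open>Pascal's rule separates the edges joining \<open>u\<close> to an \<open>m\<close>-set
  into those avoiding and those containing a fixed vertex of this set.\<close>

lemma choose_split:
  assumes "s \<ge> 2" "m \<ge> 1"
  shows "m choose (s - 1) = ((m - 1) choose (s - 1)) + ((m - 1) choose (s - 2))"
  using choose_reduce_nat[of m "s - 1"] assms by (simp add: numeral_2_eq_2)

section \<open>Balance of the pattern at the critical exponent\<close>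

context
  fixes s m d :: nat
  assumes s2: "s \<ge> 2" and ms: "m \<ge> s + 1" and d: "d \<ge> (m - 1) choose (s - 1)"
begin

lemma choose_pos: "0 < m choose (s - 1)" "0 < (m - 1) choose (s - 1)" "0 < (m - 1) choose (s - 2)"
  using ms by (auto simp: zero_less_binomial_iff)

lemma d_pos: "d \<ge> 1"
  using choose_pos(2) d by linarith

lemma critical_exponent_pos: "critical_exponent s m d > 0"
  using choose_pos(1) unfolding critical_exponent_def by (intro divide_pos_pos add_pos_nonneg) auto

lemma critical_exponent_excess: "critical_exponent s m d * real (m choose (s - 1)) - 1 = (real m + 1) / real ((m + 1) * d + 1)"
proof -
  have "real ((m + 1) * d + 1) = (real m + 1) * real d + 1" by (simp add: distrib_right)
  then show ?thesis using choose_pos(1) by (simp only: critical_exponent_def) simp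
qed

text \<open>With \<open>N = (m + 1) * d + 1\<close> attached vertices and
  \<open>M = m choose (s - 1)\<close>, the product is
  \<open>\<alpha> * M * N = (1 + \<epsilon>) * N = N + (m + 1)\<close>.\<close>

lemma critical_exponent_critical: "critical_exponent s m d * card (pattern_edges s m d) = card (pattern_vertices m d)"
proof -
  have "critical_exponent s m d * card (pattern_edges s m d) = (critical_exponent s m d * real (m choose (s - 1))) * real ((m + 1) * d + 1)"
    unfolding card_pattern_edges of_nat_mult by (simp only: mult_ac)
  also have "critical_exponent s m d * real (m choose (s - 1)) = 1 + (real m + 1) / real ((m + 1) * d + 1)" using critical_exponent_excess by linarith
  also have "\<dots> * real ((m + 1) * d + 1) = real ((m + 1) * d + 1) + (real m + 1)"
  proof -
    have "(1 + q / x) * x = x + q" if "x > 0" for x q :: real using that by (simp add: field_simps)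
    then show ?thesis by (rule meta_mp) (simp only: of_nat_0_less_iff, simp)
  qed
  finally show ?thesis by (simp add: card_pattern_vertices)
qed

text \<open>Since \<open>\<alpha> * (\<beta> + \<gamma>) = 1 + \<epsilon>\<close>, the claim amounts
  to \<open>\<epsilon> * \<beta> < \<gamma>\<close>. The assumption \<open>d \<ge> \<beta>\<close>
  gives \<open>\<epsilon> * \<beta> < 1 \<le> \<gamma>\<close>.\<close>

lemma critical_exponent_lower_degree: "critical_exponent s m d * real ((m - 1) choose (s - 1)) < 1"
proof -
  define \<beta> \<gamma> where "\<beta> = (m - 1) choose (s - 1)" and "\<gamma> = (m - 1) choose (s - 2)"
  have "\<beta> * (m + 1) \<le> d * (m + 1)" using d unfolding \<beta>_def by (rule mult_le_mono1)
  also have "\<dots> < ((m + 1) * d + 1) * 1" by simp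
  also have "\<dots> \<le> ((m + 1) * d + 1) * \<gamma>" using choose_pos(3) unfolding \<gamma>_def by (intro mult_le_mono2) linarith
  finally have "real (\<beta> * (m + 1)) < real (((m + 1) * d + 1) * \<gamma>)" by (simp only: of_nat_less_iff)
  then have "real \<beta> * real (m + 1) < real ((m + 1) * d + 1) * real \<gamma>"
    by (simp only: of_nat_mult)
  moreover have "k / x * b < c" if "x > 0" "b * k < x * c" for k x b c :: real
    using that by (simp add: field_simps)
  moreover have "real ((m + 1) * d + 1) > 0" by (simp only: of_nat_0_less_iff)
  ultimately have "real (m + 1) / real ((m + 1) * d + 1) * \<beta> < \<gamma>" by blast
  then have lt: "(real m + 1) / real ((m + 1) * d + 1) * \<beta> < \<gamma>"
    by (simp only: of_nat_add of_nat_1)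
  have "real (m choose (s - 1)) = \<beta> + \<gamma>" using choose_split[of s m] s2 ms by (simp add: \<beta>_def \<gamma>_def)
  then have M: "(\<beta> + \<gamma>) * critical_exponent s m d = 1 + (real m + 1) / real ((m + 1) * d + 1)" using critical_exponent_excess by (simp add: mult.commute)
  have "0 < \<beta>" using choose_pos(2) by (simp only: \<beta>_def)
  then have pos: "real (\<beta> + \<gamma>) > 0" by simp
  have "(\<beta> + \<gamma>) * (critical_exponent s m d * \<beta>) = \<beta> + (real m + 1) / real ((m + 1) * d + 1) * \<beta>"
    using M by (metis (no_types, opaque_lifting) distrib_right mult.assoc mult_1)
  also have "\<dots> < real (\<beta> + \<gamma>) * 1" using lt by simp
  finally show ?thesis using pos unfolding \<beta>_def[symmetric] by (simp only: mult_less_cancel_left_pos)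
qed

text \<open>Let \<open>A\<close> be the free and \<open>X\<close> the attached vertices of
  \<open>J\<close>. The edges at an attached vertex weigh at most 1, plus \<open>\<epsilon>\<close>
  if all its \<open>m\<close> free vertices lie in \<open>A\<close>, so \<open>\<epsilon>\<close>
  times the number of such full vertices must not exceed \<open>card A\<close>. If
  \<open>A = {..m}\<close>, this holds because
  \<open>\<epsilon> * ((m + 1) * d + 1) = m + 1\<close>. Otherwise full vertices exist only if
  \<open>card A = m\<close>; they then lie in the cluster of the missing index, and
  \<open>(d + 1) * \<epsilon> \<le> 2 \<le> m\<close>.\<close>

lemma balanced_pattern: "balanced (critical_exponent s m d) (pattern_vertices m d) (pattern_edges s m d)"
  unfolding balanced_def
proof (intro allI impI)
  fix J assume J: "J \<subseteq> pattern_vertices m d"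
  define A where "A = {k. Inl k \<in> J}"
  define X where "X = {x \<in> cluster_index m d. Inr x \<in> J}"
  define \<epsilon> where "\<epsilon> = (real m + 1) / real ((m + 1) * d + 1)"
  have \<epsilon>0: "\<epsilon> \<ge> 0" by (simp add: \<epsilon>_def)
  have A: "A \<subseteq> {..m}" using J by (auto simp: pattern_vertices_def A_def)
  have finA: "finite A" using A finite_subset by blast
  have finX: "finite X" by (simp add: X_def)
  have JAX: "J = Inl ` A \<union> Inr ` X" using J by (auto simp: pattern_vertices_def A_def X_def)
  have "card J = card (Inl ` A :: (nat + nat \<times> nat) set) + card (Inr ` X :: (nat + nat \<times> nat) set)"
    unfolding JAX using finA finX by (intro card_Un_disjoint) auto
  then have cardJ: "card J = card A + card X" by (simp add: card_image)
  have one: "critical_exponent s m d * real (card (A - {i}) choose (s - 1)) \<le> 1 + (if card (A - {i}) = m then \<epsilon> else 0)"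
    if "i \<le> m" for i
  proof (cases "card (A - {i}) = m")
    case True
    then show ?thesis using critical_exponent_excess by (simp add: \<epsilon>_def)
  next
    case False
    have "card (A - {i}) \<le> card ({..m} - {i})" using A by (intro card_mono) auto
    then have "card (A - {i}) \<le> m - 1" using False that by simp
    then have "card (A - {i}) choose (s - 1) \<le> (m - 1) choose (s - 1)" by (rule binomial_right_mono)
    then have "critical_exponent s m d * real (card (A - {i}) choose (s - 1)) \<le> critical_exponent s m d * real ((m - 1) choose (s - 1))"
      using critical_exponent_pos by simp
    then show ?thesis using critical_exponent_lower_degree False by simp
  qed
  have Xi: "i \<le> m" if "(i, j) \<in> X" for i j using that by (auto simp: X_def cluster_index_def)
  have "critical_exponent s m d * card {e \<in> pattern_edges s m d. e \<subseteq> J} =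
      (\<Sum>(i, j)\<in>X. critical_exponent s m d * real (card (A - {i}) choose (s - 1)))"
    unfolding pattern_edges_within[OF J] A_def[symmetric] X_def[symmetric] of_nat_sum sum_distrib_left
    by (intro sum.cong) auto
  also have "\<dots> \<le> (\<Sum>(i, j)\<in>X. 1 + (if card (A - {i}) = m then \<epsilon> else 0))"
    using one Xi by (intro sum_mono) auto
  also have "\<dots> = card X + (\<Sum>x\<in>X. if card (A - {fst x}) = m then \<epsilon> else 0)"
    by (simp add: sum.distrib case_prod_beta)
  also have "(\<Sum>x\<in>X. if card (A - {fst x}) = m then \<epsilon> else 0) = card {x \<in> X. card (A - {fst x}) = m} * \<epsilon>"
    using finX by (simp add: sum.If_cases Int_def)
  also have "\<dots> \<le> card A"
  proof (cases "A = {..m}")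
    case True
    have "card {x \<in> X. card (A - {fst x}) = m} \<le> card (cluster_index m d)"
      by (intro card_mono) (auto simp: X_def)
    then have "real (card {x \<in> X. card (A - {fst x}) = m}) * \<epsilon> \<le> real ((m + 1) * d + 1) * \<epsilon>"
      using \<epsilon>0 unfolding card_cluster_index by (intro mult_right_mono of_nat_mono) auto
    also have "\<dots> = real m + 1" by (simp add: \<epsilon>_def del: of_nat_add of_nat_mult of_nat_Suc)
    finally show ?thesis using True by simp
  next
    case False
    show ?thesis
    proof (cases "{x \<in> X. card (A - {fst x}) = m} = {}")
      case True
      show ?thesis unfolding True by simp
    next
      case ne: False
      then obtain x0 where x0: "x0 \<in> X" "card (A - {fst x0}) = m" by auto
      have "card A < card {..m}" using A False by (intro psubset_card_mono) auto
      moreover have "m \<le> card A" using x0(2) finA card_Diff1_le[of A "fst x0"] by simp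
      ultimately have cA: "card A = m" by simp
      have notin: "fst x \<notin> A" if "card (A - {fst x}) = m" for x :: "nat \<times> nat"
        using that cA finA ms by (cases "fst x \<in> A") auto
      have "card ({..m} - A) = 1" using A cA finA by (simp add: card_Diff_subset)
      then obtain i0 where i0: "{..m} - A = {i0}" by (rule card_1_singletonE)
      have "{x \<in> X. card (A - {fst x}) = m} \<subseteq> Pair i0 ` {..<d + 1}"
      proof
        fix x assume x: "x \<in> {x \<in> X. card (A - {fst x}) = m}"
        then have x1: "x \<in> X" and x2: "card (A - {fst x}) = m" by blast+
        have x3: "(fst x, snd x) \<in> X" using x1 by simp
        have "fst x \<in> {..m} - A" using notin[OF x2] Xi[OF x3] by simp
        then have "fst x = i0" unfolding i0 by simp
        moreover have "snd x < cluster_size d (fst x)" using x1 by (auto simp: X_def cluster_index_def)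
        then have "snd x < d + 1" by (simp add: cluster_size_def split: if_splits)
        ultimately show "x \<in> Pair i0 ` {..<d + 1}" by (cases x) auto
      qed
      then have "card {x \<in> X. card (A - {fst x}) = m} \<le> card (Pair i0 ` {..<d + 1})"
        by (intro card_mono) auto
      then have "card {x \<in> X. card (A - {fst x}) = m} \<le> d + 1"
        using card_image_le[of "{..<d + 1}" "Pair i0"] by simp
      then have "real (card {x \<in> X. card (A - {fst x}) = m}) * \<epsilon> \<le> real (d + 1) * \<epsilon>"
        using \<epsilon>0 by (intro mult_right_mono of_nat_mono) auto
      also have "\<dots> \<le> 2"
      proof -
        have "(d + 1) * (m + 1) \<le> 2 * ((m + 1) * d + 1)"
          using d_pos by (cases d) (auto simp: algebra_simps)
        then have "real ((d + 1) * (m + 1)) \<le> real (2 * ((m + 1) * d + 1))" by (simp only: of_nat_le_iff)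
        moreover have "real ((d + 1) * (m + 1)) = real (d + 1) * (real m + 1)" by (simp add: algebra_simps)
        moreover have "real (2 * ((m + 1) * d + 1)) = 2 * real ((m + 1) * d + 1)" by simp
        moreover have "real ((m + 1) * d + 1) > 0" by (simp only: of_nat_0_less_iff)
        ultimately show ?thesis unfolding \<epsilon>_def times_divide_eq_right by (simp only: pos_divide_le_eq)
      qed
      also have "\<dots> \<le> card A" using cA ms s2 by simp
      finally show ?thesis .
    qed
  qed
  finally show "critical_exponent s m d * card {e \<in> pattern_edges s m d. e \<subseteq> J} \<le> card J" using cardJ by simp
qed

end

section \<open>Covers and copies of the pattern\<close>

text \<open>Cluster 0 has at least two members, all attached to the same free vertices, so
  exchanging two of them is an automorphism. It supplies the factor 1/2 in the first-moment
  bound.\<close>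

lemma pattern_swap:
  assumes "d \<ge> 1"
  defines "\<sigma> \<equiv> Transposition.transpose (Inr (0, 0)) (Inr (0, 1)) :: nat + nat \<times> nat \<Rightarrow> nat + nat \<times> nat"
  shows "bij_betw \<sigma> (pattern_vertices m d) (pattern_vertices m d)"
    "(`) ((`) \<sigma>) (pattern_edges s m d) \<subseteq> pattern_edges s m d"
    "Inr (0, 0) \<in> pattern_vertices m d" "\<sigma> (Inr (0, 0)) \<noteq> Inr (0, 0)"
proof -
  have idx: "(0, 0) \<in> cluster_index m d" "(0, 1) \<in> cluster_index m d"
    using assms(1) by (auto simp: cluster_index_def cluster_size_def)
  show V: "Inr (0, 0) \<in> pattern_vertices m d"
    using idx by (auto simp: pattern_vertices_def)
  have V': "Inr (0, 1) \<in> pattern_vertices m d"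
    using idx by (auto simp: pattern_vertices_def)
  show "\<sigma> (Inr (0, 0)) \<noteq> Inr (0, 0)" by (simp add: \<sigma>_def)
  show "bij_betw \<sigma> (pattern_vertices m d) (pattern_vertices m d)"
    using V V' unfolding \<sigma>_def bij_betw_def
    by (simp add: transpose_image_eq inj_on_transpose)
  show "(`) ((`) \<sigma>) (pattern_edges s m d) \<subseteq> pattern_edges s m d"
  proof (rule image_subsetI)
    fix e assume "e \<in> pattern_edges s m d"
    then obtain i j S where e: "e = insert (Inr (i, j)) (Inl ` S)" "(i, j) \<in> cluster_index m d"
      "S \<subseteq> {..m} - {i}" "card S = s - 1"
      by (auto simp: pattern_edges_def)
    have "\<sigma> ` Inl ` S = Inl ` S" for S
      by (force simp: \<sigma>_def Transposition.transpose_def)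
    moreover have "\<exists>j'. \<sigma> (Inr (i, j)) = Inr (i, j') \<and> (i, j') \<in> cluster_index m d"
    proof (cases "i = 0 \<and> j \<le> 1")
      case True
      then have "j = 0 \<or> j = 1" by auto
      then show ?thesis using True idx by (auto simp: \<sigma>_def)
    next
      case False
      then have "\<sigma> (Inr (i, j)) = Inr (i, j)"
        unfolding \<sigma>_def by (intro transpose_apply_other) auto
      then show ?thesis using e(2) by blast
    qed
    then obtain j' where "\<sigma> (Inr (i, j)) = Inr (i, j')" "(i, j') \<in> cluster_index m d" by blast
    ultimately have "\<sigma> ` e = insert (Inr (i, j')) (Inl ` S)" "(i, j') \<in> cluster_index m d"
      using e(1) by auto
    then show "\<sigma> ` e \<in> pattern_edges s m d"
      using e(3,4) unfolding pattern_edges_def by blast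
  qed
qed

lemma inj_on_insert_subsets:
  assumes "u \<notin> A"
  shows "inj_on (insert u) {S. S \<subseteq> A \<and> card S = k}"
proof (rule inj_onI)
  fix S S' assume h: "S \<in> {S. S \<subseteq> A \<and> card S = k}" "S' \<in> {S. S \<subseteq> A \<and> card S = k}" "insert u S = insert u S'"
  have "T = insert u T - {u}" if "T \<subseteq> A" for T using that assms by auto
  then show "S = S'" using h by (metis (no_types, lifting) mem_Collect_eq)
qed

lemma present_edges_uniform: "\<forall>e\<in>present_edges s n f. card e = s"
  by (simp add: present_edges_def possible_edges_def)

lemma cluster_disjoint: "i \<le> m \<Longrightarrow> i' \<le> m \<Longrightarrow> i \<noteq> i' \<Longrightarrow> cluster s m E a i \<inter> cluster s m E a i' = {}"
  by (auto simp: cluster_def)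

text \<open>If \<open>b\<close> and a cluster had at most \<open>d\<close> elements together,
  extendability applied to the sets of one such \<open>y\<close> and \<open>a 3\<close>, ...,
  \<open>a m\<close> would produce a cover. So all clusters are large enough to choose the attached
  vertices of a copy from them.\<close>

lemma copies_nonempty_if_uncoverable:
  assumes "s \<ge> 2" "m \<ge> s + 1"
    and unc: "uncoverable s m n (present_edges s n f)"
    and ext: "extendable s (m - 1) d (m + 1 + d) n (present_edges s n f)"
  shows "copies (pattern_vertices m d) (pattern_edges s m d) n f \<noteq> {}"
proof -
  define E where "E = present_edges s n f"
  have unif: "\<forall>e\<in>E. card e = s" unfolding E_def by (rule present_edges_uniform)
  obtain a b where ab: "inj_on a {..m}" "a ` {..m} \<subseteq> {1..n}" "b \<in> {1..n} \<inter> cluster s m E a 0"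
    "\<forall>i\<le>m. \<not> covered s m n E a (insert b (cluster s m E a i))"
    using unc unfolding uncoverable_def E_def by blast
  have sm: "s - 1 \<le> m" using assms(2) by simp
  define Y where "Y i = {1..n} \<inter> cluster s m E a i" for i
  have finY: "finite (Y i)" for i by (simp add: Y_def)
  have Ya: "Y i \<inter> a ` {..m} = {}" if "i \<le> m" for i
    using cluster_notin[OF _ ab(1) that sm assms(1) unif] by (auto simp: Y_def)
  have ba: "b \<notin> a ` {..m}" using Ya[of 0] ab(3) by (auto simp: Y_def)
  have large: "d + 1 \<le> card (insert b (Y i))" if i: "i \<le> m" for i
  proof (rule ccontr)
    assume "\<not> d + 1 \<le> card (insert b (Y i))"
    then have small: "card (insert b (Y i)) \<le> d" by simp
    define Z where "Z = a ` {..m} \<union> insert b (Y i)"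
    define \<A> where "\<A> = (\<lambda>y. insert y (a ` {3..m})) ` insert b (Y i)"
    have Zn: "Z \<subseteq> {1..n}" using ab(2,3) by (auto simp: Z_def Y_def)
    have "card Z \<le> card (a ` {..m}) + card (insert b (Y i))" unfolding Z_def by (rule card_Un_le)
    also have "\<dots> \<le> m + 1 + d" using small card_image_le[of "{..m}" a] by (intro add_mono) auto
    finally have Zc: "card Z \<le> m + 1 + d" .
    have a3: "card (a ` {3..m}) = m - 2"
      using inj_on_subset[OF ab(1), of "{3..m}"] by (subst card_image) auto
    have a3sub: "a ` {3..m} \<subseteq> a ` {..m}" by auto
    have As: "\<A> \<subseteq> {A. A \<subseteq> Z \<and> card A = m - 1}"
    proof
      fix A assume "A \<in> \<A>"
      then obtain y where y: "y \<in> insert b (Y i)" "A = insert y (a ` {3..m})" by (auto simp: \<A>_def)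
      then have "y \<notin> a ` {3..m}" using Ya[OF i] ba a3sub by auto
      then have "card A = Suc (m - 2)" unfolding y(2) using a3 by simp
      moreover have "A \<subseteq> Z" unfolding y(2) Z_def using y(1) a3sub by auto
      ultimately show "A \<in> {A. A \<subseteq> Z \<and> card A = m - 1}" using assms by simp
    qed
    have Ac: "card \<A> \<le> d"
      unfolding \<A>_def by (rule order_trans[OF card_image_le small]) (simp add: finY)
    obtain p where p: "p \<in> {1..n} - Z" "\<forall>A\<in>\<A>. \<exists>u\<in>{1..n}. joined s E u (insert p A)"
      using ext Zn Zc As Ac unfolding extendable_def E_def by blast
    have "covered s m n E a (insert b (cluster s m E a i))"
      unfolding covered_def
    proof (rule bexI[of _ p], intro ballI conjI)
      show "p \<in> {1..n} - a ` {..m}" using p(1) by (auto simp: Z_def)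
    next
      fix y assume "y \<in> {1..n} \<inter> insert b (cluster s m E a i)"
      then have y: "y \<in> insert b (Y i)" by (auto simp: Y_def)
      show "y \<noteq> p" using y p(1) by (auto simp: Z_def)
      show "\<exists>u\<in>{1..n}. joined s E u (insert y (insert p (a ` {3..m})))"
        using bspec[OF p(2), of "insert y (a ` {3..m})"] y unfolding \<A>_def insert_commute[of y p] by blast
    qed
    then show False using ab(4) i by blast
  qed
  \<comment> \<open>Cluster 0 contains \<open>b\<close> already; any other cluster may owe one of
    the \<open>d + 1\<close> elements to \<open>b\<close>.\<close>
  have size: "cluster_size d i \<le> card (Y i)" if i: "i \<le> m" for i
  proof (cases "i = 0")
    case True
    then have "insert b (Y i) = Y i" using ab(3) by (auto simp: Y_def)
    then show ?thesis using large[OF i] True by (simp add: cluster_size_def)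
  next
    case False
    have "card (insert b (Y i)) \<le> Suc (card (Y i))" by (rule card_insert_le_m1) auto
    then show ?thesis using large[OF i] False by (simp add: cluster_size_def)
  qed
  have "\<exists>g. g ` {..<cluster_size d i} \<subseteq> Y i \<and> inj_on g {..<cluster_size d i}" if "i \<le> m" for i
    using card_le_inj[of "{..<cluster_size d i}" "Y i"] finY size[OF that] by auto
  then obtain g where g: "\<And>i. i \<le> m \<Longrightarrow> g i ` {..<cluster_size d i} \<subseteq> Y i"
    "\<And>i. i \<le> m \<Longrightarrow> inj_on (g i) {..<cluster_size d i}"
    by metis
  define \<phi> where "\<phi> = restrict (case_sum a (\<lambda>(i, j). g i j)) (pattern_vertices m d)"
  have \<phi>l: "\<phi> (Inl i) = a i" if "i \<le> m" for i using that by (simp add: \<phi>_def pattern_vertices_def)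
  have \<phi>r: "\<phi> (Inr (i, j)) = g i j" if "(i, j) \<in> cluster_index m d" for i j
    using that by (simp add: \<phi>_def pattern_vertices_def)
  have gY: "i \<le> m" "g i j \<in> Y i" if "(i, j) \<in> cluster_index m d" for i j
    using that g(1)[of i] by (auto simp: cluster_index_def)
  have "inj_on \<phi> (Inl ` {..m})"
    using ab(1) by (auto simp: inj_on_def \<phi>l)
  moreover have "inj_on \<phi> (Inr ` cluster_index m d)"
  proof (rule inj_onI, clarify)
    fix i j i' j' assume ij: "(i, j) \<in> cluster_index m d" "(i', j') \<in> cluster_index m d"
      and eq: "\<phi> (Inr (i, j)) = \<phi> (Inr (i', j'))"
    then have geq: "g i j = g i' j'" by (simp add: \<phi>r)
    have "i = i'"
    proof (rule ccontr)
      assume "i \<noteq> i'"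
      then have "cluster s m E a i \<inter> cluster s m E a i' = {}"
        using gY[OF ij(1)] gY[OF ij(2)] by (intro cluster_disjoint) auto
      then show False using gY[OF ij(1)] gY[OF ij(2)] geq by (auto simp: Y_def)
    qed
    moreover from this have "j = j'"
      using inj_onD[OF g(2)[OF gY(1)[OF ij(1)]], of j j'] geq ij by (auto simp: cluster_index_def)
    ultimately show "i = i' \<and> j = j'" by simp
  qed
  moreover have "\<phi> ` Inl ` {..m} \<inter> \<phi> ` Inr ` cluster_index m d = {}"
  proof -
    have img: "\<phi> ` Inl ` {..m} = a ` {..m}" unfolding image_image by (rule image_cong) (auto simp: \<phi>l)
    have nr: "\<phi> (Inr x) \<notin> a ` {..m}" if "x \<in> cluster_index m d" for x
      using that gY[of "fst x" "snd x"] Ya[of "fst x"] \<phi>r[of "fst x" "snd x"] by auto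
    show ?thesis
    proof (rule equals0I)
      fix v assume "v \<in> \<phi> ` Inl ` {..m} \<inter> \<phi> ` Inr ` cluster_index m d"
      then obtain x where "x \<in> cluster_index m d" "v = \<phi> (Inr x)" "v \<in> a ` {..m}" unfolding img by blast
      then show False using nr[of x] by simp
    qed
  qed
  ultimately have inj: "inj_on \<phi> (pattern_vertices m d)"
    unfolding pattern_vertices_def inj_on_Un by blast
  have rng: "\<phi> \<in> pattern_vertices m d \<rightarrow>\<^sub>E {1..n}"
  proof (rule PiE_I)
    fix v assume "v \<in> pattern_vertices m d"
    then consider i where "v = Inl i" "i \<le> m" | i j where "v = Inr (i, j)" "(i, j) \<in> cluster_index m d"
      by (auto simp: pattern_vertices_def)
    then show "\<phi> v \<in> {1..n}"
    proof cases
      case 1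
      then show ?thesis using ab(2) by (auto simp: \<phi>l)
    next
      case 2
      then show ?thesis using gY(2)[of i j] by (simp add: \<phi>r Y_def)
    qed
  qed (simp add: \<phi>_def)
  have "f (\<phi> ` e)" if e: "e \<in> pattern_edges s m d" for e
  proof -
    from e obtain i j S where e: "e = insert (Inr (i, j)) (Inl ` S)" "(i, j) \<in> cluster_index m d"
      "S \<subseteq> {..m} - {i}" "card S = s - 1"
      by (auto simp: pattern_edges_def)
    have "\<phi> ` Inl ` S = a ` S" unfolding image_image using e(3) by (intro image_cong) (auto simp: \<phi>l)
    then have "\<phi> ` e = insert (g i j) (a ` S)" unfolding e(1) using e(2) by (simp add: \<phi>r)
    moreover have "card (a ` S) = s - 1"
      using e(3,4) inj_on_subset[OF ab(1), of S] by (subst card_image) auto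
    moreover have "joined s E (g i j) (a ` ({..m} - {i}))"
      using gY(2)[OF e(2)] by (simp add: Y_def cluster_def)
    ultimately have "\<phi> ` e \<in> E" using e(3) unfolding joined_def by (simp add: image_mono)
    then show ?thesis by (simp add: E_def present_edges_def)
  qed
  then have "\<phi> \<in> copies (pattern_vertices m d) (pattern_edges s m d) n f"
    using inj rng by (simp add: copies_def placements_def)
  then show ?thesis by blast
qed

text \<open>The edges of a copy exhaust what sparseness allows on its vertices, so new edges have to
  be paid for by new vertices. A cover of \<open>d + 1\<close> vertices brings at most
  \<open>d + 2\<close> new vertices, namely \<open>p\<close> and the \<open>u y\<close>, but too
  many edges.\<close>

lemma uncoverable_if_copies_nonempty:
  assumes s2: "s \<ge> 2" and ms: "m \<ge> s + 1" and d: "d \<ge> (m - 1) choose (s - 1)"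
    and cop: "copies (pattern_vertices m d) (pattern_edges s m d) n f \<noteq> {}"
    and sp: "sparse (critical_exponent s m d) (card (pattern_vertices m d) + d + 2) n (present_edges s n f)"
  shows "uncoverable s m n (present_edges s n f)"
proof -
  define E where "E = present_edges s n f"
  define \<alpha> where "\<alpha> = critical_exponent s m d"
  have unif: "\<forall>e\<in>E. card e = s" unfolding E_def by (rule present_edges_uniform)
  have finE: "finite E" unfolding E_def present_edges_def by simp
  note \<alpha>0 = critical_exponent_pos[OF s2 ms d, folded \<alpha>_def]
  note pat = uniform_pattern_edges[OF s2, of m d]
  obtain \<phi> where \<phi>: "\<phi> \<in> copies (pattern_vertices m d) (pattern_edges s m d) n f" using cop by blast
  have inj: "inj_on \<phi> (pattern_vertices m d)" and rng: "\<phi> ` pattern_vertices m d \<subseteq> {1..n}"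
    and \<phi>pl: "\<phi> \<in> placements (pattern_vertices m d) n"
    using \<phi> by (auto simp: copies_def placements_def)
  have \<phi>E: "\<phi> ` e \<in> E" if "e \<in> pattern_edges s m d" for e
    using \<phi> that placement_edges(1)[OF pat \<phi>pl] by (auto simp: copies_def E_def present_edges_def)
  define V where "V = \<phi> ` pattern_vertices m d"
  define F where "F = (`) \<phi> ` pattern_edges s m d"
  have finV: "finite V" by (simp add: V_def)
  have cV: "card V = card (pattern_vertices m d)" unfolding V_def by (rule card_image[OF inj])
  have cF: "card F = card (pattern_edges s m d)" unfolding F_def by (rule placement_edges(2)[OF pat \<phi>pl])
  have crit: "\<alpha> * card F = card V"
    using critical_exponent_critical[OF s2 ms d] by (simp add: cV cF \<alpha>_def)
  have FE: "F \<subseteq> {e \<in> E. e \<subseteq> V}"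
    using \<phi>E pattern_edges_subset[of _ s m d] unfolding F_def V_def by blast
  have sparse: "\<alpha> * card {e \<in> E. e \<subseteq> W} \<le> card W" if "W \<subseteq> {1..n}" "card W \<le> card V + d + 2" for W
    using sp that unfolding sparse_def E_def \<alpha>_def cV by blast
  \<comment> \<open>In view of \<open>crit\<close> this bounds \<open>\<alpha> * card F'\<close> by
    \<open>card W - card V\<close>, the number of new vertices.\<close>
  have extra: "\<alpha> * (card F + card F') \<le> card W"
    if "W \<subseteq> {1..n}" "card W \<le> card V + d + 2" "V \<subseteq> W" "F' \<subseteq> E" "\<forall>e\<in>F'. e \<subseteq> W" "F \<inter> F' = {}" for W F'
  proof -
    have "F \<union> F' \<subseteq> {e \<in> E. e \<subseteq> W}" using FE that by blast
    then have "card (F \<union> F') \<le> card {e \<in> E. e \<subseteq> W}" using finE by (intro card_mono) auto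
    moreover have "card (F \<union> F') = card F + card F'"
      using that(4,6) FE finE by (intro card_Un_disjoint) (auto intro: finite_subset)
    ultimately have "\<alpha> * (card F + card F') \<le> \<alpha> * card {e \<in> E. e \<subseteq> W}"
      using \<alpha>0 by (intro mult_left_mono) auto
    also have "\<dots> \<le> card W" by (rule sparse[OF that(1,2)])
    finally show ?thesis .
  qed
  have rngV: "V \<subseteq> {1..n}" using rng by (simp add: V_def)
  \<comment> \<open>With no new vertices there can be no new edge, so \<open>V\<close> spans exactly
    the edges of the copy.\<close>
  have exact: "e \<in> F" if "e \<in> E" "e \<subseteq> V" for e
  proof (rule ccontr)
    assume "e \<notin> F"
    then have "\<alpha> * (card F + card {e}) \<le> card V"
      using that rngV by (intro extra) auto
    then show False using crit \<alpha>0 by (simp add: algebra_simps)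
  qed
  define a where "a i = \<phi> (Inl i)" for i
  define X where "X i = (\<lambda>j. \<phi> (Inr (i, j))) ` {..<cluster_size d i}" for i
  have Vl: "Inl i \<in> pattern_vertices m d" if "i \<le> m" for i using that by (simp add: pattern_vertices_def)
  have Vr: "Inr (i, j) \<in> pattern_vertices m d" if "i \<le> m" "j < cluster_size d i" for i j
    using that by (simp add: pattern_vertices_def cluster_index_def)
  have inja: "inj_on a {..m}"
    using inj_onD[OF inj] Vl by (fastforce simp: a_def inj_on_def)
  have aV: "a ` {..m} \<subseteq> V" using Vl by (auto simp: a_def V_def)
  have XV: "X i \<subseteq> V" if "i \<le> m" for i using Vr[OF that] by (auto simp: X_def V_def)
  have Xa: "X i \<inter> a ` {..m} = {}" if "i \<le> m" for i
    using inj_onD[OF inj] Vl Vr[OF that] by (fastforce simp: X_def a_def)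
  have XX: "i = i'" if h: "y \<in> X i" "y \<in> X i'" "i \<le> m" "i' \<le> m" for y i i'
  proof -
    obtain j where j: "y = \<phi> (Inr (i, j))" "j < cluster_size d i" using h(1) by (auto simp: X_def)
    obtain j' where j': "y = \<phi> (Inr (i', j'))" "j' < cluster_size d i'" using h(2) by (auto simp: X_def)
    have "Inr (i, j) = (Inr (i', j') :: nat + nat \<times> nat)"
      using j j' Vr[OF h(3) j(2)] Vr[OF h(4) j'(2)] by (intro inj_onD[OF inj]) auto
    then show ?thesis by simp
  qed
  have cX: "card (X i) = cluster_size d i" if "i \<le> m" for i
  proof -
    have "inj_on (\<lambda>j. \<phi> (Inr (i, j))) {..<cluster_size d i}"
    proof (rule inj_onI)
      fix j j' assume "j \<in> {..<cluster_size d i}" "j' \<in> {..<cluster_size d i}" "\<phi> (Inr (i, j)) = \<phi> (Inr (i, j'))"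
      then have "Inr (i, j) = (Inr (i, j') :: nat + nat \<times> nat)"
        using Vr[OF that] by (intro inj_onD[OF inj]) auto
      then show "j = j'" by simp
    qed
    then show ?thesis unfolding X_def by (simp add: card_image)
  qed
  have Fdest: "\<exists>i y S. i \<le> m \<and> y \<in> X i \<and> S \<subseteq> {..m} - {i} \<and> e = insert y (a ` S)" if "e \<in> F" for e
  proof -
    from that obtain i j S where e: "e = \<phi> ` insert (Inr (i, j)) (Inl ` S)" "(i, j) \<in> cluster_index m d" "S \<subseteq> {..m} - {i}"
      by (auto simp: F_def pattern_edges_def)
    then have "e = insert (\<phi> (Inr (i, j))) (a ` S)" by (simp add: a_def image_image)
    then show ?thesis using e(2,3) by (auto simp: cluster_index_def X_def)
  qed
  have clu: "y \<in> cluster s m E a i" if y: "y \<in> X i" and i: "i \<le> m" for y i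
    unfolding cluster_def
  proof (intro CollectI conjI ballI)
    show "y \<noteq> a i" using Xa[OF i] y i by auto
    show "joined s E y (a ` ({..m} - {i}))"
      unfolding joined_def
    proof (intro allI impI)
      fix S' assume S': "S' \<subseteq> a ` ({..m} - {i}) \<and> card S' = s - 1"
      then obtain S where S: "S \<subseteq> {..m} - {i}" "S' = a ` S" by (auto simp: subset_image_iff)
      have injS: "inj_on a S" using inj_on_subset[OF inja] S(1) by blast
      have "card S = s - 1"
        using S' S(2) card_image[OF injS] by simp
      moreover obtain j where "y = \<phi> (Inr (i, j))" "j < cluster_size d i" using y by (auto simp: X_def)
      ultimately have "insert y S' = \<phi> ` insert (Inr (i, j)) (Inl ` S)"
        "insert (Inr (i, j)) (Inl ` S) \<in> pattern_edges s m d"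
        using S i by (auto simp: a_def image_image pattern_edges_def cluster_index_def)
      then show "insert y S' \<in> E" using \<phi>E by metis
    qed
    \<comment> \<open>Being joined to all \<open>a k\<close> with \<open>k \<noteq> j\<close> would
      produce an edge through \<open>y\<close> and \<open>a i\<close>. By \<open>exact\<close> it
      would belong to the copy, whose edges through \<open>y\<close> avoid
      \<open>a i\<close>.\<close>
    fix j assume j: "j \<in> {..m} - {i}"
    show "\<not> joined s E y (a ` ({..m} - {j}))"
    proof
      assume jo: "joined s E y (a ` ({..m} - {j}))"
      have "card ({..m} - {i, j}) = m - 1" using i j by (subst card_Diff_subset) auto
      then have "s - 2 \<le> card ({..m} - {i, j})" using ms by simp
      then obtain S0 where S0: "S0 \<subseteq> {..m} - {i, j}" "card S0 = s - 2" by (meson obtain_subset_with_card_n)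
      define S where "S = insert i S0"
      have finS0: "finite S0" using S0(1) finite_subset by blast
      have "i \<notin> S0" using S0(1) by auto
      then have "card S = s - 1" unfolding S_def using S0(2) finS0 s2 by simp
      moreover have Sm: "S \<subseteq> {..m} - {j}" using S0(1) i j by (auto simp: S_def)
      moreover have "inj_on a S" using inj_on_subset[OF inja] Sm by blast
      ultimately have "card (a ` S) = s - 1" "a ` S \<subseteq> a ` ({..m} - {j})"
        by (auto simp: card_image)
      then have "insert y (a ` S) \<in> E" using joinedD[OF jo] by blast
      moreover have "a ` S \<subseteq> a ` {..m}" using Sm by auto
      moreover from this have "insert y (a ` S) \<subseteq> V" using aV XV[OF i] y by auto
      ultimately have "insert y (a ` S) \<in> F" by (intro exact)
      from Fdest[OF this] obtain i' y' S' where
        F': "i' \<le> m" "y' \<in> X i'" "S' \<subseteq> {..m} - {i'}" "insert y (a ` S) = insert y' (a ` S')"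
        by (elim exE conjE)
      have "y' \<notin> a ` {..m}" "y \<notin> a ` {..m}" using Xa[OF F'(1)] F'(2) Xa[OF i] y by auto
      moreover have "y' \<in> insert y (a ` S)" unfolding F'(4) by simp
      ultimately have "y = y'" using subsetD[OF \<open>a ` S \<subseteq> a ` {..m}\<close>, of y'] by auto
      then have "i' = i" using XX[of y i' i] F'(1,2) y i by auto
      have "a i \<in> insert y' (a ` S')" using F'(4) unfolding S_def by auto
      moreover have "a i \<noteq> y'" using \<open>y' \<notin> a ` {..m}\<close> i by auto
      ultimately have "a i \<in> a ` S'" by simp
      then have "i \<in> S'" using inja F'(3) i by (auto simp: inj_on_def)
      then show False using F'(3) \<open>i' = i\<close> by auto
    qed
  qed
  define b where "b = \<phi> (Inr (0, 0))"
  have b: "b \<in> X 0" by (auto simp: b_def X_def cluster_size_def)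
  have "\<not> covered s m n E a (insert b (cluster s m E a i))" if i: "i \<le> m" for i
  proof
    assume "covered s m n E a (insert b (cluster s m E a i))"
    then obtain p where p: "p \<in> {1..n}" "p \<notin> a ` {..m}"
      "\<forall>y\<in>{1..n} \<inter> insert b (cluster s m E a i). y \<noteq> p \<and> (\<exists>u\<in>{1..n}. joined s E u (insert y (insert p (a ` {3..m}))))"
      unfolding covered_def by blast
    \<comment> \<open>For \<open>i = 0\<close> the vertex \<open>b\<close> is one of the
      \<open>d + 1\<close> members; otherwise it is added to \<open>d\<close> members. Either way
      \<open>Y\<close> has \<open>d + 1\<close> elements.\<close>
    define Y where "Y = insert b (X i)"
    have YV: "Y \<subseteq> V" using XV[OF i] XV[of 0] b by (auto simp: Y_def)
    have finY: "finite Y" using YV finV finite_subset by blast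
    have Ya: "Y \<inter> a ` {..m} = {}" using Xa[OF i] Xa[of 0] b by (auto simp: Y_def)
    have cY: "card Y = d + 1"
    proof (cases "i = 0")
      case True
      then have "Y = X i" using b by (auto simp: Y_def)
      then show ?thesis using cX[OF i] True by (simp add: cluster_size_def)
    next
      case False
      then have "b \<notin> X i" using XX[OF b] i by blast
      moreover have "finite (X i)" by (simp add: X_def)
      ultimately show ?thesis using cX[OF i] False by (simp add: Y_def cluster_size_def)
    qed
    have "y \<noteq> p \<and> (\<exists>u\<in>{1..n}. joined s E u (insert y (insert p (a ` {3..m}))))" if "y \<in> Y" for y
      using p(3) that clu[OF _ i] YV rngV unfolding Y_def by blast
    then obtain u where u: "\<And>y. y \<in> Y \<Longrightarrow> y \<noteq> p" "\<And>y. y \<in> Y \<Longrightarrow> u y \<in> {1..n}"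
      "\<And>y. y \<in> Y \<Longrightarrow> joined s E (u y) (insert y (insert p (a ` {3..m})))"
      by metis
    define B where "B = insert p (a ` {3..m})"
    have a3: "a ` {3..m} \<subseteq> a ` {..m}" by auto
    have ca3: "card (a ` {3..m}) = m - 2"
      using inj_on_subset[OF inja, of "{3..m}"] by (subst card_image) auto
    have finB: "finite B" by (simp add: B_def)
    have cB: "card B = m - 1"
      using ca3 p(2) a3 ms s2 unfolding B_def by (subst card_insert_disjoint) auto
    have BY: "y \<notin> B" if "y \<in> Y" for y using that u(1) Ya a3 by (auto simp: B_def)
    have cyB: "card (insert y B) = m" if "y \<in> Y" for y using BY[OF that] finB cB ms by simp
    have uB: "u y \<notin> insert y B" if "y \<in> Y" for y
      using u(3)[OF that] cyB[OF that] finB ms unif s2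
      by (intro joined_notin[of s E]) (auto simp: B_def)
    \<comment> \<open>An edge of the copy contains only one attached vertex.\<close>
    have two: False if e: "e \<in> E" "e \<subseteq> V" and vw: "v \<in> e" "w \<in> e" "v \<noteq> w" "v \<notin> a ` {..m}" "w \<notin> a ` {..m}" for e v w
    proof -
      from Fdest[OF exact[OF e]] obtain i' y' S' where F': "S' \<subseteq> {..m} - {i'}" "e = insert y' (a ` S')"
        by (elim exE conjE)
      then have "v = y'" "w = y'" using vw by auto
      then show False using vw(3) by simp
    qed
    \<comment> \<open>If \<open>u y\<close> lay in \<open>V\<close>, an edge from it to
      \<open>s - 1\<close> of the vertices \<open>a 3\<close>, ..., \<open>a m\<close>, available
      because \<open>m \<ge> s + 1\<close>, would make it an attached vertex. Then an edge through
      \<open>u y\<close> and \<open>y\<close> contradicts \<open>two\<close>.\<close>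
    have uV: "u y \<notin> V" if y: "y \<in> Y" for y
    proof
      assume uyV: "u y \<in> V"
      have "s - 1 \<le> card (a ` {3..m})" using ca3 ms by simp
      then obtain S where S: "S \<subseteq> a ` {3..m}" "card S = s - 1" by (meson obtain_subset_with_card_n)
      have "insert (u y) S \<in> E" using S by (intro joinedD[OF u(3)[OF y]]) auto
      moreover have SV: "insert (u y) S \<subseteq> V" using uyV S(1) a3 aV by auto
      ultimately have "insert (u y) S \<in> F" by (intro exact)
      from Fdest[OF this] obtain i' y' S' where F': "i' \<le> m" "y' \<in> X i'" "insert (u y) S = insert y' (a ` S')"
        by (elim exE conjE)
      have "y' \<notin> a ` {..m}" using Xa[OF F'(1)] F'(2) by auto
      moreover have "y' \<in> insert (u y) S" unfolding F'(3) by simp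
      ultimately have ua: "u y \<notin> a ` {..m}" using S(1) a3 by auto
      have "s - 2 \<le> card (a ` {3..m})" using ca3 ms by simp
      then obtain S0 where S0: "S0 \<subseteq> a ` {3..m}" "card S0 = s - 2" by (meson obtain_subset_with_card_n)
      have "finite S0" using S0(1) finite_subset by blast
      moreover have ya: "y \<notin> a ` {..m}" using y Ya by auto
      ultimately have "card (insert y S0) = s - 1" using S0 a3 s2 by (subst card_insert_disjoint) auto
      then have 1: "insert (u y) (insert y S0) \<in> E"
        using S0(1) by (intro joinedD[OF u(3)[OF y]]) auto
      have "S0 \<subseteq> V" using S0(1) a3 aV by (blast intro: subset_trans)
      then have 2: "insert (u y) (insert y S0) \<subseteq> V" using uyV subsetD[OF YV y] by simp
      have "u y \<noteq> y" using uB[OF y] by auto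
      then show False by (intro two[OF 1 2 _ _ _ ua ya]) auto
    qed
    have insE: "insert (u y) S \<in> E" if "y \<in> Y" "S \<subseteq> insert y B" "card S = s - 1" for y S
      using that(2,3) unfolding B_def by (intro joinedD[OF u(3)[OF that(1)]]) auto
    have FnV: "F \<inter> F' = {}" if "\<forall>e\<in>F'. \<not> e \<subseteq> V" for F' using that FE by blast
    define M where "M = m choose (s - 1)"
    define \<beta> where "\<beta> = (m - 1) choose (s - 1)"
    define \<gamma> where "\<gamma> = (m - 1) choose (s - 2)"
    have M: "M = \<beta> + \<gamma>" unfolding M_def \<beta>_def \<gamma>_def using s2 ms by (intro choose_split) auto
    have exc: "\<alpha> * M - 1 = (real m + 1) / real ((m + 1) * d + 1)"
      unfolding \<alpha>_def M_def by (rule critical_exponent_excess[OF s2 ms d])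
    have exc0: "(real m + 1) / real ((m + 1) * d + 1) > 0"
      by (intro divide_pos_pos) (auto simp only: of_nat_0_less_iff)
    \<comment> \<open>With \<open>p\<close> in \<open>V\<close>, the single new vertex
      \<open>u b\<close> would bring \<open>M\<close> new edges, although
      \<open>\<alpha> * M > 1\<close>.\<close>
    have pV: "p \<notin> V"
    proof
      assume pV: "p \<in> V"
      define F' where "F' = insert (u b) ` {S. S \<subseteq> insert b B \<and> card S = s - 1}"
      have bY: "b \<in> Y" by (simp add: Y_def)
      have "inj_on (insert (u b)) {S. S \<subseteq> insert b B \<and> card S = s - 1}"
        using uB[OF bY] by (rule inj_on_insert_subsets)
      then have "card F' = M" unfolding F'_def using finB cyB[OF bY] by (simp add: card_image n_subsets M_def)
      moreover have "\<alpha> * (card F + card F') \<le> card (insert (u b) V)"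
      proof (rule extra)
        show "insert (u b) V \<subseteq> {1..n}" using u(2)[OF bY] rngV by auto
        show "card (insert (u b) V) \<le> card V + d + 2" using finV by (simp add: card_insert_if)
        show "F' \<subseteq> E" using insE[OF bY] by (auto simp: F'_def)
        have "insert b B \<subseteq> V" using pV a3 aV bY YV by (auto simp: B_def)
        then show "\<forall>e\<in>F'. e \<subseteq> insert (u b) V" by (auto simp: F'_def)
        show "F \<inter> F' = {}" by (rule FnV) (use uV[OF bY] in \<open>auto simp: F'_def\<close>)
      qed auto
      ultimately have "\<alpha> * card F + \<alpha> * M \<le> card V + 1"
        using uV[OF bY] finV by (simp add: algebra_simps)
      then show False using crit exc exc0 by linarith
    qed
    define U where "U = u ` Y"
    have finU: "finite U" using finY by (simp add: U_def)
    have cU: "card U \<le> d + 1" unfolding U_def using card_image_le[OF finY, of u] cY by simp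
    have UV: "U \<inter> V = {}" using uV by (auto simp: U_def)
    have Up: "p \<notin> U" "U \<inter> B = {}" using uB by (auto simp: U_def B_def)
    define W where "W = V \<union> insert p U"
    have cW: "card W = card V + (1 + card U)"
      unfolding W_def using finV finU Up(1) pV UV by (subst card_Un_disjoint) auto
    \<comment> \<open>The new edges are split by whether they meet \<open>Y\<close>. The
      \<open>u y\<close> may coincide, so \<open>F1\<close> is counted over \<open>U\<close>. An
      edge of \<open>F2\<close> determines its \<open>y\<close>, so \<open>F2\<close> is counted
      over all \<open>d + 1\<close> elements of \<open>Y\<close>.\<close>
    define F1 where "F1 = (\<lambda>(v, S). insert v S) ` (U \<times> {S. S \<subseteq> B \<and> card S = s - 1})"
    define F2 where "F2 = (\<lambda>(y, S). insert (u y) (insert y S)) ` (Y \<times> {S. S \<subseteq> B \<and> card S = s - 2})"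
    have "inj_on (\<lambda>(v, S). insert v S) (U \<times> {S. S \<subseteq> B \<and> card S = s - 1})"
    proof (rule inj_onI, clarify)
      fix v S v' S' assume h: "v \<in> U" "v' \<in> U" "S \<subseteq> B" "S' \<subseteq> B" "insert v S = insert v' S'"
      have vB: "v \<notin> B" "v' \<notin> B" using Up(2) h(1,2) by auto
      have "v \<in> insert v' S'" using h(5) by blast
      then have "v = v'" using vB(1) h(4) by auto
      moreover have "S = insert v S - {v}" "S' = insert v' S' - {v'}" using vB h(3,4) by auto
      ultimately show "v = v' \<and> S = S'" using h(5) by metis
    qed
    then have c1: "card F1 = card U * \<beta>"
      unfolding F1_def using finB cB by (simp add: card_image card_cartesian_product n_subsets \<beta>_def)
    have F2Y: "e \<inter> Y = {y}" "e - {u y, y} = S" if "y \<in> Y" "S \<subseteq> B" "e = insert (u y) (insert y S)" for y S e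
    proof -
      show "e \<inter> Y = {y}" using that BY uV[OF that(1)] YV by auto
      show "e - {u y, y} = S" using that BY[OF that(1)] uB[OF that(1)] by auto
    qed
    have "inj_on (\<lambda>(y, S). insert (u y) (insert y S)) (Y \<times> {S. S \<subseteq> B \<and> card S = s - 2})"
    proof (rule inj_onI, clarify)
      fix y S y' S' assume h: "y \<in> Y" "y' \<in> Y" "S \<subseteq> B" "S' \<subseteq> B"
        "insert (u y) (insert y S) = insert (u y') (insert y' S')"
      have "{y} = {y'}" using F2Y(1)[OF h(1,3) refl] F2Y(1)[OF h(2,4) h(5)] by (rule trans[OF sym])
      then have "y = y'" by simp
      with F2Y(2)[OF h(1,3) refl] F2Y(2)[OF h(2,4) h(5)] show "y = y' \<and> S = S'" by simp
    qed
    then have c2: "card F2 = (d + 1) * \<gamma>"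
      unfolding F2_def using finB cB cY by (simp add: card_image card_cartesian_product n_subsets \<gamma>_def)
    have "F1 \<inter> F2 = {}"
    proof -
      have "e \<inter> Y = {}" if "e \<in> F1" for e using that UV YV BY by (auto simp: F1_def)
      moreover have "e \<inter> Y \<noteq> {}" if "e \<in> F2" for e using that by (auto simp: F2_def)
      ultimately show ?thesis by blast
    qed
    moreover have "finite F1" "finite F2" unfolding F1_def F2_def using finU finY finB by auto
    ultimately have c12: "card (F1 \<union> F2) = card U * \<beta> + (d + 1) * \<gamma>"
      using c1 c2 by (simp add: card_Un_disjoint)
    have BW: "B \<subseteq> W" using a3 aV by (auto simp: B_def W_def)
    have "\<alpha> * (card F + card (F1 \<union> F2)) \<le> card W"
    proof (rule extra)
      show "W \<subseteq> {1..n}" using rngV p(1) u(2) by (auto simp: W_def U_def)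
      show "card W \<le> card V + d + 2" using cW cU by simp
      show "V \<subseteq> W" by (auto simp: W_def)
      have "F1 \<subseteq> E"
      proof
        fix e assume "e \<in> F1"
        then obtain y S where "y \<in> Y" "S \<subseteq> B" "card S = s - 1" "e = insert (u y) S" by (auto simp: F1_def U_def)
        then show "e \<in> E" using insE[of y S] by auto
      qed
      moreover have "F2 \<subseteq> E"
      proof
        fix e assume "e \<in> F2"
        then obtain y S where y: "y \<in> Y" "S \<subseteq> B" "card S = s - 2" "e = insert (u y) (insert y S)" by (auto simp: F2_def)
        have "finite S" using y(2) finB finite_subset by blast
        moreover have "y \<notin> S" using BY[OF y(1)] y(2) by auto
        ultimately have "card (insert y S) = s - 1" using y(3) s2 by simp
        then show "e \<in> E" using insE[of y "insert y S"] y by auto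
      qed
      ultimately show "F1 \<union> F2 \<subseteq> E" by simp
      show "\<forall>e\<in>F1 \<union> F2. e \<subseteq> W"
        using BW YV by (fastforce simp: F1_def F2_def U_def W_def)
      have "\<not> e \<subseteq> V" if "e \<in> F1 \<union> F2" for e
        using that uV unfolding F1_def F2_def U_def by auto
      then show "F \<inter> (F1 \<union> F2) = {}" by (intro FnV) blast
    qed
    then have "\<alpha> * (card U * \<beta> + (d + 1) * \<gamma>) \<le> 1 + card U"
      using crit unfolding c12 cW by (simp add: algebra_simps)
    \<comment> \<open>Coinciding \<open>u y\<close> do not help: since
      \<open>\<alpha> * \<beta> < 1\<close>, the inequality is weakest when
      \<open>card U = d + 1\<close>.\<close>
    moreover have "real (card U) * (1 - \<alpha> * \<beta>) \<le> real (d + 1) * (1 - \<alpha> * \<beta>)"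
      using cU critical_exponent_lower_degree[OF s2 ms d] unfolding \<alpha>_def \<beta>_def
      by (intro mult_right_mono of_nat_mono) auto
    ultimately have "real (d + 1) * (\<alpha> * M - 1) \<le> 1"
      unfolding M by (simp add: algebra_simps)
    then have "real (d + 1) * (real m + 1) \<le> real ((m + 1) * d + 1)"
      unfolding exc times_divide_eq_right
      by (subst (asm) pos_divide_le_eq) (simp_all only: of_nat_0_less_iff mult_1)
    \<comment> \<open>The left side exceeds the right side by \<open>m\<close>.\<close>
    then show False using ms by (simp add: algebra_simps)
  qed
  then show ?thesis
    unfolding uncoverable_def E_def[symmetric]
    using inja aV rngV b clu[OF b] XV[of 0] by (intro exI[of _ a] exI[of _ b]) auto
qed

section \<open>The spectrum\<close>

lemma prob_random_hypergraph_uncoverable: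
  assumes "s \<ge> 2" "s - 1 \<le> m" "n \<ge> 1"
  shows "measure_pmf.prob (random_hypergraph s n p) {H. models H (uncoverable_fm s m)} =
    measure_pmf.prob (edge_indicator_pmf s n p) {f. uncoverable s m n (present_edges s n f)}"
proof -
  have "models ({1..n}, present_edges s n f) (uncoverable_fm s m) \<longleftrightarrow> uncoverable s m n (present_edges s n f)" for f
    using assms present_edges_uniform[of s n f] by (intro models_uncoverable_fm) auto
  then show ?thesis
    unfolding random_hypergraph_def measure_map_pmf present_edges_def[symmetric] by (simp add: vimage_def)
qed

text \<open>Given extendability and sparseness, both asymptotically almost sure, the sentence holds
  exactly when the pattern has a copy. The first moment with its factor 1/2 excludes the limit 1,
  and the second moment excludes the limit 0.\<close>

lemma critical_exponent_in_spectrum: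
  assumes s2: "s \<ge> 2" and ms: "m \<ge> s + 1" and d: "d \<ge> (m - 1) choose (s - 1)" and k: "k \<ge> m + 5"
  shows "critical_exponent s m d \<in> spectrum_upto s k"
proof -
  define \<alpha> where "\<alpha> = critical_exponent s m d"
  define V where "V = pattern_vertices m d"
  define E where "E = pattern_edges s m d"
  note pat = uniform_pattern_edges[OF s2, of m d, folded V_def E_def]
  note \<alpha>0 = critical_exponent_pos[OF s2 ms d, folded \<alpha>_def]
  note crit = critical_exponent_critical[OF s2 ms d, folded \<alpha>_def V_def E_def]
  note exc = critical_exponent_excess[OF s2 ms d, folded \<alpha>_def]
  have split: "m choose (s - 1) = ((m - 1) choose (s - 1)) + ((m - 1) choose (s - 2))"
    using s2 ms by (intro choose_split) auto
  have d1: "d \<ge> 1" by (rule d_pos[OF s2 ms d])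
  have small: "d * (\<alpha> * real (m choose (s - 1)) - 1) < 1"
  proof -
    have "d * (m + 1) < (m + 1) * d + 1" by simp
    then have "real (d * (m + 1)) < real ((m + 1) * d + 1)" by (simp only: of_nat_less_iff)
    moreover have "real (d * (m + 1)) = real d * (real m + 1)" by (simp add: algebra_simps)
    moreover have "a / x < 1" if "a < x" "x > 0" for a x :: real using that by simp
    moreover have "real ((m + 1) * d + 1) > 0" by (simp only: of_nat_0_less_iff)
    ultimately show ?thesis unfolding exc times_divide_eq_right by metis
  qed
  \<comment> \<open>With \<open>M = m choose (s - 1) \<ge> 2\<close>, the bound \<open>small\<close>
    and \<open>d \<ge> 1\<close> give \<open>\<alpha> * M < 2\<close>. Hence \<alpha> lies in the
    range \<open>{0<..<real s - 1}\<close>.\<close>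
  have "\<alpha> < 1"
  proof -
    have "2 \<le> m choose (s - 1)"
      using choose_pos(2,3)[OF s2 ms d] split by linarith
    then have "2 * \<alpha> \<le> \<alpha> * real (m choose (s - 1))" using \<alpha>0 by simp
    moreover have "1 * (\<alpha> * real (m choose (s - 1)) - 1) \<le> d * (\<alpha> * real (m choose (s - 1)) - 1)"
      using d1 unfolding exc by (intro mult_right_mono) auto
    ultimately show ?thesis using small by simp
  qed
  then have dom: "\<alpha> \<in> {0<..<real s - 1}" using \<alpha>0 s2 by auto
  define P where "P n = measure_pmf.prob (random_hypergraph s n (real n powr - \<alpha>)) {H. models H (uncoverable_fm s m)}" for n
  define Q where "Q n = edge_indicator_pmf s n (real n powr - \<alpha>)" for n
  define cp where "cp n = measure_pmf.prob (Q n) {f. copies V E n f \<noteq> {}}" for n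
  define sp where "sp n = measure_pmf.prob (Q n) {f. \<not> sparse \<alpha> (card V + d + 2) n (present_edges s n f)}" for n
  define ex where "ex n = measure_pmf.prob (Q n) {f. \<not> extendable s (m - 1) d (m + 1 + d) n (present_edges s n f)}" for n
  have sp0: "sp \<longlonglongrightarrow> 0"
    unfolding sp_def Q_def by (rule prob_not_sparse_tendsto_0[OF \<alpha>0])
  have ex0: "ex \<longlonglongrightarrow> 0"
    unfolding ex_def Q_def
  proof (rule prob_not_extendable_tendsto_0[OF s2 \<alpha>0])
    have M: "real ((m - 1) choose (s - 1)) + real ((m - 1) choose (s - 2)) = real (m choose (s - 1))"
      using split by simp
    show "\<alpha> * real ((m - 1) choose (s - 1)) < 1"
      unfolding \<alpha>_def by (rule critical_exponent_lower_degree[OF s2 ms d])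
    have "0 \<le> \<alpha> * real (m choose (s - 1)) - 1" unfolding exc by simp
    then show "1 \<le> \<alpha> * (real ((m - 1) choose (s - 1)) + real ((m - 1) choose (s - 2)))"
      unfolding M by simp
    show "real d * (\<alpha> * (real ((m - 1) choose (s - 1)) + real ((m - 1) choose (s - 2))) - 1) < 1"
      unfolding M by (rule small)
  qed
  obtain c where c: "c > 0" "\<forall>\<^sub>F n in sequentially. c \<le> cp n"
    using prob_copies_critical_ge[OF pat balanced_pattern[OF s2 ms d, folded \<alpha>_def V_def E_def] \<alpha>0 crit]
    unfolding cp_def Q_def by blast
  have cp_le: "cp n \<le> 1 / 2" if "n \<ge> 1" for n
  proof -
    have "cp n \<le> real n ^ card V * (real n powr - \<alpha>) ^ card E / 2"
      unfolding cp_def Q_def V_def E_def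
      by (rule prob_copies_le_half[OF uniform_pattern_edges[OF s2] _ powr_minus_le_1[OF \<alpha>0] pattern_swap[OF d1]]) simp
    also have "(real n powr - \<alpha>) ^ card E = real n powr - (\<alpha> * card E)"
      using that by (simp add: powr_realpow[symmetric] powr_powr)
    also have "real n ^ card V * real n powr - (\<alpha> * card E) = 1"
      using that unfolding crit by (simp add: powr_minus powr_realpow)
    finally show ?thesis by simp
  qed
  have Peq: "P n = measure_pmf.prob (Q n) {f. uncoverable s m n (present_edges s n f)}" if "n \<ge> 1" for n
    unfolding P_def Q_def using s2 ms that by (intro prob_random_hypergraph_uncoverable) auto
  have upper: "P n \<le> 1 / 2 + ex n" if "n \<ge> 1" for n
  proof -
    have "{f. uncoverable s m n (present_edges s n f)} \<subseteq>
      {f. copies V E n f \<noteq> {}} \<union> {f. \<not> extendable s (m - 1) d (m + 1 + d) n (present_edges s n f)}"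
      using copies_nonempty_if_uncoverable[OF s2 ms] unfolding V_def E_def by blast
    then have "P n \<le> measure_pmf.prob (Q n) ({f. copies V E n f \<noteq> {}} \<union>
        {f. \<not> extendable s (m - 1) d (m + 1 + d) n (present_edges s n f)})"
      unfolding Peq[OF that] by (intro measure_pmf.finite_measure_mono) auto
    also have "\<dots> \<le> cp n + ex n"
      unfolding cp_def ex_def by (rule measure_Un_le) auto
    finally show ?thesis using cp_le[OF that] by linarith
  qed
  have lower: "cp n \<le> P n + sp n" if "n \<ge> 1" for n
  proof -
    have "{f. copies V E n f \<noteq> {}} \<subseteq> {f. uncoverable s m n (present_edges s n f)} \<union>
      {f. \<not> sparse \<alpha> (card V + d + 2) n (present_edges s n f)}"
      using uncoverable_if_copies_nonempty[OF s2 ms d] unfolding V_def E_def \<alpha>_def by blast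
    then have "cp n \<le> measure_pmf.prob (Q n) ({f. uncoverable s m n (present_edges s n f)} \<union>
      {f. \<not> sparse \<alpha> (card V + d + 2) n (present_edges s n f)})"
      unfolding cp_def by (intro measure_pmf.finite_measure_mono) auto
    also have "\<dots> \<le> P n + sp n"
      unfolding Peq[OF that] sp_def by (rule measure_Un_le) auto
    finally show ?thesis .
  qed
  have "\<not> P \<longlonglongrightarrow> 0"
  proof
    assume "P \<longlonglongrightarrow> 0"
    then have "(\<lambda>n. P n + sp n) \<longlonglongrightarrow> 0 + 0" by (intro tendsto_add sp0)
    then have "\<forall>\<^sub>F n in sequentially. P n + sp n < c" using c(1) by (intro order_tendstoD) auto
    then have "\<forall>\<^sub>F n in sequentially. False"
      using c(2) eventually_ge_at_top[of 1]
      by eventually_elim (use lower in force)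
    then show False by simp
  qed
  moreover have "\<not> P \<longlonglongrightarrow> 1"
  proof
    assume "P \<longlonglongrightarrow> 1"
    then have "(\<lambda>n. P n - ex n) \<longlonglongrightarrow> 1 - 0" by (intro tendsto_diff ex0)
    then have "\<forall>\<^sub>F n in sequentially. 1 / 2 < P n - ex n" by (intro order_tendstoD) auto
    then have "\<forall>\<^sub>F n in sequentially. False"
      using eventually_ge_at_top[of 1]
      by eventually_elim (use upper in force)
    then show False by simp
  qed
  ultimately have "\<alpha> \<in> spectrum s {H. models H (uncoverable_fm s m)}"
    unfolding spectrum_def using dom by (auto simp: P_def[abs_def])
  then show ?thesis
    unfolding spectrum_upto_def \<alpha>_def using uncoverable_fm_property[OF s2 k] by blast
qed

text \<open>As \<open>d\<close> grows, the critical exponents tend to \<open>1 / M\<close> with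
  \<open>M = m choose (s - 1)\<close>, and all of them exceed it strictly.\<close>

lemma limit_point_spectrum_upto:
  assumes "s \<ge> 2" "m \<ge> s + 1" "k \<ge> m + 5"
  shows "1 / real (m choose (s - 1)) \<in> limit_points (spectrum_upto s k)"
proof -
  define \<beta> where "\<beta> = (m - 1) choose (s - 1)"
  \<comment> \<open>The shift by \<open>\<beta>\<close> meets the lower bound on
    \<open>d\<close>.\<close>
  define g where "g i = critical_exponent s m (i + \<beta>)" for i
  have M: "real (m choose (s - 1)) > 0" using assms(2) by (simp add: zero_less_binomial_iff)
  have "g i \<in> spectrum_upto s k - {1 / real (m choose (s - 1))}" for i
  proof -
    have "critical_exponent s m (i + \<beta>) \<noteq> 1 / real (m choose (s - 1))"
    proof -
      have "(real m + 1) / ((real m + 1) * real (i + \<beta>) + 1) > 0"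
        by (intro divide_pos_pos add_nonneg_pos) auto
      moreover have "(1 + t) / x \<noteq> 1 / x" if "t > 0" "x > 0" for t x :: real
        using that by (simp add: field_simps)
      ultimately show ?thesis using M unfolding critical_exponent_def by blast
    qed
    moreover have "critical_exponent s m (i + \<beta>) \<in> spectrum_upto s k"
      by (rule critical_exponent_in_spectrum[OF assms(1,2) _ assms(3)]) (simp add: \<beta>_def)
    ultimately show ?thesis by (simp add: g_def)
  qed
  moreover have "g \<longlonglongrightarrow> 1 / real (m choose (s - 1))"
  proof -
    have "(\<lambda>i. (1 + (real m + 1) / ((real m + 1) * real (i + \<beta>) + 1)) / real (m choose (s - 1))) \<longlonglongrightarrow>
        (1 + 0) / real (m choose (s - 1))"
    proof (intro tendsto_divide tendsto_add tendsto_const real_tendsto_divide_at_top[of _ "real m + 1"])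
      have "filterlim (\<lambda>i. real (i + \<beta>)) at_top sequentially"
        by (intro filterlim_compose[OF filterlim_real_sequentially] filterlim_add_const_nat_at_top)
      then have "filterlim (\<lambda>i. 1 + (real m + 1) * real (i + \<beta>)) at_top sequentially"
        by (intro filterlim_tendsto_add_at_top[OF tendsto_const]
            filterlim_tendsto_pos_mult_at_top[OF tendsto_const]) auto
      then show "filterlim (\<lambda>i. (real m + 1) * real (i + \<beta>) + 1) at_top sequentially"
        by (simp only: add.commute)
    qed (use M in auto)
    then show ?thesis by (simp add: g_def[abs_def] critical_exponent_def)
  qed
  ultimately show ?thesis
    unfolding limit_points_def islimpt_sequential by blast
qed

theorem theorem10:
  fixes s :: nat
  assumes "s \<ge> 2"
  shows "\<exists>C::nat. \<forall>k\<ge>s + C.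
           \<exists>m\<in>limit_points (spectrum_upto s k).
             (\<forall>x\<in>limit_points (spectrum_upto s k). m \<le> x) \<and>
             m \<le> 1 / real ((k - 11) choose (s - 1))"
proof (intro exI allI impI)
  \<comment> \<open>\<open>C = 12\<close> makes \<open>m = k - 11\<close> at least
    \<open>s + 1\<close>; the required depth \<open>m + 5\<close> is then below
    \<open>k\<close>.\<close>
  fix k assume k: "s + 12 \<le> k"
  define L where "L = limit_points (spectrum_upto s k)"
  have in_L: "1 / real ((k - 11) choose (s - 1)) \<in> L"
    unfolding L_def using assms k by (intro limit_point_spectrum_upto) auto
  have "spectrum_upto s k \<subseteq> {0..}"
    by (auto simp: spectrum_upto_def spectrum_def)
  then have "x \<in> {0..}" if "x \<in> L" for x
    using that closed_limpt[of "{0 :: real..}"] islimpt_subset unfolding L_def limit_points_def by blast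
  then have bdd: "bdd_below L" by (intro bdd_belowI[of _ 0]) auto
  \<comment> \<open>A minimum exists: the set of limit points is closed, nonempty and bounded below
    by 0, so it contains its infimum.\<close>
  have "closed L" unfolding L_def limit_points_def by (rule closed_limpts)
  then have "Inf L \<in> L" using in_L bdd by (intro closed_contains_Inf) auto
  then show "\<exists>m\<in>limit_points (spectrum_upto s k). (\<forall>x\<in>limit_points (spectrum_upto s k). m \<le> x) \<and>
             m \<le> 1 / real ((k - 11) choose (s - 1))"
    using in_L bdd unfolding L_def by (intro bexI[of _ "Inf (limit_points (spectrum_upto s k))"])
      (auto intro: cInf_lower)
qed

end
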